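(* Let $d\ge 2$ and $\tilde m\ge 1$ be integers, let $\Phi:\mathbb{S}^d\times\mathbb{S}^d\to\mathbb{R}$ be a zonal kernel with expansion coefficients $(c_\ell)_{\ell\ge0}$ that is conditionally positive definite of order $\tilde m$, and let $\mathcal{L}=p(\Delta)$ with $p:\sigma(\Delta)\to(0,\infty)$ such that $\lambda_\ell=p(\nu_\ell)$ grows at most algebraically in $\ell$ and $\sum_{\ell=0}^\infty c_\ell|\lambda_\ell|\ell^{d-1}$ converges absolutely. Then for every finite $\Pi_{\tilde m-1}$-unisolvent set $X\subset\mathbb{S}^d$, the spectrum of the differentiation matrix $\mathbf{M}_X$ satisfies $\sigma(\mathbf{M}_X)\subset(0,\infty)$.
   Context: $\mathbb{S}^d\subset\mathbb{R}^{d+1}$ is the unit sphere and $\Delta$ its Laplace-Beltrami operator, with eigenvalues $\nu_\ell=-\ell(\ell+d-1)$, $\ell=0,1,2,\dots$; $\{Y_\ell^\mu\}_{\mu=1}^{N_\ell}$ is an $L_2(\mathbb{S}^d)$-orthonormal basis of real spherical harmonics of degree $\ell$. $\Pi_{k}=\mathrm{span}\{Y_\ell^\mu:\ell\le k,\ \mu\le N_\ell\}$. The operator $\mathcal{L}=p(\Delta)$ acts by $\mathcal{L}Y_\ell^\mu=\lambda_\ell Y_\ell^\mu$ with $\lambda_\ell=p(\nu_\ell)$. A zonal kernel is one with an absolutely and uniformly convergent expansion $\Phi(x,y)=\sum_{\ell=0}^\infty\sum_{\mu\le N_\ell}c_\ell Y_\ell^\mu(x)Y_\ell^\mu(y)$.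 It is conditionally positive definite (CPD) of order $\tilde m$ if for every finite set $X=\{x_1,\dots,x_N\}\subset\mathbb{S}^d$ of distinct points, $\mathbf{\Phi}_X=(\Phi(x_j,x_k))_{j,k}$ is strictly positive definite on $\{\alpha\in\mathbb{R}^N:\sum_j\alpha_jp(x_j)=0\ \forall p\in\Pi_{\tilde m-1}\}$. It is known that a zonal kernel is CPD of order $\tilde m$ if and only if $c_\ell\ge0$ for all $\ell\ge\tilde m$ and $c_\ell>0$ for infinitely many even and infinitely many odd $\ell$. The trial space is $S_X(\Phi)=\{\sum_ja_j\Phi(\cdot,x_j):\sum_ja_jp(x_j)=0\ \forall p\in\Pi_{\tilde m-1}\}+\Pi_{\tilde m-1}$. $X$ is $\Pi_{\tilde m-1}$-unisolvent if the only element of $\Pi_{\tilde m-1}$ vanishing on $X$ is $0$. The differentiation matrix $\mathbf{M}_X\in\mathbb{R}^{N\times N}$ is the unique matrix with $\mathbf{M}_X(u|_X)=(\mathcal{L}u)|_X$ for all $u\in S_X(\Phi)$, where $\mathcal{L}\Phi(x,y)=\sum_\ell\sum_\mu c_\ell\lambda_\ell Y_\ell^\mu(x)Y_\ell^\mu(y)$ ($\mathcal{L}$ acts on the first argument). *)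

theory Defs
  imports
    "HOL-Analysis.Analysis"
    "HOL-Library.Landau_Symbols"
    "Jordan_Normal_Form.Spectral_Radius"
begin

text \<open>
  The sphere \<open>S\<^sup>d\<close> is \<open>sphere 0 1\<close> in a Euclidean space \<open>'a\<close> with \<open>DIM('a) = d + 1\<close>. Functions on
  the sphere are functions on \<open>'a\<close> of which only the values on the sphere matter.
\<close>

section \<open>Surface measure\<close>

text \<open>
  The surface measure of a Borel set \<open>A\<close> of the sphere is \<open>DIM('a)\<close> times the volume of the cone
  \<open>{t x | 0 < t < 1, x \<in> A}\<close>; recall \<open>sgn x = x / norm x\<close>.
\<close>

definition sphere_measure :: "'a::euclidean_space measure" where
  "sphere_measure =
     scale_measure (of_nat DIM('a))
       (distr (restrict_space lborel (ball 0 1 - {0})) (restrict_space borel (sphere 0 1)) sgn)"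

definition sphere_inner :: "('a::euclidean_space \<Rightarrow> real) \<Rightarrow> ('a \<Rightarrow> real) \<Rightarrow> real" where
  "sphere_inner f g = (LINT x|sphere_measure. f x * g x)"

section \<open>Laplace-Beltrami operator\<close>

definition laplacian :: "('a::euclidean_space \<Rightarrow> real) \<Rightarrow> 'a \<Rightarrow> real" where
  "laplacian f x = (\<Sum>b\<in>Basis. deriv (deriv (\<lambda>t. f (x + t *\<^sub>R b))) 0)"

text \<open>
  The Laplace-Beltrami operator of the unit sphere is the Euclidean Laplacian of the extension
  that is constant along rays from the origin.
\<close>

definition laplace_beltrami :: "('a::euclidean_space \<Rightarrow> real) \<Rightarrow> 'a \<Rightarrow> real" where
  "laplace_beltrami u = laplacian (\<lambda>z. u (sgn z))"

definition C2_on :: "'a::euclidean_space set \<Rightarrow> ('a \<Rightarrow> real) \<Rightarrow> bool" where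
  "C2_on S f \<longleftrightarrow>
     (\<exists>(f' :: 'a \<Rightarrow> ('a \<Rightarrow>\<^sub>L real)) (f'' :: 'a \<Rightarrow> ('a \<Rightarrow>\<^sub>L ('a \<Rightarrow>\<^sub>L real))).
        (\<forall>x\<in>S. (f has_derivative blinfun_apply (f' x)) (at x)) \<and>
        (\<forall>x\<in>S. (f' has_derivative blinfun_apply (f'' x)) (at x)) \<and>
        continuous_on S f'')"

text \<open>
  The spectrum of the Laplace-Beltrami operator is pure point spectrum, so it is the set of
  eigenvalues. The type argument selects the ambient space.
\<close>

definition laplace_beltrami_spectrum :: "'a::euclidean_space itself \<Rightarrow> real set" where
  "laplace_beltrami_spectrum _ =
     {\<nu>. \<exists>u :: 'a \<Rightarrow> real.
        C2_on (- {0}) (\<lambda>z. u (sgn z)) \<and>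
        (\<exists>x\<in>sphere 0 1. u x \<noteq> 0) \<and>
        (\<forall>x\<in>sphere 0 1. laplace_beltrami u x = \<nu> * u x)}"

definition sphere_eigenvalue :: "nat \<Rightarrow> nat \<Rightarrow> real" where
  "sphere_eigenvalue d l = - (real l * (real l + real d - 1))"

section \<open>Spherical harmonics\<close>

definition spherical_harmonic :: "nat \<Rightarrow> ('a::euclidean_space \<Rightarrow> real) \<Rightarrow> bool" where
  "spherical_harmonic l h \<longleftrightarrow>
     (\<exists>P. real_polynomial_function P \<and>
          (\<forall>t x. P (t *\<^sub>R x) = t ^ l * P x) \<and>
          (\<forall>x. laplacian P x = 0) \<and>
          (\<forall>x\<in>sphere 0 1. h x = P x))"

text \<open>
  \<open>Y l 1, \<dots>, Y l (N l)\<close> is an orthonormal basis, with respect to the \<open>L\<^sub>2\<close> inner product of the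
  sphere, of the space of spherical harmonics of degree \<open>l\<close>, for every \<open>l\<close>.
\<close>

definition spherical_harmonic_bases ::
    "(nat \<Rightarrow> nat \<Rightarrow> 'a::euclidean_space \<Rightarrow> real) \<Rightarrow> (nat \<Rightarrow> nat) \<Rightarrow> bool" where
  "spherical_harmonic_bases Y N \<longleftrightarrow>
     (\<forall>l. (\<forall>\<mu>\<in>{1..N l}. spherical_harmonic l (Y l \<mu>)) \<and>
          (\<forall>\<mu>\<in>{1..N l}. \<forall>\<kappa>\<in>{1..N l}.
             sphere_inner (Y l \<mu>) (Y l \<kappa>) = (if \<mu> = \<kappa> then 1 else 0)) \<and>
          (\<forall>h. spherical_harmonic l h \<longrightarrow>
             (\<exists>b. \<forall>x\<in>sphere 0 1. h x = (\<Sum>\<mu>=1..N l. b \<mu> * Y l \<mu> x))))"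

definition harmonic_span ::
    "(nat \<Rightarrow> nat \<Rightarrow> 'a \<Rightarrow> real) \<Rightarrow> (nat \<Rightarrow> nat) \<Rightarrow> nat \<Rightarrow> ('a \<Rightarrow> real) set" where
  "harmonic_span Y N k = {\<lambda>x. \<Sum>l\<le>k. \<Sum>\<mu>=1..N l. b l \<mu> * Y l \<mu> x | b. True}"

definition unisolvent :: "('a::euclidean_space \<Rightarrow> real) set \<Rightarrow> 'a set \<Rightarrow> bool" where
  "unisolvent V X \<longleftrightarrow>
     (\<forall>q\<in>V. (\<forall>x\<in>X. q x = 0) \<longrightarrow> (\<forall>x\<in>sphere 0 1. q x = 0))"

text \<open>
  The operator acting on spherical harmonics of degree \<open>l\<close> as multiplication by \<open>lam l\<close>; it is
  \<open>p(\<Delta>)\<close> for \<open>lam l = p(\<nu>\<^sub>l)\<close>.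
\<close>

definition harmonic_multiplier ::
    "(nat \<Rightarrow> nat \<Rightarrow> 'a::euclidean_space \<Rightarrow> real) \<Rightarrow> (nat \<Rightarrow> nat) \<Rightarrow> (nat \<Rightarrow> real) \<Rightarrow>
     ('a \<Rightarrow> real) \<Rightarrow> 'a \<Rightarrow> real" where
  "harmonic_multiplier Y N lam u x =
     (\<Sum>l. \<Sum>\<mu>=1..N l. lam l * sphere_inner u (Y l \<mu>) * Y l \<mu> x)"

section \<open>Zonal kernels\<close>

definition zonal_kernel ::
    "(nat \<Rightarrow> nat \<Rightarrow> 'a::euclidean_space \<Rightarrow> real) \<Rightarrow> (nat \<Rightarrow> nat) \<Rightarrow> (nat \<Rightarrow> real) \<Rightarrow>
     ('a \<Rightarrow> 'a \<Rightarrow> real) \<Rightarrow> bool" where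
  "zonal_kernel Y N c \<Phi> \<longleftrightarrow>
     (\<forall>x\<in>sphere 0 1. \<forall>y\<in>sphere 0 1.
        summable (\<lambda>l. \<Sum>\<mu>=1..N l. \<bar>c l * Y l \<mu> x * Y l \<mu> y\<bar>)) \<and>
     uniform_limit (sphere 0 1 \<times> sphere 0 1)
       (\<lambda>n (x, y). \<Sum>l<n. \<Sum>\<mu>=1..N l. c l * Y l \<mu> x * Y l \<mu> y)
       (\<lambda>(x, y). \<Phi> x y) sequentially"

definition annihilates :: "('a \<Rightarrow> real) set \<Rightarrow> 'a set \<Rightarrow> ('a \<Rightarrow> real) \<Rightarrow> bool" where
  "annihilates V X a \<longleftrightarrow> (\<forall>q\<in>V. (\<Sum>x\<in>X. a x * q x) = 0)"

text \<open>Vectors indexed by a finite point set \<open>X\<close> are functions of which only the values on \<open>X\<close> matter.\<close>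

definition conditionally_positive_definite ::
    "('a::euclidean_space \<Rightarrow> real) set \<Rightarrow> ('a \<Rightarrow> 'a \<Rightarrow> real) \<Rightarrow> bool" where
  "conditionally_positive_definite V \<Phi> \<longleftrightarrow>
     (\<forall>X \<alpha>. finite X \<and> X \<subseteq> sphere 0 1 \<and> annihilates V X \<alpha> \<and> (\<exists>x\<in>X. \<alpha> x \<noteq> 0) \<longrightarrow>
        0 < (\<Sum>x\<in>X. \<Sum>y\<in>X. \<alpha> x * \<alpha> y * \<Phi> x y))"

definition trial_space ::
    "('a \<Rightarrow> real) set \<Rightarrow> ('a \<Rightarrow> 'a \<Rightarrow> real) \<Rightarrow> 'a set \<Rightarrow> ('a \<Rightarrow> real) set" where
  "trial_space V \<Phi> X =
     {\<lambda>x. (\<Sum>y\<in>X. a y * \<Phi> x y) + q x | a q. annihilates V X a \<and> q \<in> V}"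

text \<open>The list \<open>xs\<close> enumerates the points, and \<open>S\<close> and \<open>L\<close> are the trial space and the operator.\<close>

definition differentiation_matrix ::
    "('a \<Rightarrow> real) set \<Rightarrow> (('a \<Rightarrow> real) \<Rightarrow> ('a \<Rightarrow> real)) \<Rightarrow> 'a list \<Rightarrow> real mat" where
  "differentiation_matrix S L xs =
     (THE M. M \<in> carrier_mat (length xs) (length xs) \<and>
        (\<forall>u\<in>S. M *\<^sub>v vec_of_list (map u xs) = vec_of_list (map (L u) xs)))"

end

(*
  Write an eigenfunction for the eigenvalue t as u = sum_y a_y Phi(., y) + q with a annihilating
  Pi_{m-1}, and pair M u = t u with a: the polynomial part drops out, and
  sum_l c_l lam_l s_l = t sum_l c_l s_l, where s_l >= 0 is the energy of a in degree l and s_l = 0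
  for l < m. Conditional positive definiteness forces c_l >= 0 for l >= m and makes the right-hand
  sum positive if a is nonzero, so t > 0. If a = 0, then u = q lies in Pi_{m-1}, and by
  unisolvence t is one of the lam_l.

  Convergence of the series for L Phi needs sum_mu |Y_l^mu(x) Y_l^mu(y)| = O(l^(d-1)). By rotation
  invariance sum_mu Y_l^mu(x)^2 is the constant N_l / |S^d|. Further N_l = O(l^(d-1)), since a
  harmonic homogeneous polynomial is determined by its values and normal derivatives at the points
  of a grid in an affine subspace of dimension d - 1.
*)

theory Submission
  imports Defs
begin

text \<open>The matrix need not be symmetric, so an eigenvalue \<sigma> + i \<omega> is handled
  through two real trial functions. The forms with coefficients \<open>c\<close> and
  \<open>c * lam\<close> are both symmetric, so the imaginary part of the paired equation is 0 =
  \<omega> * (a sum of two energies), which forces \<omega> = 0 unless both trial functions are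
  polynomials. Conditional positive definiteness speaks of finite sets only, while c_l >= 0 concerns
  integrals against a harmonic. Discrete weights that approximate the integral annihilate the
  polynomials only in the limit; the unisolvent set X absorbs the error exactly. The hypothesis on p
  gives positivity only on the analytically defined spectrum, so -l (l + d - 1) must be realised by
  a C^2 eigenfunction; degrees without a nonzero harmonic contribute nothing to the series. The
  surface measure is given by cones over Lebesgue measure. Its rotation invariance makes rotational
  derivatives integrate to zero, and the sum of their squares acts on degree l as twice the
  eigenvalue, whence orthogonality of different degrees.\<close>

no_notation Matrix.scalar_prod (infix "\<bullet>" 70)

section \<open>Directional derivatives of polynomial functions\<close>

text \<open>Taken from the total derivative, so that linearity in the direction \<open>v\<close> and
  the chain rule come for free.\<close>

definition dir_deriv :: "'a::real_normed_vector \<Rightarrow> ('a \<Rightarrow> real) \<Rightarrow> 'a \<Rightarrow> real" where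
  "dir_deriv v f x = frechet_derivative f (at x) v"

lemma dir_deriv_eqI: "(f has_derivative D) (at x) \<Longrightarrow> dir_deriv v f x = D v"
  unfolding dir_deriv_def by (metis frechet_derivative_at)

lemma has_derivative_dir_deriv:
  "real_polynomial_function f \<Longrightarrow> (f has_derivative (\<lambda>h. dir_deriv h f x)) (at x)"
  unfolding dir_deriv_def
  using differentiable_at_real_polynomial_function frechet_derivative_works by fast

lemma has_derivative_dir_deriv_chain:
  "real_polynomial_function f \<Longrightarrow> (g has_derivative g') (at x within S) \<Longrightarrow>
   ((\<lambda>x. f (g x)) has_derivative (\<lambda>h. dir_deriv (g' h) f (g x))) (at x within S)"
  using has_derivative_compose[OF _ has_derivative_dir_deriv] by blast

lemma linear_dir_deriv: "real_polynomial_function f \<Longrightarrow> linear (\<lambda>h. dir_deriv h f x)"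
  using has_derivative_dir_deriv has_derivative_linear by blast

lemma dir_deriv_const [simp]: "dir_deriv v (\<lambda>x. c) x = 0"
  by (rule dir_deriv_eqI[where D="\<lambda>_. 0"]) simp

lemma dir_deriv_bounded_linear: "bounded_linear f \<Longrightarrow> dir_deriv v f x = f v"
  by (rule dir_deriv_eqI) (rule bounded_linear_imp_has_derivative)

lemma dir_deriv_inner [simp]: "dir_deriv v (\<lambda>x. x \<bullet> b) x = v \<bullet> b"
  by (rule dir_deriv_bounded_linear) (rule bounded_linear_inner_left)

lemma dir_deriv_add:
  "real_polynomial_function f \<Longrightarrow> real_polynomial_function g \<Longrightarrow>
   dir_deriv v (\<lambda>x. f x + g x) x = dir_deriv v f x + dir_deriv v g x"
  by (rule dir_deriv_eqI) (intro has_derivative_add has_derivative_dir_deriv)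

lemma dir_deriv_diff:
  "real_polynomial_function f \<Longrightarrow> real_polynomial_function g \<Longrightarrow>
   dir_deriv v (\<lambda>x. f x - g x) x = dir_deriv v f x - dir_deriv v g x"
  by (rule dir_deriv_eqI) (intro has_derivative_diff has_derivative_dir_deriv)

lemma dir_deriv_mult:
  "real_polynomial_function f \<Longrightarrow> real_polynomial_function g \<Longrightarrow>
   dir_deriv v (\<lambda>x. f x * g x) x = f x * dir_deriv v g x + dir_deriv v f x * g x"
  by (rule dir_deriv_eqI) (intro has_derivative_mult has_derivative_dir_deriv)

lemma dir_deriv_cmult:
  "real_polynomial_function g \<Longrightarrow> dir_deriv v (\<lambda>x. c * g x) x = c * dir_deriv v g x"
  by (simp add: dir_deriv_mult real_polynomial_function.intros(2))

lemma dir_deriv_sum: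
  "(\<And>i. i \<in> I \<Longrightarrow> real_polynomial_function (f i)) \<Longrightarrow>
   dir_deriv v (\<lambda>x. \<Sum>i\<in>I. f i x) x = (\<Sum>i\<in>I. dir_deriv v (f i) x)"
  by (rule dir_deriv_eqI) (intro has_derivative_sum has_derivative_dir_deriv)

lemma real_polynomial_function_dir_deriv [intro]:
  assumes "real_polynomial_function f"
  shows "real_polynomial_function (dir_deriv v f)"
  using assms
proof induction
  case (linear f)
  then have "dir_deriv v f = (\<lambda>_. f v)" by (simp add: fun_eq_iff dir_deriv_bounded_linear)
  then show ?case by (simp add: real_polynomial_function.intros(2))
next
  case (const c)
  then show ?case by (simp add: dir_deriv_const[abs_def] real_polynomial_function.intros(2))
next
  case (add f g)
  then have "dir_deriv v (\<lambda>x. f x + g x) = (\<lambda>x. dir_deriv v f x + dir_deriv v g x)"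
    by (simp add: fun_eq_iff dir_deriv_add)
  with add show ?case by (simp add: real_polynomial_function.intros(3))
next
  case (mult f g)
  then have "dir_deriv v (\<lambda>x. f x * g x) = (\<lambda>x. f x * dir_deriv v g x + dir_deriv v f x * g x)"
    by (simp add: fun_eq_iff dir_deriv_mult)
  with mult show ?case by (simp add: real_polynomial_function.intros(3,4))
qed

text \<open>Induction on the construction of the polynomial: the product rule, expanded twice, is
  symmetric in \<open>u\<close> and \<open>v\<close>.\<close>

lemma dir_deriv_commute:
  assumes "real_polynomial_function f"
  shows "dir_deriv u (dir_deriv v f) x = dir_deriv v (dir_deriv u f) x"
  using assms
proof (induction arbitrary: x)
  case (linear f)
  then have "dir_deriv w f = (\<lambda>_. f w)" for w by (simp add: fun_eq_iff dir_deriv_bounded_linear)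
  then show ?case by simp
next
  case (const c)
  then show ?case by (simp add: dir_deriv_const[abs_def])
next
  case (add f g)
  then have "dir_deriv w (\<lambda>x. f x + g x) = (\<lambda>x. dir_deriv w f x + dir_deriv w g x)" for w
    by (simp add: fun_eq_iff dir_deriv_add)
  with add show ?case by (simp add: dir_deriv_add real_polynomial_function_dir_deriv)
next
  case (mult f g)
  then have "dir_deriv w (\<lambda>x. f x * g x) = (\<lambda>x. f x * dir_deriv w g x + dir_deriv w f x * g x)" for w
    by (simp add: fun_eq_iff dir_deriv_mult)
  with mult show ?case
    by (simp add: dir_deriv_mult dir_deriv_add real_polynomial_function_dir_deriv
        real_polynomial_function.intros(4))
qed

lemma DERIV_dir_deriv_line:
  assumes "real_polynomial_function f"
  shows "((\<lambda>t. f (x + t *\<^sub>R v)) has_real_derivative dir_deriv v f (x + t *\<^sub>R v)) (at t)"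
proof -
  have "((\<lambda>t. f (x + t *\<^sub>R v)) has_derivative (\<lambda>h. dir_deriv (h *\<^sub>R v) f (x + t *\<^sub>R v))) (at t)"
    by (rule has_derivative_dir_deriv_chain[OF assms]) (auto intro!: derivative_eq_intros)
  moreover have "(\<lambda>h. dir_deriv (h *\<^sub>R v) f (x + t *\<^sub>R v)) = (*) (dir_deriv v f (x + t *\<^sub>R v))"
    using linear_scale[OF linear_dir_deriv[OF assms]] by (auto simp: fun_eq_iff)
  ultimately show ?thesis by (simp add: has_field_derivative_def)
qed

lemma laplacian_eq_sum_dir_deriv:
  assumes "real_polynomial_function f"
  shows "laplacian f x = (\<Sum>b\<in>Basis. dir_deriv b (dir_deriv b f) x)"
proof -
  have "deriv (deriv (\<lambda>t. f (x + t *\<^sub>R b))) 0 = dir_deriv b (dir_deriv b f) x" for b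
  proof -
    have "deriv (\<lambda>t. f (x + t *\<^sub>R b)) = (\<lambda>t. dir_deriv b f (x + t *\<^sub>R b))"
      using DERIV_imp_deriv[OF DERIV_dir_deriv_line[OF assms]] by blast
    moreover have "deriv (\<lambda>t. dir_deriv b f (x + t *\<^sub>R b)) 0 = dir_deriv b (dir_deriv b f) x"
      using DERIV_imp_deriv[OF DERIV_dir_deriv_line[OF real_polynomial_function_dir_deriv[OF assms],
          where x=x and v=b and t=0]]
      by simp
    ultimately show ?thesis by simp
  qed
  then show ?thesis by (simp add: laplacian_def)
qed

lemma dir_deriv_Basis:
  fixes f :: "'a::euclidean_space \<Rightarrow> real"
  assumes "real_polynomial_function f"
  shows "dir_deriv v f x = (\<Sum>b\<in>Basis. (v \<bullet> b) * dir_deriv b f x)"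
proof -
  have "dir_deriv v f x = dir_deriv (\<Sum>b\<in>Basis. (v \<bullet> b) *\<^sub>R b) f x"
    by (simp add: euclidean_representation)
  also have "\<dots> = (\<Sum>b\<in>Basis. (v \<bullet> b) * dir_deriv b f x)"
    by (simp only: linear_sum[OF linear_dir_deriv[OF assms]] linear_scale[OF linear_dir_deriv[OF assms]]
        real_scaleR_def)
  finally show ?thesis .
qed

lemma real_polynomial_function_inner [intro]: "real_polynomial_function (\<lambda>x. x \<bullet> b)"
  by (rule real_polynomial_function.intros(1)) (rule bounded_linear_inner_left)

lemma continuous_on_real_polynomial_function:
  "real_polynomial_function f \<Longrightarrow> continuous_on S f"
  by (simp add: differentiable_imp_continuous_on differentiable_on_real_polynomial_function)

lemma isCont_real_polynomial_function:
  "real_polynomial_function f \<Longrightarrow> isCont f x"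
  by (simp add: differentiable_at_real_polynomial_function differentiable_imp_continuous_within)

section \<open>Homogeneous polynomial functions\<close>

definition homogeneous :: "nat \<Rightarrow> ('a::real_vector \<Rightarrow> real) \<Rightarrow> bool" where
  "homogeneous l f \<longleftrightarrow> (\<forall>t x. f (t *\<^sub>R x) = t ^ l * f x)"

text \<open>Differentiate t^l * f x in t in two ways. Both Euler identities below are the case t = 1
  of this formula and of its derivative.\<close>

lemma homogeneous_dir_deriv_radial:
  assumes f: "real_polynomial_function f" and h: "homogeneous l f"
  shows "dir_deriv x f (t *\<^sub>R x) = real l * t ^ (l - 1) * f x"
proof -
  have "((\<lambda>t. f (0 + t *\<^sub>R x)) has_real_derivative dir_deriv x f (0 + t *\<^sub>R x)) (at t)"
    by (rule DERIV_dir_deriv_line[OF f])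
  moreover have "(\<lambda>t. f (0 + t *\<^sub>R x)) = (\<lambda>t. t ^ l * f x)"
    using h by (auto simp: homogeneous_def)
  moreover have "((\<lambda>t. t ^ l * f x) has_real_derivative real l * t ^ (l - 1) * f x) (at t)"
    by (auto intro!: derivative_eq_intros)
  ultimately show ?thesis by (metis DERIV_unique add_0)
qed

lemma homogeneous_Euler:
  assumes f: "real_polynomial_function f" and h: "homogeneous l f"
  shows "dir_deriv x f x = real l * f x"
  using homogeneous_dir_deriv_radial[OF f h, of x 1] by simp

lemma homogeneous_Euler2:
  assumes f: "real_polynomial_function f" and h: "homogeneous l f"
  shows "dir_deriv x (dir_deriv x f) x = real l * (real l - 1) * f x"
proof -
  have "((\<lambda>t. dir_deriv x f (0 + t *\<^sub>R x)) has_real_derivative dir_deriv x (dir_deriv x f) (0 + 1 *\<^sub>R x)) (at 1)"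
    by (rule DERIV_dir_deriv_line) (rule real_polynomial_function_dir_deriv[OF f])
  moreover have "(\<lambda>t. dir_deriv x f (0 + t *\<^sub>R x)) = (\<lambda>t. real l * t ^ (l - 1) * f x)"
    using homogeneous_dir_deriv_radial[OF f h] by auto
  moreover have "((\<lambda>t. real l * t ^ (l - 1) * f x) has_real_derivative
      real l * real (l - 1) * f x) (at 1)"
    by (auto intro!: derivative_eq_intros)
  ultimately have "dir_deriv x (dir_deriv x f) x = real l * real (l - 1) * f x"
    using DERIV_unique by (metis add_0 scaleR_one)
  then show ?thesis by (cases l) auto
qed

lemma homogeneous_dir_deriv:
  assumes f: "real_polynomial_function f" and h: "homogeneous l f"
  shows "homogeneous (l - 1) (dir_deriv v f)"
proof (cases l)
  case 0
  then have "f = (\<lambda>x. f 0)"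
    using h unfolding homogeneous_def by (metis mult_1 power_0 scaleR_zero_left)
  then have "dir_deriv v f x = 0" for x
    by (metis dir_deriv_const)
  then show ?thesis by (simp add: homogeneous_def)
next
  case (Suc k)
  \<comment> \<open>Differentiate f (t (x + s v)) = t^l * f (x + s v) at s = 0 and cancel one factor
    t. The case t = 0 follows afterwards by continuity.\<close>
  have nz: "dir_deriv v f (t *\<^sub>R x) = t ^ k * dir_deriv v f x" if "t \<noteq> 0" for t x
  proof -
    have "((\<lambda>s. f (t *\<^sub>R x + s *\<^sub>R (t *\<^sub>R v))) has_real_derivative dir_deriv (t *\<^sub>R v) f (t *\<^sub>R x + 0 *\<^sub>R (t *\<^sub>R v))) (at 0)"
      by (rule DERIV_dir_deriv_line[OF f])
    moreover have "(\<lambda>s. f (t *\<^sub>R x + s *\<^sub>R (t *\<^sub>R v))) = (\<lambda>s. t ^ l * f (x + s *\<^sub>R v))"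
    proof
      fix s
      have "t *\<^sub>R x + s *\<^sub>R (t *\<^sub>R v) = t *\<^sub>R (x + s *\<^sub>R v)" by (simp add: algebra_simps)
      then show "f (t *\<^sub>R x + s *\<^sub>R (t *\<^sub>R v)) = t ^ l * f (x + s *\<^sub>R v)"
        using h by (metis homogeneous_def)
    qed
    moreover have "((\<lambda>s. t ^ l * f (x + s *\<^sub>R v)) has_real_derivative t ^ l * dir_deriv v f (x + 0 *\<^sub>R v)) (at 0)"
      by (rule DERIV_cmult[OF DERIV_dir_deriv_line[OF f]])
    ultimately have "dir_deriv (t *\<^sub>R v) f (t *\<^sub>R x) = t ^ l * dir_deriv v f x"
      using DERIV_unique by fastforce
    moreover have "dir_deriv (t *\<^sub>R v) f (t *\<^sub>R x) = t * dir_deriv v f (t *\<^sub>R x)"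
      using linear_scale[OF linear_dir_deriv[OF f]] by simp
    ultimately show ?thesis using that Suc by simp
  qed
  have "dir_deriv v f (t *\<^sub>R x) = t ^ k * dir_deriv v f x" for t x
  proof (cases "t = 0")
    case True
    have c1: "((\<lambda>t. dir_deriv v f (t *\<^sub>R x)) \<longlongrightarrow> dir_deriv v f (0 *\<^sub>R x)) (at 0)"
      by (intro isCont_tendsto_compose[OF isCont_real_polynomial_function[OF real_polynomial_function_dir_deriv[OF f]]]
          tendsto_intros)
    have c2: "((\<lambda>t. t ^ k * dir_deriv v f x) \<longlongrightarrow> 0 ^ k * dir_deriv v f x) (at 0)"
      by (intro tendsto_intros)
    have "((\<lambda>t. dir_deriv v f (t *\<^sub>R x)) \<longlongrightarrow> 0 ^ k * dir_deriv v f x) (at 0)"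
      by (rule Lim_transform_eventually[OF c2]) (auto simp: eventually_at_filter nz)
    with c1 have "dir_deriv v f (0 *\<^sub>R x) = 0 ^ k * dir_deriv v f x"
      by (rule tendsto_unique[rotated]) simp
    with True show ?thesis by simp
  qed (use nz in blast)
  with Suc show ?thesis by (simp add: homogeneous_def)
qed

text \<open>A chain of derivatives ending in 0 stands for a polynomial of degree at most
  \<open>k\<close>, with no coefficients in sight. Rolle turns the k + 1 zeros of \<open>f 0\<close>
  into k zeros of \<open>f 1\<close>, so by induction \<open>f 1\<close> vanishes and
  \<open>f 0\<close> is constant.\<close>

lemma Rolle_iterate:
  fixes f :: "nat \<Rightarrow> real \<Rightarrow> real" and z :: "nat \<Rightarrow> real"
  assumes "\<And>i x. (f i has_real_derivative f (Suc i) x) (at x)"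
    and "\<And>x. f (Suc k) x = 0"
    and "\<And>i. i < k \<Longrightarrow> z i < z (Suc i)"
    and "\<And>i. i \<le> k \<Longrightarrow> f 0 (z i) = 0"
  shows "f 0 x = 0"
  using assms
proof (induction k arbitrary: f z x)
  case 0
  have "(f 0 has_real_derivative 0) (at x)" for x using 0(1)[of 0 x] 0(2)[of x] by simp
  then have "f 0 x = f 0 (z 0)" by (intro DERIV_isconst_all allI)
  with 0 show ?case by simp
next
  case (Suc k)
  have "\<exists>y. z i < y \<and> y < z (Suc i) \<and> f 1 y = 0" if "i \<le> k" for i
  proof -
    have "\<exists>y>z i. y < z (Suc i) \<and> (f 0 has_real_derivative 0) (at y)"
    proof (rule Rolle)
      show "z i < z (Suc i)" using Suc.prems(3) that by auto
      show "f 0 (z i) = f 0 (z (Suc i))" using Suc.prems(4) that by auto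
      show "continuous_on {z i..z (Suc i)} (f 0)"
        by (rule DERIV_continuous_on) (rule has_field_derivative_at_within[OF Suc.prems(1)])
      show "\<And>x. f 0 differentiable (at x)"
        unfolding real_differentiable_def using Suc.prems(1)[of 0] by blast
    qed
    then obtain y where "y > z i" "y < z (Suc i)" "(f 0 has_real_derivative 0) (at y)" by blast
    moreover have "f 1 y = 0" using DERIV_unique[OF Suc.prems(1)[of 0 y] calculation(3)] by simp
    ultimately show ?thesis by blast
  qed
  then obtain y where y: "\<And>i. i \<le> k \<Longrightarrow> z i < y i \<and> y i < z (Suc i) \<and> f 1 (y i) = 0" by metis
  have "f (Suc 0) x = 0" for x
  proof (rule Suc.IH[of "\<lambda>i. f (Suc i)" y])
    show "y i < y (Suc i)" if "i < k" for i using y[of i] y[of "Suc i"] that by auto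
  qed (use Suc.prems y in auto)
  then have "(f 0 has_real_derivative 0) (at x)" for x using Suc.prems(1)[of 0 x] by simp
  then have "f 0 x = f 0 (z 0)" by (intro DERIV_isconst_all allI)
  with Suc.prems(4)[of 0] show ?case by simp
qed

text \<open>Homogeneity plays the role of the degree: after \<open>l\<close> derivatives it has
  dropped to 0, the function is constant, and the next derivative is 0. This is the terminating
  chain for \<open>Rolle_iterate\<close>.\<close>

lemma dir_deriv_funpow:
  assumes f: "real_polynomial_function f" and h: "homogeneous l f"
  shows "real_polynomial_function ((dir_deriv v ^^ i) f)"
    and "homogeneous (l - i) ((dir_deriv v ^^ i) f)"
    and "l < i \<Longrightarrow> (dir_deriv v ^^ i) f x = 0"
proof -
  have *: "real_polynomial_function ((dir_deriv v ^^ i) f) \<and> homogeneous (l - i) ((dir_deriv v ^^ i) f)" for i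
  proof (induction i)
    case (Suc i)
    then show ?case
      using homogeneous_dir_deriv[of "(dir_deriv v ^^ i) f" "l - i" v] by auto
  qed (use f h in auto)
  then show "real_polynomial_function ((dir_deriv v ^^ i) f)" "homogeneous (l - i) ((dir_deriv v ^^ i) f)"
    by blast+
  have "(dir_deriv v ^^ (Suc l + j)) f = (\<lambda>x. 0)" for j
  proof (induction j)
    case 0
    let ?g = "(dir_deriv v ^^ l) f"
    have "homogeneous 0 ?g" using *[of l] by simp
    then have "?g = (\<lambda>x. ?g 0)"
      unfolding homogeneous_def by (metis mult_1 power_0 scaleR_zero_left)
    then have "dir_deriv v ?g x = 0" for x by (metis dir_deriv_const)
    then show ?case by auto
  next
    case (Suc j)
    have "(dir_deriv v ^^ (Suc l + Suc j)) f = dir_deriv v (\<lambda>x. 0)"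
      unfolding Suc[symmetric] by simp
    then show ?case by (simp add: fun_eq_iff)
  qed
  then show "(dir_deriv v ^^ i) f x = 0" if "l < i"
    by (metis Suc_leI le_add_diff_inverse that)
qed

lemma homogeneous_zero_on_line:
  assumes f: "real_polynomial_function f" and h: "homogeneous l f"
    and z: "\<And>k. k \<le> l \<Longrightarrow> f (x + real k *\<^sub>R v) = 0"
  shows "f (x + t *\<^sub>R v) = 0"
proof -
  have "(dir_deriv v ^^ 0) f (x + t *\<^sub>R v) = 0"
  proof (rule Rolle_iterate[where k=l and z=real and f="\<lambda>i t. (dir_deriv v ^^ i) f (x + t *\<^sub>R v)"])
    show "((\<lambda>t. (dir_deriv v ^^ i) f (x + t *\<^sub>R v)) has_real_derivative
            (dir_deriv v ^^ Suc i) f (x + s *\<^sub>R v)) (at s)" for i s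
      using DERIV_dir_deriv_line[OF dir_deriv_funpow(1)[OF f h, of i v], of x v s] by simp
    show "(dir_deriv v ^^ Suc l) f (x + s *\<^sub>R v) = 0" for s
      by (rule dir_deriv_funpow(3)[OF f h]) simp
  qed (use z in auto)
  then show ?thesis by simp
qed

section \<open>Homogeneous harmonic polynomials are determined by their values on a grid\<close>

text \<open>Inside the hyperplane orthogonal to \<open>e\<close>, the \<open>e'\<close>-coordinate
  is normalised to 1, which homogeneity allows. This leaves DIM('a) - 2 = d - 1 free coordinates
  with l + 1 values each, the origin of the growth order l^(d-1).\<close>

definition harmonic_grid :: "'a::euclidean_space \<Rightarrow> 'a \<Rightarrow> nat \<Rightarrow> 'a set" where
  "harmonic_grid e e' l =
     (\<lambda>k. e' + (\<Sum>b\<in>Basis - {e, e'}. real (k b) *\<^sub>R b)) ` ((Basis - {e, e'}) \<rightarrow>\<^sub>E {..l})"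

lemma card_harmonic_grid:
  fixes e :: "'a::euclidean_space"
  assumes "e \<in> Basis" "e' \<in> Basis" "e \<noteq> e'"
  shows "finite (harmonic_grid e e' l)"
    and "card (harmonic_grid e e' l) \<le> (l + 1) ^ (DIM('a) - 2)"
proof -
  let ?F = "(Basis - {e, e'}) \<rightarrow>\<^sub>E {..l}"
  have fin: "finite ?F" by (rule finite_PiE) auto
  then show "finite (harmonic_grid e e' l)" by (simp add: harmonic_grid_def)
  have "card (harmonic_grid e e' l) \<le> card ?F"
    unfolding harmonic_grid_def by (rule card_image_le[OF fin])
  also have "card ?F = (l + 1) ^ card (Basis - {e, e'})" by (simp add: card_PiE)
  also have "card (Basis - {e, e'}) = DIM('a) - 2"
    using assms by (subst card_Diff_subset) auto
  finally show "card (harmonic_grid e e' l) \<le> (l + 1) ^ (DIM('a) - 2)" .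
qed

text \<open>Zeros spread from the grid to the slice \<open>x \<bullet> e' = 1\<close> one coordinate
  at a time, then by scaling to \<open>x \<bullet> e' \<noteq> 0\<close>, then by continuity to the
  whole hyperplane. The degree \<open>k\<close> may be below \<open>l\<close> so that the normal
  derivative, of degree l - 1, can use the same grid.\<close>

lemma homogeneous_zero_of_grid:
  fixes f :: "'a::euclidean_space \<Rightarrow> real"
  assumes f: "real_polynomial_function f" and h: "homogeneous k f" and kl: "k \<le> l"
    and e: "e \<in> Basis" "e' \<in> Basis" "e \<noteq> e'"
    and z: "\<And>w. w \<in> harmonic_grid e e' l \<Longrightarrow> f w = 0"
    and x: "x \<bullet> e = 0"
  shows "f x = 0"
proof -
  let ?B = "Basis - {e, e'}"
  \<comment> \<open>\<open>A\<close> is the set of coordinates that may already take arbitrary real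
    values; the others still take integer values 0..l. Adding \<open>a\<close> to \<open>A\<close>
    is one use of \<open>homogeneous_zero_on_line\<close> in direction \<open>a\<close>.\<close>
  have *: "f (e' + (\<Sum>b\<in>?B. t b *\<^sub>R b)) = 0"
    if "finite A" "A \<subseteq> ?B" "\<And>b. b \<in> ?B - A \<Longrightarrow> \<exists>n\<le>l. t b = real n" for A and t :: "'a \<Rightarrow> real"
    using that
  proof (induction A arbitrary: t rule: finite_induct)
    case empty
    then have "\<forall>b. \<exists>n. b \<in> ?B \<longrightarrow> n \<le> l \<and> t b = real n" by blast
    then obtain n where n: "\<And>b. b \<in> ?B \<Longrightarrow> n b \<le> l \<and> t b = real (n b)" by metis
    have "e' + (\<Sum>b\<in>?B. t b *\<^sub>R b) \<in> harmonic_grid e e' l"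
      unfolding harmonic_grid_def
    proof (rule image_eqI)
      show "restrict n ?B \<in> ?B \<rightarrow>\<^sub>E {..l}" using n by auto
      show "e' + (\<Sum>b\<in>?B. t b *\<^sub>R b) = e' + (\<Sum>b\<in>?B. real (restrict n ?B b) *\<^sub>R b)"
        using n by (auto intro!: sum.cong)
    qed
    then show ?case by (rule z)
  next
    case (insert a A)
    have split: "e' + (\<Sum>b\<in>?B. (t(a := s)) b *\<^sub>R b) = (e' + (\<Sum>b\<in>?B - {a}. t b *\<^sub>R b)) + s *\<^sub>R a" for s
    proof -
      have "(\<Sum>b\<in>?B. (t(a := s)) b *\<^sub>R b) = s *\<^sub>R a + (\<Sum>b\<in>?B - {a}. (t(a := s)) b *\<^sub>R b)"
        using insert.prems by (subst sum.remove[of _ a]) auto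
      also have "(\<Sum>b\<in>?B - {a}. (t(a := s)) b *\<^sub>R b) = (\<Sum>b\<in>?B - {a}. t b *\<^sub>R b)"
        by (rule sum.cong) auto
      finally show ?thesis by simp
    qed
    have "f ((e' + (\<Sum>b\<in>?B - {a}. t b *\<^sub>R b)) + real n *\<^sub>R a) = 0" if "n \<le> k" for n
      unfolding split[symmetric]
    proof (rule insert.IH)
      show "\<exists>n'\<le>l. (t(a := real n)) b = real n'" if "b \<in> ?B - A" for b
        using insert.prems(2)[of b] that \<open>n \<le> k\<close> kl by (auto intro: exI[of _ n])
    qed (use insert.prems in auto)
    from homogeneous_zero_on_line[OF f h this, of "t a"]
    show ?case unfolding split[of "t a", symmetric] by simp
  qed
  have rep: "y = (y \<bullet> e') *\<^sub>R e' + (\<Sum>b\<in>?B. (y \<bullet> b) *\<^sub>R b)" if "y \<bullet> e = 0" for y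
  proof -
    have "y = (\<Sum>b\<in>Basis. (y \<bullet> b) *\<^sub>R b)" by (simp add: euclidean_representation)
    also have "\<dots> = (y \<bullet> e) *\<^sub>R e + (\<Sum>b\<in>Basis - {e}. (y \<bullet> b) *\<^sub>R b)"
      using e by (subst sum.remove[of _ e]) auto
    also have "(\<Sum>b\<in>Basis - {e}. (y \<bullet> b) *\<^sub>R b) = (y \<bullet> e') *\<^sub>R e' + (\<Sum>b\<in>Basis - {e} - {e'}. (y \<bullet> b) *\<^sub>R b)"
      using e by (subst sum.remove[of _ e']) auto
    also have "Basis - {e} - {e'} = ?B" by auto
    finally show ?thesis using that by simp
  qed
  have nz: "f y = 0" if "y \<bullet> e = 0" "y \<bullet> e' \<noteq> 0" for y
  proof -
    let ?s = "y \<bullet> e'"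
    have "?s *\<^sub>R (e' + (\<Sum>b\<in>?B. ((y \<bullet> b) / ?s) *\<^sub>R b)) = y"
      unfolding scaleR_add_right scaleR_sum_right using rep[OF that(1)] that(2) by simp
    then have "f y = ?s ^ k * f (e' + (\<Sum>b\<in>?B. ((y \<bullet> b) / ?s) *\<^sub>R b))"
      using h[unfolded homogeneous_def, rule_format, of ?s "e' + (\<Sum>b\<in>?B. ((y \<bullet> b) / ?s) *\<^sub>R b)"] by simp
    also have "f (e' + (\<Sum>b\<in>?B. ((y \<bullet> b) / ?s) *\<^sub>R b)) = 0"
      using *[of ?B "\<lambda>b. (y \<bullet> b) / ?s"] by simp
    finally show ?thesis by simp
  qed
  show ?thesis
  proof (cases "x \<bullet> e' = 0")
    case True
    \<comment> \<open>Move off the exceptional set along \<open>e'\<close>, where \<open>nz\<close>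
      applies, and return by continuity.\<close>
    have c: "((\<lambda>t. f (x + t *\<^sub>R e')) \<longlongrightarrow> f (x + 0 *\<^sub>R e')) (at 0)"
      by (intro isCont_tendsto_compose[OF isCont_real_polynomial_function[OF f]] tendsto_intros)
    have "f (x + t *\<^sub>R e') = 0" if "t \<noteq> 0" for t
      by (rule nz) (use e x True that in \<open>auto simp: inner_add_left inner_Basis\<close>)
    then have "((\<lambda>t. f (x + t *\<^sub>R e')) \<longlongrightarrow> 0) (at 0)"
      by (intro tendsto_eventually) (auto simp: eventually_at_filter)
    with c have "f (x + 0 *\<^sub>R e') = 0" by (rule tendsto_unique[rotated]) simp
    then show ?thesis by simp
  qed (use nz x in blast)
qed

text \<open>Uniqueness for the Cauchy problem on the hyperplane orthogonal to \<open>e\<close>.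
  There the tangential second derivatives of \<open>f\<close> vanish, so the Laplace equation kills
  the second normal derivative too. Hence the normal derivative satisfies the same hypotheses in
  degree one less, vanishes by induction, and \<open>f\<close> is constant along
  \<open>e\<close>.\<close>

lemma homogeneous_harmonic_zero:
  fixes f :: "'a::euclidean_space \<Rightarrow> real"
  assumes f: "real_polynomial_function f" and h: "homogeneous l f"
    and lap: "\<And>x. (\<Sum>b\<in>Basis. dir_deriv b (dir_deriv b f) x) = 0"
    and e: "e \<in> Basis"
    and z: "\<And>x. x \<bullet> e = 0 \<Longrightarrow> f x = 0" "\<And>x. x \<bullet> e = 0 \<Longrightarrow> dir_deriv e f x = 0"
  shows "f x = 0"
  using f h lap z
proof (induction l arbitrary: f x)
  case 0
  then have "f 0 = 0" by simp
  then show ?case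
    using 0(2)[unfolded homogeneous_def, rule_format, of 0 x] by simp
next
  case (Suc l)
  let ?g = "dir_deriv e f"
  note f = Suc.prems(1)
  note df = real_polynomial_function_dir_deriv[OF f]
  have tang: "dir_deriv b g x = 0" if g: "real_polynomial_function g" and gz: "\<And>x. x \<bullet> e = 0 \<Longrightarrow> g x = 0"
    and b: "b \<bullet> e = 0" and x: "x \<bullet> e = 0" for g b x
  proof -
    have "(\<lambda>t. g (x + t *\<^sub>R b)) = (\<lambda>t. 0)" using gz b x by (auto simp: inner_add_left)
    with DERIV_dir_deriv_line[OF g, of x b 0] have "((\<lambda>t. 0) has_real_derivative dir_deriv b g x) (at 0)" by simp
    from DERIV_unique[OF this DERIV_const] show ?thesis .
  qed
  have "?g x = 0" for x
  proof (rule Suc.IH)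
    show "homogeneous l ?g" using homogeneous_dir_deriv[OF f Suc.prems(2)] by simp
    show "(\<Sum>b\<in>Basis. dir_deriv b (dir_deriv b ?g) x) = 0" for x
    proof -
      have "dir_deriv b (dir_deriv b ?g) x = dir_deriv e (dir_deriv b (dir_deriv b f)) x" for b
      proof -
        have "dir_deriv b ?g = dir_deriv e (dir_deriv b f)" using dir_deriv_commute[OF f] by (intro ext)
        then show ?thesis by (simp add: dir_deriv_commute[OF df])
      qed
      then have "(\<Sum>b\<in>Basis. dir_deriv b (dir_deriv b ?g) x)
          = dir_deriv e (\<lambda>x. \<Sum>b\<in>Basis. dir_deriv b (dir_deriv b f) x) x"
        by (subst dir_deriv_sum) (auto intro: df)
      also have "\<dots> = 0" using Suc.prems(3) by simp
      finally show ?thesis .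
    qed
    \<comment> \<open>Second Cauchy datum of \<open>?g\<close>: all terms of the Laplacian of
      \<open>f\<close> other than the one for \<open>e\<close> are tangential.\<close>
    show "dir_deriv e ?g x = 0" if "x \<bullet> e = 0" for x
    proof -
      have "dir_deriv b (dir_deriv b f) x = 0" if "b \<in> Basis - {e}" for b
      proof -
        have be: "b \<bullet> e = 0" using that e by (auto simp: inner_Basis)
        show ?thesis
          by (intro tang df f be \<open>x \<bullet> e = 0\<close>) (use Suc.prems(4) in auto)
      qed
      then have "(\<Sum>b\<in>Basis - {e}. dir_deriv b (dir_deriv b f) x) = 0" by simp
      with Suc.prems(3)[of x] e show ?thesis by (simp add: sum.remove[of _ e])
    qed
  qed (use Suc.prems(5) df in auto)
  then have "((\<lambda>t. f ((x - (x \<bullet> e) *\<^sub>R e) + t *\<^sub>R e)) has_real_derivative 0) (at t)" for t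
    using DERIV_dir_deriv_line[OF f, of "x - (x \<bullet> e) *\<^sub>R e" e] by simp
  then have "f ((x - (x \<bullet> e) *\<^sub>R e) + (x \<bullet> e) *\<^sub>R e) = f ((x - (x \<bullet> e) *\<^sub>R e) + 0 *\<^sub>R e)"
    by (intro DERIV_isconst_all[of "\<lambda>t. f ((x - (x \<bullet> e) *\<^sub>R e) + t *\<^sub>R e)"] allI)
  also have "\<dots> = 0" using Suc.prems(4) e by (simp add: inner_diff_left)
  finally show ?case by simp
qed

section \<open>Rotation invariance of the surface measure\<close>

text \<open>
  By Vitali's covering theorem an open set is, up to a null set, a countable disjoint union of
  balls, and the preimage of a ball is a ball of the same radius.
\<close>

lemma emeasure_lborel_orthogonal_vimage_open:
  fixes f :: "'a::euclidean_space \<Rightarrow> 'a"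
  assumes f: "orthogonal_transformation f" and U: "open U"
  shows "emeasure lborel (f -` U) = emeasure lborel U"
proof -
  define g where "g = inv_into UNIV f"
  have g: "orthogonal_transformation g" unfolding g_def using f by (rule orthogonal_transformation_inv)
  have bij: "bij f" using f by (rule orthogonal_transformation_bij)
  have fg: "f (g x) = x" for x unfolding g_def using bij by (simp add: bij_is_surj surj_f_inv_f)
  have gf: "g (f x) = x" for x unfolding g_def using bij by (simp add: bij_is_inj)
  have vim: "f -` A = g ` A" for A 
  proof (intro equalityI subsetI)
    fix x assume "x \<in> f -` A"
    then show "x \<in> g ` A" using gf[of x] by (intro image_eqI[of _ g "f x"]) auto
  qed (use fg in auto)
  have lin: "bounded_linear f" "bounded_linear g"
    using f g linear_conv_bounded_linear orthogonal_transformation_linear by blast+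
  have fm: "f \<in> borel \<rightarrow>\<^sub>M borel"
    by (intro borel_measurable_continuous_onI) (simp add: lin linear_continuous_on)
  define K where "K = {(a, r). 0 < r \<and> ball a r \<subseteq> U}"
  obtain C where C: "countable C" "C \<subseteq> K"
    "pairwise (\<lambda>i j. disjnt (ball (fst i) (snd i)) (ball (fst j) (snd j))) C"
    "negligible (U - (\<Union>i\<in>C. ball (fst i) (snd i)))"
  proof (rule Vitali_covering_theorem_balls[of U K fst snd])
    fix x and d :: real assume "x \<in> U" "0 < d"
    then obtain e where e: "0 < e" "ball x e \<subseteq> U" using U open_contains_ball by blast
    have "ball x (min e (d / 2)) \<subseteq> U" using e by auto
    then show "\<exists>i. i \<in> K \<and> x \<in> ball (fst i) (snd i) \<and> snd i < d"
      using e \<open>0 < d\<close> by (intro exI[of _ "(x, min e (d / 2))"]) (auto simp: K_def)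
  qed
  let ?B = "\<lambda>i. ball (fst i) (snd i)"
  let ?N = "U - (\<Union>i\<in>C. ?B i)"
  have Nb: "?N \<in> sets borel" using U C(1) by (intro sets.Diff) auto
  have N0: "?N \<in> null_sets lborel"
    using C(4) Nb by (simp add: negligible_iff_null_sets null_sets_completion_iff)
  have "negligible (g ` ?N)"
    using C(4) lin(2)
    by (intro negligible_differentiable_image_negligible)
       (auto intro: linear_imp_differentiable_on bounded_linear.linear)
  moreover have gb: "f -` A \<in> sets borel" if "A \<in> sets borel" for A
    using measurable_sets[OF fm that] by simp
  ultimately have N1: "f -` ?N \<in> null_sets lborel"
    using gb[OF Nb] by (simp add: negligible_iff_null_sets null_sets_completion_iff vim)
  have ball: "f -` ball a r = ball (g a) r" for a r
  proof -
    have "dist a (f x) = dist (g a) x" for x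
    proof -
      have "norm (f (g a - x)) = norm (g a - x)" using f by (simp add: orthogonal_transformation)
      then show ?thesis
        using linear_diff[OF orthogonal_transformation_linear[OF f]] by (simp add: fg dist_norm)
    qed
    then show ?thesis by auto
  qed
  have sub: "(\<Union>i\<in>C. ?B i) \<subseteq> U"
  proof (intro UN_least)
    fix i assume "i \<in> C"
    then show "?B i \<subseteq> U" using C(2) unfolding K_def by (cases i) force
  qed
  have disj: "disjoint_family_on ?B C"
    using C(3) by (auto simp: disjoint_family_on_def pairwise_def disjnt_def)
  have "emeasure lborel U = emeasure lborel (U - ?N)"
    using N0 U by (subst emeasure_Diff_null_set) auto
  also have "U - ?N = (\<Union>i\<in>C. ?B i)" using sub by auto
  also have "emeasure lborel \<dots> = (\<integral>\<^sup>+i. emeasure lborel (?B i) \<partial>count_space C)"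
    using C(1) disj by (intro emeasure_UN_countable) auto
  also have "\<dots> = (\<integral>\<^sup>+i. emeasure lborel (f -` ?B i) \<partial>count_space C)"
    using C(2) by (intro nn_integral_cong) (auto simp: ball K_def emeasure_ball)
  also have "\<dots> = emeasure lborel (\<Union>i\<in>C. f -` ?B i)"
  proof (rule emeasure_UN_countable[symmetric])
    show "disjoint_family_on (\<lambda>i. f -` ?B i) C"
      using disj unfolding disjoint_family_on_def by blast
  qed (use C(1) in \<open>auto intro!: gb\<close>)
  also have "(\<Union>i\<in>C. f -` ?B i) = f -` U - f -` ?N" using sub by auto
  also have "emeasure lborel \<dots> = emeasure lborel (f -` U)"
    using N1 gb[of U] U by (subst emeasure_Diff_null_set) auto
  finally show ?thesis by simp
qed

lemma borel_measurable_orthogonal_transformation: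
  fixes f :: "'a::euclidean_space \<Rightarrow> 'a"
  shows "orthogonal_transformation f \<Longrightarrow> f \<in> borel \<rightarrow>\<^sub>M borel"
  by (intro borel_measurable_continuous_onI)
     (simp add: linear_continuous_on linear_linear orthogonal_transformation_linear)

text \<open>Lebesgue measure is characterised by its values on boxes, and these are open
  sets.\<close>

lemma distr_lborel_orthogonal_transformation:
  fixes f :: "'a::euclidean_space \<Rightarrow> 'a"
  assumes f: "orthogonal_transformation f"
  shows "distr lborel borel f = lborel"
proof (rule lborel_eqI[symmetric])
  note [measurable] = borel_measurable_orthogonal_transformation[OF f]
  fix l u :: 'a assume le: "\<And>b. b \<in> Basis \<Longrightarrow> l \<bullet> b \<le> u \<bullet> b"
  have "emeasure (distr lborel borel f) (box l u) = emeasure lborel (f -` box l u)"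
    by (subst emeasure_distr) auto
  also have "\<dots> = (\<Prod>b\<in>Basis. (u - l) \<bullet> b)"
    unfolding emeasure_lborel_orthogonal_vimage_open[OF f open_box] using le by (rule emeasure_lborel_box)
  finally show "emeasure (distr lborel borel f) (box l u) = (\<Prod>b\<in>Basis. (u - l) \<bullet> b)" .
qed simp

lemma measurable_sgn_sphere [measurable]:
  "sgn \<in> restrict_space lborel (ball 0 1 - {0}) \<rightarrow>\<^sub>M restrict_space borel (sphere (0::'a::euclidean_space) 1)"
proof (rule measurable_restrict_space2)
  show "sgn \<in> space (restrict_space lborel (ball 0 1 - {0})) \<rightarrow> sphere (0::'a) 1"
    by (auto simp: space_restrict_space norm_sgn)
  have "continuous_on (ball 0 1 - {0::'a}) sgn" by (intro continuous_intros) auto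
  from borel_measurable_continuous_on_restrict[OF this]
  show "sgn \<in> restrict_space lborel (ball 0 1 - {0}) \<rightarrow>\<^sub>M (borel :: 'a measure)"
    by (simp cong: measurable_cong_sets sets_restrict_space_cong)
qed

lemma space_sphere_measure [simp]: "space (sphere_measure :: 'a::euclidean_space measure) = sphere 0 1"
  by (simp add: sphere_measure_def space_scale_measure space_restrict_space)

lemma sets_sphere_measure [measurable_cong]:
  "sets (sphere_measure :: 'a::euclidean_space measure) = sets (restrict_space borel (sphere 0 1))"
  by (simp add: sphere_measure_def)

lemma emeasure_sphere_measure:
  fixes A :: "'a::euclidean_space set"
  assumes "A \<in> sets (restrict_space borel (sphere 0 1))"
  shows "emeasure sphere_measure A =
    of_nat DIM('a) * emeasure lborel {x \<in> ball 0 1 - {0}. sgn x \<in> A}"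
proof -
  have "emeasure sphere_measure A = of_nat DIM('a) * emeasure (restrict_space lborel (ball 0 1 - {0}))
      (sgn -` A \<inter> space (restrict_space lborel (ball 0 1 - {0})))"
    unfolding sphere_measure_def using assms by (simp add: emeasure_distr)
  also have "sgn -` A \<inter> space (restrict_space lborel (ball 0 1 - {0})) = {x \<in> ball 0 1 - {0}. sgn x \<in> A}"
    by (auto simp: space_restrict_space)
  also have "emeasure (restrict_space lborel (ball 0 1 - {0})) \<dots> = emeasure lborel \<dots>"
    by (rule emeasure_restrict_space) auto
  finally show ?thesis .
qed

lemma finite_measure_sphere_measure: "finite_measure (sphere_measure :: 'a::euclidean_space measure)"
proof
  let ?S = "sphere (0::'a) 1"
  have "emeasure sphere_measure ?S = of_nat DIM('a) * emeasure lborel {x \<in> ball 0 1 - {0::'a}. sgn x \<in> ?S}"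
    by (rule emeasure_sphere_measure) (simp add: sets_restrict_space_iff)
  also have "\<dots> \<le> of_nat DIM('a) * emeasure lborel (ball (0::'a) 1)"
    by (intro mult_left_mono emeasure_mono) auto
  also have "\<dots> < \<infinity>" by (simp add: ennreal_mult_less_top emeasure_lborel_ball_finite[simplified] of_nat_less_top)
  finally show "emeasure (sphere_measure :: 'a measure) (space sphere_measure) \<noteq> \<infinity>" by simp
qed

interpretation sphere: finite_measure "sphere_measure :: 'a::euclidean_space measure"
  by (rule finite_measure_sphere_measure)

lemma measurable_orthogonal_transformation_sphere:
  fixes f :: "'a::euclidean_space \<Rightarrow> 'a"
  assumes f: "orthogonal_transformation f"
  shows "f \<in> restrict_space borel (sphere 0 1) \<rightarrow>\<^sub>M restrict_space borel (sphere 0 1)"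
  using f by (intro measurable_restrict_space3 borel_measurable_orthogonal_transformation)
    (auto simp: orthogonal_transformation)

text \<open>An orthogonal map preserves norms and commutes with \<open>sgn\<close>, so the cone over
  the preimage of \<open>A\<close> is the preimage of the cone over \<open>A\<close>. Invariance of
  Lebesgue measure then carries over.\<close>

lemma distr_sphere_measure:
  fixes f :: "'a::euclidean_space \<Rightarrow> 'a"
  assumes f: "orthogonal_transformation f"
  shows "distr sphere_measure (restrict_space borel (sphere 0 1)) f = sphere_measure"
proof (rule measure_eqI)
  let ?S = "restrict_space borel (sphere (0::'a) 1)"
  have fm: "f \<in> ?S \<rightarrow>\<^sub>M ?S" by (rule measurable_orthogonal_transformation_sphere[OF f])
  have norm: "norm (f x) = norm x" for x using f by (simp add: orthogonal_transformation)
  have sgn: "sgn (f x) = f (sgn x)" for x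
    using orthogonal_transformation_linear[OF f] by (simp add: sgn_div_norm norm linear_scale)
  fix A assume "A \<in> sets (distr sphere_measure ?S f)"
  then have A: "A \<in> sets ?S" by simp
  have AS: "A \<subseteq> sphere 0 1" using sets.sets_into_space[OF A] by (simp add: space_restrict_space)
  let ?C = "{x \<in> ball 0 1 - {0}. sgn x \<in> A}"
  have C: "?C \<in> sets lborel"
  proof -
    have "sgn -` A \<inter> space (restrict_space lborel (ball 0 1 - {0})) \<in> sets (restrict_space lborel (ball 0 1 - {0}))"
      using A by measurable
    moreover have "sgn -` A \<inter> space (restrict_space lborel (ball 0 1 - {0})) = ?C"
      by (auto simp: space_restrict_space)
    ultimately show ?thesis by (subst (asm) sets_restrict_space_iff) auto
  qed
  have fA: "f -` A \<inter> sphere 0 1 \<in> sets ?S"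
    using measurable_sets[OF fm A] by (simp add: space_restrict_space)
  have "emeasure (distr sphere_measure ?S f) A = emeasure sphere_measure (f -` A \<inter> sphere 0 1)"
    using fm A by (subst emeasure_distr) (auto cong: measurable_cong_sets simp: sets_sphere_measure)
  also have "\<dots> = of_nat DIM('a) * emeasure lborel {x \<in> ball 0 1 - {0}. sgn x \<in> f -` A \<inter> sphere 0 1}"
    by (rule emeasure_sphere_measure[OF fA])
  also have "{x \<in> ball 0 1 - {0}. sgn x \<in> f -` A \<inter> sphere 0 1} = f -` ?C"
  proof -
    have "f x \<noteq> 0" if "x \<noteq> 0" for x using norm[of x] that by auto
    moreover have "f 0 = 0" using norm[of 0] by simp
    ultimately show ?thesis using AS by (auto simp: sgn norm_sgn norm split: if_splits)
  qed
  also have "emeasure lborel (f -` ?C) = emeasure (distr lborel borel f) ?C"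
    using C borel_measurable_orthogonal_transformation[OF f] by (subst emeasure_distr) auto
  also have "\<dots> = emeasure lborel ?C" by (simp only: distr_lborel_orthogonal_transformation[OF f])
  also have "of_nat DIM('a) * emeasure lborel ?C = emeasure sphere_measure A"
    by (rule emeasure_sphere_measure[OF A, symmetric])
  finally show "emeasure (distr sphere_measure ?S f) A = emeasure sphere_measure A" .
qed (simp add: sets_sphere_measure)

lemma borel_measurable_sphere_continuous:
  "continuous_on (sphere 0 1) h \<Longrightarrow> h \<in> borel_measurable (sphere_measure :: 'a::euclidean_space measure)"
  using borel_measurable_continuous_on_restrict sets_sphere_measure measurable_cong_sets by blast

lemma integrable_sphere_continuous:
  fixes h :: "'a::euclidean_space \<Rightarrow> real"
  assumes "continuous_on (sphere 0 1) h"
  shows "integrable sphere_measure h"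
proof -
  have "bounded (h ` sphere 0 1)"
    by (intro compact_imp_bounded compact_continuous_image assms compact_sphere)
  then obtain B where "\<forall>x\<in>sphere 0 1. norm (h x) \<le> B" by (auto simp: bounded_iff)
  then show ?thesis
    by (intro sphere.integrable_const_bound[of _ B] borel_measurable_sphere_continuous assms) (auto intro: AE_I2)
qed

lemma integral_sphere_orthogonal_transformation:
  fixes f :: "'a::euclidean_space \<Rightarrow> 'a" and h :: "'a \<Rightarrow> real"
  assumes f: "orthogonal_transformation f" and h: "continuous_on (sphere 0 1) h"
  shows "(LINT x|sphere_measure. h (f x)) = (LINT x|sphere_measure. h x)"
proof -
  let ?S = "restrict_space borel (sphere (0::'a) 1)"
  have "(LINT x|sphere_measure. h x) = (LINT x|distr sphere_measure ?S f. h x)"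
    by (simp only: distr_sphere_measure[OF f])
  also have "\<dots> = (LINT x|sphere_measure. h (f x))"
    using measurable_orthogonal_transformation_sphere[OF f] borel_measurable_continuous_on_restrict[OF h]
    by (intro integral_distr) (auto cong: measurable_cong_sets simp: sets_sphere_measure)
  finally show ?thesis by simp
qed

section \<open>Rotational vector fields\<close>

text \<open>For orthonormal \<open>u\<close>, \<open>v\<close>: rotation by the angle
  \<open>t\<close> in their plane, identity on the orthogonal complement, written as a perturbation
  of \<open>x\<close>.\<close>

definition plane_rotation :: "'a::euclidean_space \<Rightarrow> 'a \<Rightarrow> real \<Rightarrow> 'a \<Rightarrow> 'a" where
  "plane_rotation u v t x =
     x + ((cos t - 1) * (x \<bullet> u) - sin t * (x \<bullet> v)) *\<^sub>R u + (sin t * (x \<bullet> u) + (cos t - 1) * (x \<bullet> v)) *\<^sub>R v"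

text \<open>The infinitesimal generator of \<open>plane_rotation u v\<close>, an angular momentum
  operator.\<close>

definition rot_deriv :: "'a::euclidean_space \<Rightarrow> 'a \<Rightarrow> ('a \<Rightarrow> real) \<Rightarrow> 'a \<Rightarrow> real" where
  "rot_deriv u v f x = (x \<bullet> u) * dir_deriv v f x - (x \<bullet> v) * dir_deriv u f x"

lemma real_polynomial_function_rot_deriv [intro]:
  "real_polynomial_function f \<Longrightarrow> real_polynomial_function (rot_deriv u v f)"
  unfolding rot_deriv_def[abs_def]
  by (intro real_polynomial_function_diff real_polynomial_function.intros(4) real_polynomial_function_inner
      real_polynomial_function_dir_deriv)

context
  fixes u v :: "'a::euclidean_space"
  assumes uv: "u \<bullet> u = 1" "v \<bullet> v = 1" "u \<bullet> v = 0"
begin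

lemma orthogonal_plane_rotation: "orthogonal_transformation (plane_rotation u v t)"
  unfolding orthogonal_transformation
proof (intro conjI allI)
  show "linear (plane_rotation u v t)"
    by (rule linearI) (simp_all add: plane_rotation_def algebra_simps)
  fix x
  let ?a = "x \<bullet> u" and ?b = "x \<bullet> v"
  have vu: "v \<bullet> u = 0" using uv by (simp add: inner_commute)
  \<comment> \<open>The expansion is polynomial in \<open>c\<close> and \<open>s\<close>, free of
    trigonometry; c^2 + s^2 = 1 makes the coefficient vanish only at the end.\<close>
  have "(x + ((c - 1) * ?a - s * ?b) *\<^sub>R u + (s * ?a + (c - 1) * ?b) *\<^sub>R v)
        \<bullet> (x + ((c - 1) * ?a - s * ?b) *\<^sub>R u + (s * ?a + (c - 1) * ?b) *\<^sub>R v)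
      = x \<bullet> x + (2 * (c - 1) + (c - 1)\<^sup>2 + s\<^sup>2) * (?a\<^sup>2 + ?b\<^sup>2)" for c s
    using uv vu
    by (simp add: inner_add_left inner_add_right inner_commute[of u x] inner_commute[of v x])
       (simp add: power2_eq_square algebra_simps)
  then have "plane_rotation u v t x \<bullet> plane_rotation u v t x
      = x \<bullet> x + (2 * (cos t - 1) + (cos t - 1)\<^sup>2 + (sin t)\<^sup>2) * (?a\<^sup>2 + ?b\<^sup>2)"
    unfolding plane_rotation_def .
  also have "2 * (cos t - 1) + (cos t - 1)\<^sup>2 + (sin t)\<^sup>2 = 0"
    using sin_cos_squared_add[of t] by (simp add: power2_eq_square algebra_simps)
  finally show "norm (plane_rotation u v t x) = norm x" by (simp add: norm_eq_sqrt_inner)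
qed

text \<open>The rotations are the flow of the vector field x \<mapsto> (x \<bullet> u) v - (x
  \<bullet> v) u, so the formula holds at every time \<open>t\<close>, which the mean value theorem
  will require.\<close>

lemma DERIV_plane_rotation:
  assumes f: "real_polynomial_function f"
  shows "((\<lambda>t. f (plane_rotation u v t x)) has_real_derivative rot_deriv u v f (plane_rotation u v t x)) (at t)"
proof -
  let ?R = "plane_rotation u v t x"
  have vu: "v \<bullet> u = 0" using uv by (simp add: inner_commute)
  have Ru: "?R \<bullet> u = cos t * (x \<bullet> u) - sin t * (x \<bullet> v)" and Rv: "?R \<bullet> v = sin t * (x \<bullet> u) + cos t * (x \<bullet> v)"
    unfolding plane_rotation_def using uv vu by (simp_all add: inner_add_left algebra_simps)
  let ?w = "(?R \<bullet> u) *\<^sub>R v - (?R \<bullet> v) *\<^sub>R u"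
  have "((\<lambda>t. plane_rotation u v t x) has_vector_derivative ?w) (at t)"
    unfolding Ru Rv unfolding plane_rotation_def has_vector_derivative_def
    by (auto intro!: derivative_eq_intros simp: fun_eq_iff algebra_simps)
  then have "((\<lambda>t. plane_rotation u v t x) has_derivative (\<lambda>h. h *\<^sub>R ?w)) (at t)"
    by (simp add: has_vector_derivative_def)
  from has_derivative_dir_deriv_chain[OF f this]
  have "((\<lambda>t. f (plane_rotation u v t x)) has_derivative (\<lambda>h. dir_deriv (h *\<^sub>R ?w) f ?R)) (at t)" .
  moreover have "dir_deriv (h *\<^sub>R ?w) f ?R = rot_deriv u v f ?R * h" for h
    unfolding rot_deriv_def linear_scale[OF linear_dir_deriv[OF f]] linear_diff[OF linear_dir_deriv[OF f]]
    by (simp add: algebra_simps)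
  ultimately show ?thesis by (simp add: has_field_derivative_def)
qed

text \<open>The integral of f over the rotated sphere does not depend on the angle; its derivative
  at 0 is the integral of \<open>rot_deriv u v f\<close>. Difference quotients at angles 1 / (k + 1)
  justify the exchange by dominated convergence.\<close>

lemma integral_rot_deriv:
  assumes f: "real_polynomial_function f"
  shows "(LINT x|sphere_measure. rot_deriv u v f x) = 0"
proof -
  let ?D = "rot_deriv u v f" and ?R = "plane_rotation u v"
  define t :: "nat \<Rightarrow> real" where "t k = inverse (real (Suc k))" for k
  have t0: "t k > 0" for k by (simp add: t_def)
  define s where "s k x = (f (?R (t k) x) - f x) / t k" for k x
  have cD: "continuous_on S ?D" for S by (intro continuous_on_real_polynomial_function real_polynomial_function_rot_deriv f)
  have cf: "continuous_on S f" for S by (intro continuous_on_real_polynomial_function f)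
  have "bounded (?D ` sphere 0 1)"
    by (intro compact_imp_bounded compact_continuous_image cD compact_sphere)
  then obtain B where B: "\<And>x. x \<in> sphere 0 1 \<Longrightarrow> norm (?D x) \<le> B" unfolding bounded_iff by blast
  have R0: "?R 0 x = x" for x by (simp add: plane_rotation_def)
  have RS: "?R h x \<in> sphere 0 1" if "x \<in> sphere 0 1" for h x
    using orthogonal_plane_rotation[of h] that by (simp add: orthogonal_transformation)
  have cR: "continuous_on S (?R h)" for S h
    unfolding plane_rotation_def by (intro continuous_intros)
  have cfR: "continuous_on S (\<lambda>x. f (?R h x))" for S h
    by (rule continuous_on_compose2[OF cf[of UNIV] cR]) auto
  have s_int: "integrable sphere_measure (s k)" for k
    unfolding s_def by (intro integrable_sphere_continuous continuous_intros cf cfR) (use t0[of k] in auto)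
  have "(LINT x|sphere_measure. s k x) = 0" for k
  proof -
    have "(LINT x|sphere_measure. s k x) = ((LINT x|sphere_measure. f (?R (t k) x)) - (LINT x|sphere_measure. f x)) / t k"
      unfolding s_def using integrable_sphere_continuous[OF cf] integrable_sphere_continuous[OF cfR]
      by (simp add: Bochner_Integration.integral_diff)
    also have "(LINT x|sphere_measure. f (?R (t k) x)) = (LINT x|sphere_measure. f x)"
      by (rule integral_sphere_orthogonal_transformation[OF orthogonal_plane_rotation cf])
    finally show ?thesis by simp
  qed
  moreover have "(\<lambda>k. LINT x|sphere_measure. s k x) \<longlonglongrightarrow> (LINT x|sphere_measure. ?D x)"
  proof (rule integral_dominated_convergence[where w="\<lambda>_. B"])
    show "?D \<in> borel_measurable sphere_measure" by (rule borel_measurable_sphere_continuous[OF cD])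
    show "s k \<in> borel_measurable sphere_measure" for k using s_int[of k] by auto
    show "AE x in sphere_measure. (\<lambda>k. s k x) \<longlonglongrightarrow> ?D x"
    proof (intro AE_I2)
      fix x :: 'a
      have "((\<lambda>h. (f (?R (0 + h) x) - f (?R 0 x)) / h) \<longlongrightarrow> ?D (?R 0 x)) (at 0)"
        using DERIV_plane_rotation[OF f, of x 0] by (simp add: DERIV_def)
      moreover have "filterlim t (at 0) sequentially"
        unfolding filterlim_at using LIMSEQ_inverse_real_of_nat t0 by (auto simp: t_def[abs_def])
      ultimately show "(\<lambda>k. s k x) \<longlonglongrightarrow> ?D x"
        using filterlim_compose[of "\<lambda>h. (f (?R (0 + h) x) - f (?R 0 x)) / h" "nhds (?D x)" "at 0" t sequentially]
        by (simp add: R0 s_def)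
    qed
    \<comment> \<open>By the mean value theorem a difference quotient is a value of
      \<open>?D\<close> at a rotated point, again on the sphere, where \<open>?D\<close> is bounded
      by \<open>B\<close>.\<close>
    show "AE x in sphere_measure. norm (s k x) \<le> B" for k
    proof (intro AE_I2)
      fix x :: 'a assume x: "x \<in> space sphere_measure"
      have "\<exists>z. 0 < z \<and> z < t k \<and> f (?R (t k) x) - f (?R 0 x) = (t k - 0) * ?D (?R z x)"
        by (rule MVT2) (use t0 DERIV_plane_rotation[OF f] in auto)
      then obtain z where "f (?R (t k) x) - f x = t k * ?D (?R z x)" by (auto simp: R0)
      then have "s k x = ?D (?R z x)" using t0[of k] by (simp add: s_def)
      then show "norm (s k x) \<le> B" using B RS x by simp
    qed
  qed auto
  ultimately have "(\<lambda>k. 0) \<longlonglongrightarrow> (LINT x|sphere_measure. ?D x)" by simp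
  then show ?thesis using LIMSEQ_unique tendsto_const by blast
qed

text \<open>Integration by parts on the sphere: \<open>rot_deriv\<close> is a derivation, and the
  derivative of the product integrates to 0.\<close>

lemma integral_rot_deriv_skew:
  assumes f: "real_polynomial_function f" and g: "real_polynomial_function g"
  shows "(LINT x|sphere_measure. rot_deriv u v f x * g x) = - (LINT x|sphere_measure. f x * rot_deriv u v g x)"
proof -
  have int: "integrable sphere_measure (\<lambda>x. p x * q x)" if "real_polynomial_function p" "real_polynomial_function q"
    for p q :: "'a \<Rightarrow> real"
    by (intro integrable_sphere_continuous continuous_on_real_polynomial_function real_polynomial_function.intros(4) that)
  have "rot_deriv u v (\<lambda>x. f x * g x) = (\<lambda>x. rot_deriv u v f x * g x + f x * rot_deriv u v g x)"
    by (simp add: fun_eq_iff rot_deriv_def dir_deriv_mult[OF f g] algebra_simps)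
  then have "0 = (LINT x|sphere_measure. rot_deriv u v f x * g x + f x * rot_deriv u v g x)"
    using integral_rot_deriv[OF real_polynomial_function.intros(4)[OF f g]] by simp
  also have "\<dots> = (LINT x|sphere_measure. rot_deriv u v f x * g x) + (LINT x|sphere_measure. f x * rot_deriv u v g x)"
    by (intro Bochner_Integration.integral_add int f g real_polynomial_function_rot_deriv)
  finally show ?thesis by simp
qed

end

section \<open>Finite systems of linear equations\<close>

text \<open>Gaussian elimination: an equation \<open>f\<close> with a nonzero coefficient at
  \<open>j\<close> is solved for the unknown \<open>j\<close> and substituted into the others, which
  costs one equation and one unknown.\<close>

lemma exists_nontrivial_solution:
  fixes A :: "'i \<Rightarrow> 'f \<Rightarrow> real"
  assumes "finite F" "finite I" "card F < card I"
  shows "\<exists>b. (\<exists>i\<in>I. b i \<noteq> 0) \<and> (\<forall>f\<in>F. (\<Sum>i\<in>I. b i * A i f) = 0)"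
  using assms
proof (induction F arbitrary: I A rule: finite_induct)
  case empty
  then have "I \<noteq> {}" by auto
  then show ?case by (intro exI[of _ "\<lambda>_. 1"]) auto
next
  case (insert f F)
  show ?case
  proof (cases "\<forall>i\<in>I. A i f = 0")
    case True
    obtain b where "\<exists>i\<in>I. b i \<noteq> 0" "\<forall>g\<in>F. (\<Sum>i\<in>I. b i * A i g) = 0"
      using insert.IH[of I A] insert.prems insert.hyps by auto
    then show ?thesis using True by (intro exI[of _ b]) auto
  next
    case False
    then obtain j where j: "j \<in> I" "A j f \<noteq> 0" by blast
    let ?J = "I - {j}" and ?A = "\<lambda>i g. A i g - (A i f / A j f) * A j g"
    have "finite ?J" "card F < card ?J" using insert.prems insert.hyps j by auto
    from insert.IH[OF this, of ?A]
    obtain b where b: "\<exists>i\<in>?J. b i \<noteq> 0" "\<forall>g\<in>F. (\<Sum>i\<in>?J. b i * ?A i g) = 0"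
      by blast
    \<comment> \<open>The value at \<open>j\<close> is the one that makes equation \<open>f\<close>
      hold.\<close>
    define b' where "b' = b(j := - (\<Sum>i\<in>?J. b i * A i f) / A j f)"
    have sum: "(\<Sum>i\<in>I. b' i * A i g) = (\<Sum>i\<in>?J. b i * ?A i g)" for g
    proof -
      have "(\<Sum>i\<in>I. b' i * A i g) = b' j * A j g + (\<Sum>i\<in>?J. b' i * A i g)"
        using insert.prems j by (subst sum.remove[of _ j]) auto
      also have "(\<Sum>i\<in>?J. b' i * A i g) = (\<Sum>i\<in>?J. b i * A i g)"
        by (rule sum.cong) (auto simp: b'_def)
      also have "b' j * A j g = - (\<Sum>i\<in>?J. b i * ((A i f / A j f) * A j g))"
        by (simp add: b'_def sum_divide_distrib sum_distrib_right mult.assoc)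
      finally show ?thesis by (simp add: right_diff_distrib sum_subtractf)
    qed
    have "\<exists>i\<in>I. b' i \<noteq> 0" using b(1) by (auto simp: b'_def)
    moreover have "(\<Sum>i\<in>I. b' i * A i g) = 0" if "g \<in> insert f F" for g
    proof (cases "g = f")
      case True
      then show ?thesis unfolding sum using j by simp
    qed (use b(2) that sum in auto)
    ultimately show ?thesis by blast
  qed
qed

text \<open>Finite-dimensional separation of a vector from a subspace, with vectors given by values
  on \<open>X\<close>. It yields both the dual weights of the harmonics and the solvability of
  interpolation. Induction on the points eliminates one coordinate \<open>z\<close> at a
  time.\<close>

lemma exists_separating_functional:
  fixes U :: "('b \<Rightarrow> real) set" and v :: "'b \<Rightarrow> real"
  assumes "finite X"
    and "(\<lambda>x. 0) \<in> U"
    and "\<And>f g. f \<in> U \<Longrightarrow> g \<in> U \<Longrightarrow> (\<lambda>x. f x + g x) \<in> U"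
    and "\<And>a f. f \<in> U \<Longrightarrow> (\<lambda>x. a * f x) \<in> U"
    and "\<And>u. u \<in> U \<Longrightarrow> \<exists>x\<in>X. u x \<noteq> v x"
  shows "\<exists>w. (\<forall>u\<in>U. (\<Sum>x\<in>X. w x * u x) = 0) \<and> (\<Sum>x\<in>X. w x * v x) \<noteq> 0"
  using assms
proof (induction X arbitrary: U v rule: finite_induct)
  case empty
  then show ?case by blast
next
  case (insert z X)
  note zero = insert.prems(1) and add = insert.prems(2) and scale = insert.prems(3)
  have sum_upd: "(\<Sum>x\<in>insert z X. (w(z := a)) x * f x) = a * f z + (\<Sum>x\<in>X. w x * f x)" for w f a
  proof -
    have "(\<Sum>x\<in>X. (w(z := a)) x * f x) = (\<Sum>x\<in>X. w x * f x)"
      using insert.hyps by (intro sum.cong) auto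
    then show ?thesis using insert.hyps by simp
  qed
  show ?case
  proof (cases "\<forall>u\<in>U. u z = 0")
    case U0: True
    show ?thesis
    proof (cases "v z = 0")
      case True
      have "\<exists>w. (\<forall>u\<in>U. (\<Sum>x\<in>X. w x * u x) = 0) \<and> (\<Sum>x\<in>X. w x * v x) \<noteq> 0"
      proof (rule insert.IH)
        show "\<exists>x\<in>X. u x \<noteq> v x" if "u \<in> U" for u using insert.prems(4)[OF that] U0 that True by auto
      qed (use zero add scale in auto)
      then obtain w where w: "\<forall>u\<in>U. (\<Sum>x\<in>X. w x * u x) = 0" "(\<Sum>x\<in>X. w x * v x) \<noteq> 0" by blast
      show ?thesis by (rule exI[of _ "w(z := 0)"]) (use w in \<open>auto simp only: sum_upd mult_zero_left add_0\<close>)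
    next
      case False
      show ?thesis
        by (rule exI[of _ "(\<lambda>_. 0)(z := 1)"]) (use U0 False in \<open>auto simp only: sum_upd; simp\<close>)
    qed
  next
    case False
    then obtain f where f: "f \<in> U" "f z \<noteq> 0" by blast
    \<comment> \<open>Multiples of \<open>f\<close> reduce everything to functions vanishing at
      \<open>z\<close>: \<open>?U\<close> is the corresponding part of \<open>U\<close>, and
      \<open>?v\<close> is \<open>v\<close> corrected to be 0 at \<open>z\<close>.\<close>
    let ?U = "{u \<in> U. u z = 0}" and ?v = "\<lambda>x. v x + (- v z / f z) * f x"
    have "\<exists>w. (\<forall>u\<in>?U. (\<Sum>x\<in>X. w x * u x) = 0) \<and> (\<Sum>x\<in>X. w x * ?v x) \<noteq> 0"
    proof (rule insert.IH)
      show "\<exists>x\<in>X. u x \<noteq> ?v x" if "u \<in> ?U" for u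
      proof (rule ccontr)
        assume "\<not> ?thesis"
        then have eq: "u x = ?v x" if "x \<in> X" for x using that by blast
        have "(\<lambda>x. u x + (v z / f z) * f x) \<in> U" using that f by (intro add scale) auto
        from insert.prems(4)[OF this] eq that f show False by auto
      qed
    qed (use zero add scale in auto)
    then obtain w where w: "\<And>u. u \<in> ?U \<Longrightarrow> (\<Sum>x\<in>X. w x * u x) = 0" "(\<Sum>x\<in>X. w x * ?v x) \<noteq> 0" by blast
    \<comment> \<open>The weight at \<open>z\<close> is chosen so that the functional annihilates
      \<open>f\<close>; then \<open>u\<close> and its reduction modulo \<open>f\<close> get the same
      value, which is \<open>reduce\<close>.\<close>
    let ?w = "w(z := - (\<Sum>x\<in>X. w x * f x) / f z)"
    have reduce: "(\<Sum>x\<in>insert z X. ?w x * u x) = (\<Sum>x\<in>X. w x * (u x + (- u z / f z) * f x))" for u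
    proof -
      have "(\<Sum>x\<in>X. w x * (u x + (- u z / f z) * f x))
          = (\<Sum>x\<in>X. w x * u x) + (\<Sum>x\<in>X. (- u z / f z) * (w x * f x))"
        by (simp add: distrib_left sum.distrib mult_ac sum_negf sum_subtractf right_diff_distrib)
      also have "(\<Sum>x\<in>X. (- u z / f z) * (w x * f x)) = (- u z / f z) * (\<Sum>x\<in>X. w x * f x)"
        by (rule sum_distrib_left[symmetric])
      finally show ?thesis unfolding sum_upd by simp
    qed
    have "(\<Sum>x\<in>insert z X. ?w x * u x) = 0" if "u \<in> U" for u
    proof -
      have "(\<lambda>x. u x + (- u z / f z) * f x) \<in> ?U" using add[OF that scale[OF f(1), of "- u z / f z"]] f(2) by simp
      from w(1)[OF this] show ?thesis unfolding reduce .
    qed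
    moreover have "(\<Sum>x\<in>insert z X. ?w x * v x) \<noteq> 0" unfolding reduce by (rule w(2))
    ultimately show ?thesis by blast
  qed
qed

section \<open>Harmonic polynomials\<close>

definition harmonic_poly :: "nat \<Rightarrow> ('a::euclidean_space \<Rightarrow> real) \<Rightarrow> bool" where
  "harmonic_poly l f \<longleftrightarrow> real_polynomial_function f \<and> homogeneous l f \<and>
     (\<forall>x. (\<Sum>b\<in>Basis. dir_deriv b (dir_deriv b f) x) = 0)"

lemma harmonic_polyD:
  assumes "harmonic_poly l f"
  shows "real_polynomial_function f" "homogeneous l f" "(\<Sum>b\<in>Basis. dir_deriv b (dir_deriv b f) x) = 0"
  using assms by (auto simp: harmonic_poly_def)

lemma spherical_harmonic_iff:
  "spherical_harmonic l h \<longleftrightarrow> (\<exists>P. harmonic_poly l P \<and> (\<forall>x\<in>sphere 0 1. h x = P x))"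
proof -
  have "harmonic_poly l P \<longleftrightarrow> real_polynomial_function P \<and> (\<forall>t x. P (t *\<^sub>R x) = t ^ l * P x) \<and> (\<forall>x. laplacian P x = 0)"
    for P :: "'a \<Rightarrow> real"
    by (auto simp: harmonic_poly_def homogeneous_def laplacian_eq_sum_dir_deriv)
  then show ?thesis by (auto simp: spherical_harmonic_def)
qed

lemma harmonic_poly_sum:
  assumes "finite I" "\<And>i. i \<in> I \<Longrightarrow> harmonic_poly l (f i)"
  shows "harmonic_poly l (\<lambda>x. \<Sum>i\<in>I. a i * f i x)"
proof -
  note rpf = harmonic_polyD(1)[OF assms(2)]
  have rpf': "real_polynomial_function (\<lambda>x. a i * f i x)" if "i \<in> I" for i
    by (intro real_polynomial_function.intros rpf that)
  have d: "dir_deriv b (\<lambda>x. \<Sum>i\<in>I. a i * f i x) = (\<lambda>x. \<Sum>i\<in>I. a i * dir_deriv b (f i) x)" for b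
    by (rule ext) (simp add: dir_deriv_sum rpf' dir_deriv_cmult rpf)
  have rpfd: "real_polynomial_function (\<lambda>x. a i * dir_deriv b (f i) x)" if "i \<in> I" for i b
    by (intro real_polynomial_function.intros real_polynomial_function_dir_deriv rpf that)
  have d2: "dir_deriv b (dir_deriv b (\<lambda>x. \<Sum>i\<in>I. a i * f i x)) x = (\<Sum>i\<in>I. a i * dir_deriv b (dir_deriv b (f i)) x)" for b x
    unfolding d by (simp add: dir_deriv_sum rpfd dir_deriv_cmult rpf real_polynomial_function_dir_deriv)
  have "(\<Sum>b\<in>Basis. dir_deriv b (dir_deriv b (\<lambda>x. \<Sum>i\<in>I. a i * f i x)) x) = 0" for x
  proof -
    have "(\<Sum>b\<in>Basis. dir_deriv b (dir_deriv b (\<lambda>x. \<Sum>i\<in>I. a i * f i x)) x)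
        = (\<Sum>i\<in>I. a i * (\<Sum>b\<in>Basis. dir_deriv b (dir_deriv b (f i)) x))"
      unfolding d2 sum_distrib_left by (rule sum.swap)
    then show ?thesis using harmonic_polyD(3)[OF assms(2)] by simp
  qed
  moreover have "homogeneous l (\<lambda>x. \<Sum>i\<in>I. a i * f i x)"
    using harmonic_polyD(2)[OF assms(2)] by (simp add: homogeneous_def sum_distrib_left mult_ac)
  moreover have "real_polynomial_function (\<lambda>x. \<Sum>i\<in>I. a i * f i x)"
    by (intro real_polynomial_function_sum assms(1) rpf')
  ultimately show ?thesis by (simp add: harmonic_poly_def)
qed

lemma dir_deriv2_Basis:
  fixes f :: "'a::euclidean_space \<Rightarrow> real"
  assumes f: "real_polynomial_function f"
  shows "dir_deriv u (dir_deriv v f) x =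
    (\<Sum>i\<in>Basis. \<Sum>j\<in>Basis. (u \<bullet> i) * (v \<bullet> j) * dir_deriv i (dir_deriv j f) x)"
proof -
  note df = real_polynomial_function_dir_deriv[OF f]
  have "dir_deriv v f = (\<lambda>x. \<Sum>j\<in>Basis. (v \<bullet> j) * dir_deriv j f x)"
    by (rule ext) (rule dir_deriv_Basis[OF f])
  then have "dir_deriv i (dir_deriv v f) x = (\<Sum>j\<in>Basis. (v \<bullet> j) * dir_deriv i (dir_deriv j f) x)" for i
    by (simp add: dir_deriv_sum real_polynomial_function.intros df dir_deriv_cmult)
  then show ?thesis
    by (subst dir_deriv_Basis[OF df]) (simp add: sum_distrib_left mult_ac)
qed

text \<open>The Laplacian is the trace of the Hessian, and an orthogonal map sends the standard
  basis to another orthonormal basis, which computes the same trace.\<close>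

lemma harmonic_poly_orthogonal_transformation:
  fixes f :: "'a::euclidean_space \<Rightarrow> real" and R :: "'a \<Rightarrow> 'a"
  assumes f: "harmonic_poly l f" and R: "orthogonal_transformation R"
  shows "harmonic_poly l (\<lambda>x. f (R x))"
proof -
  note rpf = harmonic_polyD(1)[OF f]
  have lin: "linear R" and bl: "bounded_linear R"
    using R by (auto simp: orthogonal_transformation linear_linear)
  have chain: "dir_deriv v (\<lambda>x. g (R x)) x = dir_deriv (R v) g (R x)"
    if "real_polynomial_function g" for g v x
    by (rule dir_deriv_eqI, rule has_derivative_dir_deriv_chain[OF that])
       (rule bounded_linear_imp_has_derivative[OF bl])
  have d2: "dir_deriv b (dir_deriv b (\<lambda>x. f (R x))) x = dir_deriv (R b) (dir_deriv (R b) f) (R x)" for b x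
  proof -
    have "dir_deriv b (\<lambda>x. f (R x)) = (\<lambda>x. dir_deriv (R b) f (R x))"
      by (rule ext) (rule chain[OF rpf])
    then show ?thesis by (simp add: chain real_polynomial_function_dir_deriv[OF rpf])
  qed
  define S where "S = inv_into UNIV R"
  have S: "orthogonal_transformation S" unfolding S_def using R by (rule orthogonal_transformation_inv)
  have RS: "R (S x) = x" for x
    unfolding S_def using orthogonal_transformation_surj[OF R] by (simp add: surj_f_inv_f)
  have adj: "R b \<bullet> c = S c \<bullet> b" for b c
  proof -
    have "R b \<bullet> R (S c) = b \<bullet> S c" using R unfolding orthogonal_transformation_def by blast
    then show ?thesis unfolding RS by (rule trans) (rule inner_commute)
  qed
  \<comment> \<open>The adjoint of \<open>R\<close> is its inverse \<open>S\<close>, so the sum is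
    the coordinate expansion of \<open>S i \<bullet> S j\<close>.\<close>
  have trace: "(\<Sum>b\<in>Basis. (R b \<bullet> i) * (R b \<bullet> j)) = i \<bullet> j" for i j
  proof -
    have "S i \<bullet> S j = (\<Sum>b\<in>Basis. (R b \<bullet> i) * (R b \<bullet> j))"
      unfolding adj by (rule euclidean_inner)
    moreover have "S i \<bullet> S j = i \<bullet> j" using S unfolding orthogonal_transformation_def by blast
    ultimately show ?thesis by simp
  qed
  have "(\<Sum>b\<in>Basis. dir_deriv b (dir_deriv b (\<lambda>x. f (R x))) x) = 0" for x
  proof -
    let ?H = "\<lambda>i j. dir_deriv i (dir_deriv j f) (R x)"
    have "(\<Sum>b\<in>Basis. dir_deriv b (dir_deriv b (\<lambda>x. f (R x))) x)
        = (\<Sum>b\<in>Basis. \<Sum>i\<in>Basis. \<Sum>j\<in>Basis. (R b \<bullet> i) * (R b \<bullet> j) * ?H i j)"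
      unfolding d2 by (simp only: dir_deriv2_Basis[OF rpf, of "R _" "R _"])
    also have "\<dots> = (\<Sum>i\<in>Basis. \<Sum>b\<in>Basis. \<Sum>j\<in>Basis. (R b \<bullet> i) * (R b \<bullet> j) * ?H i j)"
      by (rule sum.swap)
    also have "\<dots> = (\<Sum>i\<in>Basis. \<Sum>j\<in>Basis. \<Sum>b\<in>Basis. (R b \<bullet> i) * (R b \<bullet> j) * ?H i j)"
      by (intro sum.cong refl sum.swap)
    also have "\<dots> = (\<Sum>i\<in>Basis. \<Sum>j\<in>Basis. (i \<bullet> j) * ?H i j)"
      by (simp add: sum_distrib_right[symmetric] trace)
    also have "\<dots> = (\<Sum>i\<in>Basis. ?H i i)"
      by (intro sum.cong refl) (simp add: inner_Basis if_distrib[of "\<lambda>t. t * _"] sum.delta cong: if_cong)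
    also have "\<dots> = 0" by (rule harmonic_polyD(3)[OF f])
    finally show ?thesis .
  qed
  moreover have "homogeneous l (\<lambda>x. f (R x))"
    using harmonic_polyD(2)[OF f] lin by (simp add: homogeneous_def linear_scale)
  moreover have "real_polynomial_function (\<lambda>x. f (R x))"
    using real_polynomial_function_compose[OF polynomial_function_bounded_linear[OF bl] rpf] by (simp add: o_def)
  ultimately show ?thesis by (simp add: harmonic_poly_def)
qed

section \<open>Orthogonality of harmonic polynomials of different degree\<close>

lemma rot_deriv_self [simp]: "rot_deriv u u f x = 0"
  by (simp add: rot_deriv_def)

text \<open>The quadratic Casimir operator of the rotation group. For homogeneous harmonic
  \<open>f\<close> only the Euler terms survive, giving the Laplace-Beltrami eigenvalue; the factor
  2 arises because ordered pairs (i, j) are summed.\<close>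

lemma harmonic_poly_Casimir:
  fixes f :: "'a::euclidean_space \<Rightarrow> real"
  assumes f: "harmonic_poly l f"
  shows "(\<Sum>i\<in>Basis. \<Sum>j\<in>Basis. rot_deriv i j (rot_deriv i j f) x)
    = - 2 * real l * (real l + real DIM('a) - 2) * f x"
proof -
  note rpf = harmonic_polyD(1)[OF f] and hom = harmonic_polyD(2)[OF f]
  note df = real_polynomial_function_dir_deriv[OF rpf]
  let ?d = "\<lambda>i. dir_deriv i f x" and ?H = "\<lambda>i j. dir_deriv i (dir_deriv j f) x"
  have drot: "dir_deriv v (rot_deriv i j f) x
      = (v \<bullet> i) * ?d j + (x \<bullet> i) * ?H v j - ((v \<bullet> j) * ?d i + (x \<bullet> j) * ?H v i)" for v i j
    unfolding rot_deriv_def[abs_def]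
    by (simp add: dir_deriv_diff dir_deriv_mult df real_polynomial_function_inner real_polynomial_function.intros(4))
  have E: "(\<Sum>i\<in>Basis. (x \<bullet> i) * ?d i) = real l * f x"
    using dir_deriv_Basis[OF rpf, of x x] homogeneous_Euler[OF rpf hom, of x] by simp
  have E2: "(\<Sum>i\<in>Basis. \<Sum>j\<in>Basis. (x \<bullet> i) * (x \<bullet> j) * ?H i j) = real l * (real l - 1) * f x"
    using dir_deriv2_Basis[OF rpf, of x x x] homogeneous_Euler2[OF rpf hom, of x] by simp
  have L: "(\<Sum>i\<in>Basis. ?H i i) = 0" by (rule harmonic_polyD(3)[OF f])
  \<comment> \<open>The terms with \<open>i \<bullet> j\<close> make the formula valid on the
    diagonal as well, where both sides are 0, so the double sum can be split freely.\<close>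
  have "rot_deriv i j (rot_deriv i j f) x =
      ((x \<bullet> i)\<^sup>2 * ?H j j + (x \<bullet> j)\<^sup>2 * ?H i i) - 2 * ((x \<bullet> i) * (x \<bullet> j) * ?H i j)
       - ((x \<bullet> i) * ?d i + (x \<bullet> j) * ?d j) + (i \<bullet> j) * ((x \<bullet> i) * ?d j + (x \<bullet> j) * ?d i)"
    if "i \<in> Basis" "j \<in> Basis" for i j
    using that dir_deriv_commute[OF rpf, of j i x]
    by (subst rot_deriv_def) (simp add: drot inner_commute[of j i] algebra_simps power2_eq_square)
  then have "(\<Sum>i\<in>Basis. \<Sum>j\<in>Basis. rot_deriv i j (rot_deriv i j f) x) =
      (\<Sum>i\<in>Basis. \<Sum>j\<in>Basis. ((x \<bullet> i)\<^sup>2 * ?H j j + (x \<bullet> j)\<^sup>2 * ?H i i) - 2 * ((x \<bullet> i) * (x \<bullet> j) * ?H i j)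
       - ((x \<bullet> i) * ?d i + (x \<bullet> j) * ?d j) + (i \<bullet> j) * ((x \<bullet> i) * ?d j + (x \<bullet> j) * ?d i))"
    by (intro sum.cong refl) auto
  also have "\<dots> = (\<Sum>i\<in>Basis. \<Sum>j\<in>Basis. (x \<bullet> i)\<^sup>2 * ?H j j) + (\<Sum>i\<in>Basis. \<Sum>j\<in>Basis. (x \<bullet> j)\<^sup>2 * ?H i i)
       - 2 * (\<Sum>i\<in>Basis. \<Sum>j\<in>Basis. (x \<bullet> i) * (x \<bullet> j) * ?H i j)
       - ((\<Sum>i\<in>Basis. \<Sum>j\<in>(Basis :: 'a set). (x \<bullet> i) * ?d i) + (\<Sum>i\<in>(Basis :: 'a set). \<Sum>j\<in>Basis. (x \<bullet> j) * ?d j))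
       + (\<Sum>i\<in>Basis. \<Sum>j\<in>Basis. (i \<bullet> j) * ((x \<bullet> i) * ?d j + (x \<bullet> j) * ?d i))"
    by (simp only: sum.distrib sum_subtractf sum_distrib_left)
  also have "(\<Sum>i\<in>Basis. \<Sum>j\<in>Basis. (x \<bullet> i)\<^sup>2 * ?H j j) = 0"
    by (simp add: sum_distrib_left[symmetric] L)
  also have "(\<Sum>i\<in>Basis. \<Sum>j\<in>Basis. (x \<bullet> j)\<^sup>2 * ?H i i) = 0"
    by (simp add: sum_distrib_right[symmetric] sum_distrib_left[symmetric] L)
  also have "(\<Sum>i\<in>Basis. \<Sum>j\<in>(Basis :: 'a set). (x \<bullet> i) * ?d i) = real DIM('a) * (real l * f x)"
    by (simp add: sum_distrib_left[symmetric] E)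
  also have "(\<Sum>i\<in>(Basis :: 'a set). \<Sum>j\<in>Basis. (x \<bullet> j) * ?d j) = real DIM('a) * (real l * f x)"
    by (simp add: E)
  also have "(\<Sum>i\<in>Basis. \<Sum>j\<in>Basis. (i \<bullet> j) * ((x \<bullet> i) * ?d j + (x \<bullet> j) * ?d i))
      = (\<Sum>i\<in>Basis. 2 * ((x \<bullet> i) * ?d i))"
    by (intro sum.cong refl) (simp add: inner_Basis if_distrib[of "\<lambda>t. t * _"] sum.delta cong: if_cong)
  also have "\<dots> = 2 * (real l * f x)" by (simp add: sum_distrib_left[symmetric] E)
  finally show ?thesis unfolding E2 by (simp add: algebra_simps)
qed

lemma integrable_sphere_poly:
  fixes f :: "'a::euclidean_space \<Rightarrow> real"
  shows "real_polynomial_function f \<Longrightarrow> integrable sphere_measure f"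
  by (intro integrable_sphere_continuous continuous_on_real_polynomial_function)

text \<open>Two skew-symmetric steps make the square symmetric.\<close>

lemma integral_rot_deriv2:
  fixes f g :: "'a::euclidean_space \<Rightarrow> real"
  assumes f: "real_polynomial_function f" and g: "real_polynomial_function g"
    and ij: "i \<in> Basis" "j \<in> Basis"
  shows "(LINT x|sphere_measure. rot_deriv i j (rot_deriv i j f) x * g x)
    = (LINT x|sphere_measure. f x * rot_deriv i j (rot_deriv i j g) x)"
proof (cases "i = j")
  case False
  with ij have o: "i \<bullet> i = 1" "j \<bullet> j = 1" "i \<bullet> j = 0" by (auto simp: inner_Basis)
  note r = real_polynomial_function_rot_deriv
  show ?thesis
    using integral_rot_deriv_skew[OF o r[OF f, of i j] g] integral_rot_deriv_skew[OF o f r[OF g, of i j]] by simp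
qed simp

text \<open>The Casimir operator is symmetric, and \<open>f\<close> and \<open>g\<close> are
  eigenfunctions with different eigenvalues.\<close>

lemma harmonic_poly_orthogonal:
  fixes f g :: "'a::euclidean_space \<Rightarrow> real"
  assumes f: "harmonic_poly l f" and g: "harmonic_poly k g" and lk: "l \<noteq> k" and dim: "DIM('a) \<ge> 2"
  shows "(LINT x|sphere_measure. f x * g x) = 0"
proof -
  note rf = harmonic_polyD(1)[OF f] and rg = harmonic_polyD(1)[OF g]
  note r = real_polynomial_function_rot_deriv
  define a where "a = (\<lambda>l. 2 * real l * (real l + real DIM('a) - 2))"
  let ?I = "LINT x|sphere_measure. f x * g x"
  have int: "integrable sphere_measure (\<lambda>x. p x * q x)" if "real_polynomial_function p" "real_polynomial_function q"
    for p q :: "'a \<Rightarrow> real"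
    by (intro integrable_sphere_poly real_polynomial_function.intros(4) that)
  have "- a l * ?I = (LINT x|sphere_measure. (\<Sum>i\<in>Basis. \<Sum>j\<in>Basis. rot_deriv i j (rot_deriv i j f) x) * g x)"
    unfolding harmonic_poly_Casimir[OF f] a_def by (simp add: mult.assoc)
  also have "\<dots> = (\<Sum>i\<in>Basis. \<Sum>j\<in>Basis. LINT x|sphere_measure. rot_deriv i j (rot_deriv i j f) x * g x)"
    unfolding sum_distrib_right
    by (subst Bochner_Integration.integral_sum, intro Bochner_Integration.integrable_sum int r rf rg)
       (intro sum.cong refl Bochner_Integration.integral_sum int r rf rg)
  also have "\<dots> = (\<Sum>i\<in>Basis. \<Sum>j\<in>Basis. LINT x|sphere_measure. f x * rot_deriv i j (rot_deriv i j g) x)"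
    by (intro sum.cong refl integral_rot_deriv2 rf rg)
  also have "\<dots> = (LINT x|sphere_measure. f x * (\<Sum>i\<in>Basis. \<Sum>j\<in>Basis. rot_deriv i j (rot_deriv i j g) x))"
    unfolding sum_distrib_left
    by (subst Bochner_Integration.integral_sum, intro Bochner_Integration.integrable_sum int r rf rg)
       (intro sum.cong refl Bochner_Integration.integral_sum[symmetric] int r rf rg)
  also have "\<dots> = - a k * ?I"
  proof -
    have "(\<lambda>x. f x * (- 2 * real k * (real k + real DIM('a) - 2) * g x)) = (\<lambda>x. (- a k) * (f x * g x))"
      by (simp add: a_def fun_eq_iff)
    then show ?thesis unfolding harmonic_poly_Casimir[OF g] by simp
  qed
  finally have "(a l - a k) * ?I = 0" by (simp add: algebra_simps)
  moreover have "a l - a k = 2 * (real l - real k) * (real l + real k + (real DIM('a) - 2))"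
    by (simp add: a_def algebra_simps)
  \<comment> \<open>This factor makes the eigenvalues distinct: l + k is at least 1 because l and k
    differ, and DIM('a) - 2 is nonnegative.\<close>
  moreover have "real l + real k + (real DIM('a) - 2) > 0"
    using lk dim by linarith
  ultimately show ?thesis using lk by simp
qed

section \<open>The reproducing kernel of the spherical harmonics of fixed degree\<close>

lemma sphere_inner_cong:
  assumes "\<And>x. x \<in> sphere 0 1 \<Longrightarrow> f x = f' x" "\<And>x. x \<in> sphere 0 1 \<Longrightarrow> g x = g' x"
  shows "sphere_inner f g = sphere_inner f' g'"
  unfolding sphere_inner_def by (rule Bochner_Integration.integral_cong) (use assms in auto)

lemma exists_orthogonal_transformation:
  fixes x y :: "'a::euclidean_space"
  assumes "norm x = norm y"
  obtains R :: "'a \<Rightarrow> 'a" where "orthogonal_transformation R" "R x = y"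
proof (cases "x = y")
  case True
  then show ?thesis using that[of "\<lambda>x. x"] by (simp add: orthogonal_transformation_def linear_ident)
next
  case False
  define w where "w = x - y"
  have w0: "w \<bullet> w \<noteq> 0" using False by (simp add: w_def)
  \<comment> \<open>The reflection in the hyperplane orthogonal to x - y, which exchanges two
    vectors of equal norm.\<close>
  define R where "R z = z - (2 * (z \<bullet> w) / (w \<bullet> w)) *\<^sub>R w" for z
  have "linear R"
    by (rule linearI) (simp_all add: R_def inner_add_left algebra_simps add_divide_distrib)
  moreover have "R z \<bullet> R z' = z \<bullet> z'" for z z'
    using w0 by (simp add: R_def inner_diff_left inner_diff_right inner_commute field_simps)
  moreover have "R x = y"
  proof -
    have "x \<bullet> x = y \<bullet> y" using assms by (simp add: norm_eq)
    then have "2 * (x \<bullet> w) = w \<bullet> w" by (simp add: w_def inner_diff_left inner_diff_right inner_commute)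
    then show ?thesis using w0 by (simp add: R_def) (simp add: w_def)
  qed
  ultimately show ?thesis using that[of R] by (simp add: orthogonal_transformation_def)
qed

locale harmonic_bases =
  fixes Y :: "nat \<Rightarrow> nat \<Rightarrow> 'a::euclidean_space \<Rightarrow> real" and N :: "nat \<Rightarrow> nat"
  assumes bases: "spherical_harmonic_bases Y N"
    and dim: "DIM('a) \<ge> 3"
begin

text \<open>\<open>Y l \<mu>\<close> is constrained only on the sphere; derivatives need a harmonic
  polynomial extension, chosen here once and for all.\<close>

definition P :: "nat \<Rightarrow> nat \<Rightarrow> 'a \<Rightarrow> real" where
  "P l \<mu> = (SOME P. harmonic_poly l P \<and> (\<forall>x\<in>sphere 0 1. Y l \<mu> x = P x))"

lemma P:
  assumes "\<mu> \<in> {1..N l}"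
  shows "harmonic_poly l (P l \<mu>)" "\<And>x. x \<in> sphere 0 1 \<Longrightarrow> Y l \<mu> x = P l \<mu> x"
proof -
  have "\<exists>P. harmonic_poly l P \<and> (\<forall>x\<in>sphere 0 1. Y l \<mu> x = P x)"
    using bases assms unfolding spherical_harmonic_bases_def spherical_harmonic_iff by blast
  from someI_ex[OF this]
  show "harmonic_poly l (P l \<mu>)" "\<And>x. x \<in> sphere 0 1 \<Longrightarrow> Y l \<mu> x = P l \<mu> x"
    unfolding P_def by blast+
qed

lemma continuous_on_Y:
  assumes "\<mu> \<in> {1..N l}"
  shows "continuous_on (sphere 0 1) (Y l \<mu>)"
  using continuous_on_real_polynomial_function[OF harmonic_polyD(1)[OF P(1)[OF assms]]] P(2)[OF assms]
  by (metis (no_types, lifting) continuous_on_cong)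

lemma integrable_Y_mult:
  assumes "\<mu> \<in> {1..N l}" "\<kappa> \<in> {1..N k}"
  shows "integrable sphere_measure (\<lambda>x. Y l \<mu> x * Y k \<kappa> x)"
  by (intro integrable_sphere_continuous continuous_intros continuous_on_Y assms)

lemma sphere_inner_Y:
  assumes "\<mu> \<in> {1..N l}" "\<kappa> \<in> {1..N k}"
  shows "sphere_inner (Y l \<mu>) (Y k \<kappa>) = (if l = k \<and> \<mu> = \<kappa> then 1 else 0)"
proof (cases "l = k")
  case True
  then show ?thesis using bases assms unfolding spherical_harmonic_bases_def by auto
next
  case False
  have "sphere_inner (Y l \<mu>) (Y k \<kappa>) = sphere_inner (P l \<mu>) (P k \<kappa>)"
    by (rule sphere_inner_cong) (use P(2) assms in auto)
  also have "\<dots> = 0"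
    unfolding sphere_inner_def
    by (rule harmonic_poly_orthogonal[OF P(1)[OF assms(1)] P(1)[OF assms(2)] False]) (use dim in simp)
  finally show ?thesis using False by simp
qed

lemma integral_sum_Y_squared:
  "(LINT x|sphere_measure. (\<Sum>\<mu>=1..N l. a \<mu> * Y l \<mu> x)\<^sup>2) = (\<Sum>\<mu>=1..N l. (a \<mu>)\<^sup>2)"
proof -
  have "(LINT x|sphere_measure. (\<Sum>\<mu>=1..N l. a \<mu> * Y l \<mu> x)\<^sup>2)
      = (LINT x|sphere_measure. (\<Sum>\<mu>=1..N l. \<Sum>\<kappa>=1..N l. a \<mu> * a \<kappa> * (Y l \<mu> x * Y l \<kappa> x)))"
    by (simp add: power2_eq_square sum_product mult_ac)
  also have "\<dots> = (\<Sum>\<mu>=1..N l. \<Sum>\<kappa>=1..N l. LINT x|sphere_measure. a \<mu> * a \<kappa> * (Y l \<mu> x * Y l \<kappa> x))"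
  proof -
    have "integrable sphere_measure (\<lambda>x. a \<mu> * a \<kappa> * (Y l \<mu> x * Y l \<kappa> x))"
      if "\<mu> \<in> {1..N l}" "\<kappa> \<in> {1..N l}" for \<mu> \<kappa>
      using integrable_Y_mult[OF that] by (rule integrable_mult_right)
    then show ?thesis
      by (subst Bochner_Integration.integral_sum)
         (auto intro!: Bochner_Integration.integrable_sum sum.cong Bochner_Integration.integral_sum)
  qed
  also have "\<dots> = (\<Sum>\<mu>=1..N l. \<Sum>\<kappa>=1..N l. a \<mu> * a \<kappa> * (if \<mu> = \<kappa> then 1 else 0))"
    by (intro sum.cong refl) (use sphere_inner_Y in \<open>simp add: sphere_inner_def\<close>)
  also have "\<dots> = (\<Sum>\<mu>=1..N l. (a \<mu>)\<^sup>2)"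
    by (intro sum.cong refl) (simp add: power2_eq_square if_distrib[of "\<lambda>t. _ * t"] sum.delta cong: if_cong)
  finally show ?thesis .
qed

lemma expand_harmonic:
  assumes "harmonic_poly l f"
  obtains b where "\<And>x. x \<in> sphere 0 1 \<Longrightarrow> f x = (\<Sum>\<mu>=1..N l. b \<mu> * Y l \<mu> x)"
proof -
  have "spherical_harmonic l f" using assms unfolding spherical_harmonic_iff by blast
  then show ?thesis using bases that unfolding spherical_harmonic_bases_def by metis
qed

definition K :: "nat \<Rightarrow> 'a \<Rightarrow> 'a \<Rightarrow> real" where
  "K l x y = (\<Sum>\<mu>=1..N l. Y l \<mu> x * Y l \<mu> y)"

lemma K_diag: "K l x x = (\<Sum>\<mu>=1..N l. (Y l \<mu> x)\<^sup>2)"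
  by (simp add: K_def power2_eq_square)

text \<open>
  \<open>Z y = (\<Sum>\<mu>=1..N l. Y l \<mu> (R x) * Y l \<mu> (R y))\<close> has squared norm \<open>K l (R x) (R x) = Z x\<close>;
  expanding \<open>Z\<close> in the unrotated basis, the Cauchy-Schwarz inequality gives the bound.
\<close>

lemma K_diag_rotate_le:
  assumes R: "orthogonal_transformation R" and x: "x \<in> sphere 0 1"
  shows "K l (R x) (R x) \<le> K l x x"
proof -
  have RS: "R y \<in> sphere 0 1" if "y \<in> sphere 0 1" for y
    using R that by (simp add: orthogonal_transformation)
  define a where "a \<mu> = Y l \<mu> (R x)" for \<mu>
  define s where "s = K l (R x) (R x)"
  have s: "s = (\<Sum>\<mu>=1..N l. (a \<mu>)\<^sup>2)" by (simp add: s_def K_diag a_def)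
  define Z where "Z y = (\<Sum>\<mu>=1..N l. a \<mu> * P l \<mu> (R y))" for y
  have "harmonic_poly l Z"
    unfolding Z_def
    by (rule harmonic_poly_sum) (simp, rule harmonic_poly_orthogonal_transformation[OF P(1) R])
  then obtain b where b: "\<And>y. y \<in> sphere 0 1 \<Longrightarrow> Z y = (\<Sum>\<mu>=1..N l. b \<mu> * Y l \<mu> y)"
    by (rule expand_harmonic) blast
  have ZY: "Z y = (\<Sum>\<mu>=1..N l. a \<mu> * Y l \<mu> (R y))" if "y \<in> sphere 0 1" for y
    unfolding Z_def by (intro sum.cong refl) (use P(2) RS[OF that] in auto)
  have "(\<Sum>\<mu>=1..N l. (b \<mu>)\<^sup>2) = (LINT y|sphere_measure. (\<Sum>\<mu>=1..N l. b \<mu> * Y l \<mu> y)\<^sup>2)"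
    by (rule integral_sum_Y_squared[symmetric])
  also have "\<dots> = (LINT y|sphere_measure. (\<Sum>\<mu>=1..N l. a \<mu> * Y l \<mu> (R y))\<^sup>2)"
    by (rule Bochner_Integration.integral_cong) (use b ZY in auto)
  also have "\<dots> = (LINT y|sphere_measure. (\<Sum>\<mu>=1..N l. a \<mu> * Y l \<mu> y)\<^sup>2)"
    by (rule integral_sphere_orthogonal_transformation[OF R, where h="\<lambda>y. (\<Sum>\<mu>=1..N l. a \<mu> * Y l \<mu> y)\<^sup>2"])
       (intro continuous_intros continuous_on_Y)
  also have "\<dots> = s" unfolding s by (rule integral_sum_Y_squared)
  finally have bs: "(\<Sum>\<mu>=1..N l. (b \<mu>)\<^sup>2) = s" .
  have "s = Z x" unfolding s ZY[OF x] by (simp add: a_def power2_eq_square)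
  also have "\<dots> = (\<Sum>\<mu>=1..N l. b \<mu> * Y l \<mu> x)" by (rule b[OF x])
  finally have "s\<^sup>2 = (\<Sum>\<mu>=1..N l. b \<mu> * Y l \<mu> x)\<^sup>2" by simp
  also have "\<dots> \<le> (\<Sum>\<mu>=1..N l. (b \<mu>)\<^sup>2) * (\<Sum>\<mu>=1..N l. (Y l \<mu> x)\<^sup>2)"
    by (rule Cauchy_Schwarz_ineq_sum)
  also have "\<dots> = s * K l x x" by (simp only: bs K_diag)
  finally have le: "s * s \<le> s * K l x x" by (simp add: power2_eq_square)
  have "0 \<le> s" "0 \<le> K l x x" unfolding s K_diag by (simp_all add: sum_nonneg)
  with le show ?thesis unfolding s_def[symmetric] by (cases "s = 0") auto
qed

definition kdiag :: "nat \<Rightarrow> real" where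
  "kdiag l = real (N l) / measure (sphere_measure :: 'a measure) (sphere 0 1)"

text \<open>Any two points of the sphere are exchanged by an orthogonal map, so
  \<open>K_diag_rotate_le\<close> gives inequalities both ways and the diagonal is constant.
  Integrating it and using orthonormality identifies the constant.\<close>

lemma K_diag_eq:
  assumes x: "x \<in> sphere 0 1"
  shows "K l x x = kdiag l"
proof -
  have le: "K l z z \<le> K l y y" if yz: "y \<in> sphere 0 1" "z \<in> sphere 0 1" for y z
  proof -
    obtain R where "orthogonal_transformation R" "R y = z"
      using exists_orthogonal_transformation[of y z] yz by auto
    then show ?thesis using K_diag_rotate_le[of R y l] yz by simp
  qed
  have "real (N l) = (\<Sum>\<mu>=1..N l. LINT y|sphere_measure. (Y l \<mu> y)\<^sup>2)"
    using sphere_inner_Y[of _ l _ l] by (simp add: sphere_inner_def power2_eq_square)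
  also have "\<dots> = (LINT y|sphere_measure. K l y y)"
    unfolding K_diag
    by (rule Bochner_Integration.integral_sum[symmetric]) (simp add: power2_eq_square integrable_Y_mult)
  also have "\<dots> = (LINT y|(sphere_measure :: 'a measure). K l x x)"
    by (rule Bochner_Integration.integral_cong) (use le x in \<open>auto intro!: antisym\<close>)
  also have "\<dots> = K l x x * measure (sphere_measure :: 'a measure) (sphere 0 1)"
    by simp
  finally have eq: "real (N l) = K l x x * measure (sphere_measure :: 'a measure) (sphere 0 1)" .
  show ?thesis
  proof (cases "measure (sphere_measure :: 'a measure) (sphere 0 1) = 0")
    \<comment> \<open>With zero total measure \<open>eq\<close> gives \<open>N l = 0\<close>: the
      left side is an empty sum, the right side is 0 / 0 = 0.\<close>
    case True
    with eq show ?thesis by (simp add: K_def kdiag_def)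
  next
    case False
    with eq show ?thesis by (simp add: kdiag_def)
  qed
qed

text \<open>2 |a b| <= a^2 + b^2 reduces the off-diagonal sum to two diagonal ones.\<close>

lemma sum_abs_Y_le:
  assumes "x \<in> sphere 0 1" "y \<in> sphere 0 1"
  shows "(\<Sum>\<mu>=1..N l. \<bar>Y l \<mu> x * Y l \<mu> y\<bar>) \<le> kdiag l"
proof -
  have "(\<Sum>\<mu>=1..N l. \<bar>Y l \<mu> x * Y l \<mu> y\<bar>) \<le> (\<Sum>\<mu>=1..N l. ((Y l \<mu> x)\<^sup>2 + (Y l \<mu> y)\<^sup>2) / 2)"
  proof (rule sum_mono)
    fix \<mu>
    show "\<bar>Y l \<mu> x * Y l \<mu> y\<bar> \<le> ((Y l \<mu> x)\<^sup>2 + (Y l \<mu> y)\<^sup>2) / 2"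
      using sum_squares_bound[of "\<bar>Y l \<mu> x\<bar>" "\<bar>Y l \<mu> y\<bar>"] by (simp add: abs_mult)
  qed
  also have "\<dots> = (K l x x + K l y y) / 2"
    by (simp add: K_diag sum.distrib sum_divide_distrib[symmetric])
  also have "\<dots> = kdiag l" using K_diag_eq assms by simp
  finally show ?thesis .
qed

lemma abs_K_le: "x \<in> sphere 0 1 \<Longrightarrow> y \<in> sphere 0 1 \<Longrightarrow> \<bar>K l x y\<bar> \<le> kdiag l"
  using order_trans[OF sum_abs sum_abs_Y_le] unfolding K_def .

lemma kdiag_nonneg: "0 \<le> kdiag l"
  by (simp add: kdiag_def)

text \<open>Each grid point imposes two linear conditions. With more than twice as many harmonics as
  grid points, a nontrivial combination satisfies all of them, so it vanishes identically,
  contradicting orthonormality.\<close>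

lemma N_le: "N l \<le> 2 * (l + 1) ^ (DIM('a) - 2)"
proof (rule ccontr)
  assume neg: "\<not> ?thesis"
  have "\<exists>e e' :: 'a. e \<in> Basis \<and> e' \<in> Basis \<and> e \<noteq> e'"
    using dim by (metis One_nat_def card_le_Suc0_iff_eq finite_Basis not_less_eq_eq numeral_3_eq_3 Suc_le_lessD Suc_leD)
  then obtain e e' :: 'a where e: "e \<in> Basis" "e' \<in> Basis" "e \<noteq> e'" by blast
  let ?G = "harmonic_grid e e' l"
  \<comment> \<open>The Boolean component tells a value condition from a normal-derivative
    condition.\<close>
  let ?F = "?G \<times> (UNIV :: bool set)"
  define A where "A \<mu> f = (if snd f then P l \<mu> (fst f) else dir_deriv e (P l \<mu>) (fst f))" for \<mu> f
  have "card ?F < card {1..N l}"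
    using neg card_harmonic_grid(2)[OF e, of l] by (simp add: card_cartesian_product mult.commute)
  with exists_nontrivial_solution[of ?F "{1..N l}" A] card_harmonic_grid(1)[OF e]
  obtain b where b: "\<exists>\<mu>\<in>{1..N l}. b \<mu> \<noteq> 0" "\<forall>f\<in>?F. (\<Sum>\<mu>=1..N l. b \<mu> * A \<mu> f) = 0"
    by auto
  define Q where "Q x = (\<Sum>\<mu>=1..N l. b \<mu> * P l \<mu> x)" for x
  have Q: "harmonic_poly l Q"
    unfolding Q_def by (rule harmonic_poly_sum) (simp, rule P(1))
  note rQ = harmonic_polyD(1)[OF Q] and hQ = harmonic_polyD(2)[OF Q]
  note rP = harmonic_polyD(1)[OF P(1)]
  have QG: "Q w = 0" if "w \<in> ?G" for w
    using bspec[OF b(2), of "(w, True)"] that by (simp add: A_def Q_def)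
  have dQG: "dir_deriv e Q w = 0" if "w \<in> ?G" for w
  proof -
    have "dir_deriv e Q w = (\<Sum>\<mu>=1..N l. b \<mu> * dir_deriv e (P l \<mu>) w)"
    proof -
      have "dir_deriv e (\<lambda>x. \<Sum>\<mu>=1..N l. b \<mu> * P l \<mu> x) w = (\<Sum>\<mu>=1..N l. dir_deriv e (\<lambda>x. b \<mu> * P l \<mu> x) w)"
        by (rule dir_deriv_sum) (intro real_polynomial_function.intros rP)
      also have "\<dots> = (\<Sum>\<mu>=1..N l. b \<mu> * dir_deriv e (P l \<mu>) w)"
        by (intro sum.cong refl dir_deriv_cmult rP)
      finally show ?thesis unfolding Q_def .
    qed
    then show ?thesis using bspec[OF b(2), of "(w, False)"] that by (simp add: A_def)
  qed
  have "Q x = 0" for x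
  proof (rule homogeneous_harmonic_zero[OF rQ hQ harmonic_polyD(3)[OF Q] e(1)])
    show "Q x = 0" if "x \<bullet> e = 0" for x
      by (rule homogeneous_zero_of_grid[OF rQ hQ order_refl e QG that])
    show "dir_deriv e Q x = 0" if "x \<bullet> e = 0" for x
      by (rule homogeneous_zero_of_grid[OF real_polynomial_function_dir_deriv[OF rQ]
            homogeneous_dir_deriv[OF rQ hQ] diff_le_self e dQG that])
  qed
  then have "(\<Sum>\<mu>=1..N l. b \<mu> * Y l \<mu> x) = 0" if "x \<in> sphere 0 1" for x
    using P(2)[OF _ that] by (simp add: Q_def)
  then have "(LINT x|sphere_measure. (\<Sum>\<mu>=1..N l. b \<mu> * Y l \<mu> x)\<^sup>2) = (LINT x|(sphere_measure :: 'a measure). 0)"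
    by (intro Bochner_Integration.integral_cong) auto
  then have "(\<Sum>\<mu>=1..N l. (b \<mu>)\<^sup>2) = 0" unfolding integral_sum_Y_squared by simp
  then show False using b(1) by (simp add: sum_nonneg_eq_0_iff)
qed

text \<open>Degree 0 is excluded because there the right-hand side is 0 for every \<open>C\<close>,
  the exponent being at least 1.\<close>

lemma kdiag_le: "\<exists>C. \<forall>l\<ge>1. kdiag l \<le> C * real l ^ (DIM('a) - 2)"
proof -
  let ?A = "measure (sphere_measure :: 'a measure) (sphere 0 1)" and ?n = "DIM('a) - 2"
  have "kdiag l \<le> (2 * 2 ^ ?n / ?A) * real l ^ ?n" if "l \<ge> 1" for l
  proof -
    have "real (N l) \<le> real (2 * (l + 1) ^ ?n)" using N_le of_nat_le_iff by blast
    also have "\<dots> = 2 * (real l + 1) ^ ?n" by (simp add: add.commute)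
    also have "\<dots> \<le> 2 * (2 * real l) ^ ?n"
      using that by (intro mult_left_mono power_mono) auto
    finally have "real (N l) \<le> 2 * 2 ^ ?n * real l ^ ?n" by (simp add: power_mult_distrib)
    then show ?thesis unfolding kdiag_def by (simp add: divide_right_mono)
  qed
  then show ?thesis by blast
qed

end

section \<open>Zonal series\<close>

context harmonic_bases
begin

lemma sphere_nonempty: "\<exists>x::'a. x \<in> sphere 0 1"
  by (intro exI[of _ "SOME i. i \<in> Basis"]) (simp add: SOME_Basis)

lemma abs_Y_le:
  assumes "\<mu> \<in> {1..N l}" "x \<in> sphere 0 1"
  shows "\<bar>Y l \<mu> x\<bar> \<le> sqrt (kdiag l)"
proof -
  have "(Y l \<mu> x)\<^sup>2 \<le> K l x x"
    unfolding K_diag by (rule member_le_sum[OF assms(1)]) auto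
  then show ?thesis using K_diag_eq[OF assms(2)] by (simp add: real_le_rsqrt)
qed

lemma sphere_inner_span:
  assumes \<kappa>: "\<kappa> \<in> {1..N k}"
  shows "sphere_inner (\<lambda>x. \<Sum>l\<le>M. \<Sum>\<mu>=1..N l. b l \<mu> * Y l \<mu> x) (Y k \<kappa>) = (if k \<le> M then b k \<kappa> else 0)"
    and "integrable sphere_measure (\<lambda>x. (\<Sum>l\<le>M. \<Sum>\<mu>=1..N l. b l \<mu> * Y l \<mu> x) * Y k \<kappa> x)"
proof -
  have int: "integrable sphere_measure (\<lambda>x. b l \<mu> * (Y l \<mu> x * Y k \<kappa> x))" if "\<mu> \<in> {1..N l}" for l \<mu>
    using integrable_Y_mult[OF that \<kappa>] by (rule integrable_mult_right)
  have eq: "(\<Sum>l\<le>M. \<Sum>\<mu>=1..N l. b l \<mu> * Y l \<mu> x) * Y k \<kappa> x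
      = (\<Sum>l\<le>M. \<Sum>\<mu>=1..N l. b l \<mu> * (Y l \<mu> x * Y k \<kappa> x))" for x
    by (simp add: sum_distrib_right mult.assoc)
  show "integrable sphere_measure (\<lambda>x. (\<Sum>l\<le>M. \<Sum>\<mu>=1..N l. b l \<mu> * Y l \<mu> x) * Y k \<kappa> x)"
    unfolding eq by (intro Bochner_Integration.integrable_sum int)
  have "sphere_inner (\<lambda>x. \<Sum>l\<le>M. \<Sum>\<mu>=1..N l. b l \<mu> * Y l \<mu> x) (Y k \<kappa>)
      = (\<Sum>l\<le>M. LINT x|sphere_measure. (\<Sum>\<mu>=1..N l. b l \<mu> * (Y l \<mu> x * Y k \<kappa> x)))"
    unfolding sphere_inner_def eq
    by (intro Bochner_Integration.integral_sum Bochner_Integration.integrable_sum int)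
  also have "\<dots> = (\<Sum>l\<le>M. \<Sum>\<mu>=1..N l. LINT x|sphere_measure. b l \<mu> * (Y l \<mu> x * Y k \<kappa> x))"
    by (intro sum.cong refl Bochner_Integration.integral_sum int)
  also have "\<dots> = (\<Sum>l\<le>M. \<Sum>\<mu>=1..N l. if l = k \<and> \<mu> = \<kappa> then b l \<mu> else 0)"
    by (intro sum.cong refl) (use sphere_inner_Y[OF _ \<kappa>] in \<open>simp add: sphere_inner_def\<close>)
  also have "\<dots> = (\<Sum>l\<le>M. if l = k then b k \<kappa> else 0)"
  proof (intro sum.cong refl)
    fix l
    show "(\<Sum>\<mu>=1..N l. if l = k \<and> \<mu> = \<kappa> then b l \<mu> else 0) = (if l = k then b k \<kappa> else 0)"
      using \<kappa> by (cases "l = k") simp_all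
  qed
  also have "\<dots> = (if k \<le> M then b k \<kappa> else 0)" by simp
  finally show "sphere_inner (\<lambda>x. \<Sum>l\<le>M. \<Sum>\<mu>=1..N l. b l \<mu> * Y l \<mu> x) (Y k \<kappa>) = (if k \<le> M then b k \<kappa> else 0)" .
qed

lemma span_zero_coeff:
  assumes "\<And>x. x \<in> sphere 0 1 \<Longrightarrow> (\<Sum>l\<le>M. \<Sum>\<mu>=1..N l. b l \<mu> * Y l \<mu> x) = 0"
    and "k \<le> M" "\<kappa> \<in> {1..N k}"
  shows "b k \<kappa> = 0"
proof -
  have "b k \<kappa> = sphere_inner (\<lambda>x. \<Sum>l\<le>M. \<Sum>\<mu>=1..N l. b l \<mu> * Y l \<mu> x) (Y k \<kappa>)"
    using sphere_inner_span(1)[OF assms(3)] assms(2) by simp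
  also have "\<dots> = sphere_inner (\<lambda>x. 0) (Y k \<kappa>)"
    by (rule sphere_inner_cong) (use assms(1) in auto)
  also have "\<dots> = 0" by (simp add: sphere_inner_def)
  finally show ?thesis .
qed

text \<open>A common form for \<Phi>, with coefficients \<open>c\<close>, and for the operator
  applied to \<Phi>, with coefficients \<open>c l * lam l\<close>; the lemmas on general
  \<open>e\<close> serve both.\<close>

definition kern :: "(nat \<Rightarrow> real) \<Rightarrow> 'a \<Rightarrow> 'a \<Rightarrow> real" where
  "kern e x y = (\<Sum>k. e k * K k x y)"

lemma kern_summable:
  assumes e: "summable (\<lambda>k. \<bar>e k\<bar> * kdiag k)" and "x \<in> sphere 0 1" "y \<in> sphere 0 1"
  shows "summable (\<lambda>k. norm (e k * K k x y))"
  by (rule summable_comparison_test[OF _ e])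
     (auto simp: abs_mult intro!: mult_left_mono abs_K_le assms(2-))

lemma kern_sums:
  assumes "summable (\<lambda>k. \<bar>e k\<bar> * kdiag k)" "x \<in> sphere 0 1" "y \<in> sphere 0 1"
  shows "(\<lambda>k. e k * K k x y) sums kern e x y"
  unfolding kern_def by (rule summable_sums[OF summable_norm_cancel[OF kern_summable[OF assms]]])

lemma sum_sum_K:
  "(\<Sum>x\<in>Z. \<Sum>y\<in>Z. \<beta> x * \<gamma> y * K k x y) = (\<Sum>\<mu>=1..N k. (\<Sum>x\<in>Z. \<beta> x * Y k \<mu> x) * (\<Sum>y\<in>Z. \<gamma> y * Y k \<mu> y))"
proof -
  have "(\<Sum>x\<in>Z. \<Sum>y\<in>Z. \<beta> x * \<gamma> y * K k x y) = (\<Sum>x\<in>Z. \<Sum>y\<in>Z. \<Sum>\<mu>=1..N k. (\<beta> x * Y k \<mu> x) * (\<gamma> y * Y k \<mu> y))"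
    by (simp add: K_def sum_distrib_left mult_ac)
  also have "\<dots> = (\<Sum>x\<in>Z. \<Sum>\<mu>=1..N k. \<Sum>y\<in>Z. (\<beta> x * Y k \<mu> x) * (\<gamma> y * Y k \<mu> y))"
    by (intro sum.cong refl sum.swap)
  also have "\<dots> = (\<Sum>\<mu>=1..N k. \<Sum>x\<in>Z. \<Sum>y\<in>Z. (\<beta> x * Y k \<mu> x) * (\<gamma> y * Y k \<mu> y))"
    by (rule sum.swap)
  finally show ?thesis by (simp add: sum_product)
qed

text \<open>The quadratic form splits by degree into sums of squares, so its sign is governed by the
  signs of the \<open>e k\<close>.\<close>

lemma kern_quadratic_sums:
  assumes e: "summable (\<lambda>k. \<bar>e k\<bar> * kdiag k)" and Z: "finite Z" "Z \<subseteq> sphere 0 1"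
  shows "(\<lambda>k. e k * (\<Sum>\<mu>=1..N k. (\<Sum>x\<in>Z. \<beta> x * Y k \<mu> x)\<^sup>2)) sums (\<Sum>x\<in>Z. \<Sum>y\<in>Z. \<beta> x * \<beta> y * kern e x y)"
proof -
  have "(\<lambda>k. \<Sum>x\<in>Z. \<Sum>y\<in>Z. \<beta> x * \<beta> y * (e k * K k x y)) sums (\<Sum>x\<in>Z. \<Sum>y\<in>Z. \<beta> x * \<beta> y * kern e x y)"
    by (intro sums_sum sums_mult kern_sums e) (use Z in auto)
  also have "(\<lambda>k. \<Sum>x\<in>Z. \<Sum>y\<in>Z. \<beta> x * \<beta> y * (e k * K k x y)) = (\<lambda>k. e k * (\<Sum>x\<in>Z. \<Sum>y\<in>Z. \<beta> x * \<beta> y * K k x y))"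
    by (simp add: sum_distrib_left mult_ac)
  finally show ?thesis by (simp only: sum_sum_K power2_eq_square)
qed

text \<open>Termwise integration, legitimate because the k-th term is at most
  \<open>\<bar>e k\<bar> * kdiag k * sqrt (kdiag l)\<close> on the sphere of finite measure;
  orthonormality leaves only the term k = l.\<close>

lemma sphere_inner_kern:
  assumes e: "summable (\<lambda>k. \<bar>e k\<bar> * kdiag k)" and y: "y \<in> sphere 0 1" and \<mu>: "\<mu> \<in> {1..N l}"
  shows "sphere_inner (\<lambda>x. kern e x y) (Y l \<mu>) = e l * Y l \<mu> y"
    and "integrable sphere_measure (\<lambda>x. kern e x y * Y l \<mu> x)"
proof -
  let ?f = "\<lambda>k x. e k * K k x y * Y l \<mu> x"
  let ?B = "sqrt (kdiag l)" and ?A = "measure (sphere_measure :: 'a measure) (sphere 0 1)"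
  have int: "integrable sphere_measure (?f k)" for k
    unfolding K_def by (intro integrable_sphere_continuous continuous_intros continuous_on_Y \<mu>)
  have bd: "norm (?f k x) \<le> \<bar>e k\<bar> * kdiag k * ?B" if "x \<in> sphere 0 1" for k x
    unfolding real_norm_def abs_mult
    by (intro mult_mono mult_left_mono abs_K_le abs_Y_le y that \<mu>) (auto simp: kdiag_nonneg)
  have summ: "summable (\<lambda>k. \<bar>e k\<bar> * kdiag k * ?B)" using e by (rule summable_mult2)
  have sx: "summable (\<lambda>k. norm (?f k x))" if "x \<in> sphere 0 1" for x
    by (rule summable_comparison_test[OF _ summ]) (use bd[OF that] in auto)
  have si: "summable (\<lambda>k. LINT x|sphere_measure. norm (?f k x))"
  proof (rule summable_comparison_test[OF _ summable_mult2[OF summ, of ?A]], intro exI[of _ 0] allI impI)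
    fix k
    have "(LINT x|sphere_measure. norm (?f k x)) \<le> (LINT x|(sphere_measure :: 'a measure). \<bar>e k\<bar> * kdiag k * ?B)"
      by (intro integral_mono integrable_norm int) (use bd in auto)
    then show "norm (LINT x|sphere_measure. norm (?f k x)) \<le> \<bar>e k\<bar> * kdiag k * ?B * ?A"
      by (simp add: mult_ac)
  qed
  have AE: "AE x in sphere_measure. summable (\<lambda>k. norm (?f k x))"
    using sx by (intro AE_I2) simp
  have eq: "(\<Sum>k. ?f k x) = kern e x y * Y l \<mu> x" if "x \<in> sphere 0 1" for x
    using sums_mult2[OF kern_sums[OF e that y], of "Y l \<mu> x"] by (rule sums_unique[symmetric])
  have "integrable sphere_measure (\<lambda>x. \<Sum>k. ?f k x)"
    by (rule integrable_suminf[OF int AE si])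
  then show "integrable sphere_measure (\<lambda>x. kern e x y * Y l \<mu> x)"
    by (rule Bochner_Integration.integrable_cong[THEN iffD1, rotated -1]) (use eq in auto)
  have "(\<lambda>k. LINT x|sphere_measure. ?f k x) sums (LINT x|sphere_measure. (\<Sum>k. ?f k x))"
    by (rule sums_integral[OF int AE si])
  also have "(LINT x|sphere_measure. (\<Sum>k. ?f k x)) = sphere_inner (\<lambda>x. kern e x y) (Y l \<mu>)"
    unfolding sphere_inner_def by (rule Bochner_Integration.integral_cong) (use eq in auto)
  finally have s1: "(\<lambda>k. LINT x|sphere_measure. ?f k x) sums sphere_inner (\<lambda>x. kern e x y) (Y l \<mu>)" .
  have "(LINT x|sphere_measure. ?f k x) = (if k = l then e l * Y l \<mu> y else 0)" for k
  proof -
    have "(LINT x|sphere_measure. ?f k x) = (LINT x|sphere_measure. (\<Sum>\<kappa>=1..N k. e k * Y k \<kappa> y * (Y k \<kappa> x * Y l \<mu> x)))"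
      by (simp add: K_def sum_distrib_left sum_distrib_right mult_ac)
    also have "\<dots> = (\<Sum>\<kappa>=1..N k. LINT x|sphere_measure. e k * Y k \<kappa> y * (Y k \<kappa> x * Y l \<mu> x))"
      by (intro Bochner_Integration.integral_sum integrable_mult_right integrable_Y_mult \<mu>)
    also have "\<dots> = (\<Sum>\<kappa>=1..N k. if k = l \<and> \<kappa> = \<mu> then e k * Y k \<kappa> y else 0)"
      by (intro sum.cong refl) (use sphere_inner_Y[OF _ \<mu>] in \<open>simp add: sphere_inner_def\<close>)
    also have "\<dots> = (if k = l then e l * Y l \<mu> y else 0)" using \<mu> by (cases "k = l") simp_all
    finally show ?thesis .
  qed
  then have "(\<lambda>k. LINT x|sphere_measure. ?f k x) sums (e l * Y l \<mu> y)"
    using sums_single[of l "\<lambda>_. e l * Y l \<mu> y"] by simp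
  with s1 show "sphere_inner (\<lambda>x. kern e x y) (Y l \<mu>) = e l * Y l \<mu> y" by (rule sums_unique2)
qed

section \<open>Nonnegativity of the expansion coefficients\<close>

text \<open>Unisolvence keeps the harmonics up to degree \<open>M\<close> linearly independent on
  \<open>X\<close>, so \<open>Y k \<mu>\<close> is not in the span \<open>?U\<close> of the others
  there. A functional separating it from \<open>?U\<close>, normalised, is the dual weight
  \<open>g\<close>.\<close>

lemma harmonic_dual_functional:
  assumes X: "finite X" "X \<subseteq> sphere 0 1" "unisolvent (harmonic_span Y N M) X"
    and k: "k \<le> M" "\<mu> \<in> {1..N k}"
  shows "\<exists>g. \<forall>j\<le>M. \<forall>\<nu>\<in>{1..N j}. (\<Sum>x\<in>X. g x * Y j \<nu> x) = (if j = k \<and> \<nu> = \<mu> then 1 else 0)"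
proof -
  let ?q = "\<lambda>b x. \<Sum>l\<le>M. \<Sum>\<mu>=1..N l. b l \<mu> * Y l \<mu> x"
  let ?U = "{?q b | b. b k \<mu> = 0}"
  define \<delta> where "\<delta> j \<nu> = (\<lambda>j' \<nu>'. if j' = j \<and> \<nu>' = \<nu> then 1 else 0 :: real)" for j \<nu> :: nat
  have q\<delta>: "?q (\<delta> j \<nu>) = Y j \<nu>" if "j \<le> M" "\<nu> \<in> {1..N j}" for j \<nu>
  proof
    fix x
    have "?q (\<delta> j \<nu>) x = (\<Sum>l\<le>M. if l = j then Y j \<nu> x else 0)"
    proof (intro sum.cong refl)
      fix l
      have "(\<Sum>\<mu>=1..N l. \<delta> j \<nu> l \<mu> * Y l \<mu> x) = (\<Sum>\<mu>=1..N l. if l = j \<and> \<mu> = \<nu> then Y l \<mu> x else 0)"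
        by (intro sum.cong refl) (simp add: \<delta>_def)
      also have "\<dots> = (if l = j then Y j \<nu> x else 0)" using that by (cases "l = j") simp_all
      finally show "(\<Sum>\<mu>=1..N l. \<delta> j \<nu> l \<mu> * Y l \<mu> x) = (if l = j then Y j \<nu> x else 0)" .
    qed
    then show "?q (\<delta> j \<nu>) x = Y j \<nu> x" using that by simp
  qed
  have "\<exists>w. (\<forall>u\<in>?U. (\<Sum>x\<in>X. w x * u x) = 0) \<and> (\<Sum>x\<in>X. w x * Y k \<mu> x) \<noteq> 0"
  proof (rule exists_separating_functional[OF X(1)])
    show "(\<lambda>x. 0) \<in> ?U" by (auto intro!: exI[of _ "\<lambda>_ _. 0"])
  next
    fix f g assume "f \<in> ?U" "g \<in> ?U"
    then obtain b b' where "f = ?q b" "g = ?q b'" "b k \<mu> = 0" "b' k \<mu> = 0" by blast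
    then show "(\<lambda>x. f x + g x) \<in> ?U"
      by (auto intro!: exI[of _ "\<lambda>l \<mu>. b l \<mu> + b' l \<mu>"] simp: distrib_right sum.distrib)
  next
    fix a f assume "f \<in> ?U"
    then obtain b where "f = ?q b" "b k \<mu> = 0" by blast
    then show "(\<lambda>x. a * f x) \<in> ?U"
      by (auto intro!: exI[of _ "\<lambda>l \<mu>. a * b l \<mu>"] simp: sum_distrib_left mult.assoc)
  next
    fix u assume "u \<in> ?U"
    then obtain b where b: "u = ?q b" "b k \<mu> = 0" by blast
    show "\<exists>x\<in>X. u x \<noteq> Y k \<mu> x"
    proof (rule ccontr)
      assume neg: "\<not> ?thesis"
      \<comment> \<open>This combination vanishes on \<open>X\<close>, hence on the sphere, although
        its coefficient at (k, \<mu>) is 0 - 1.\<close>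
      have diff: "?q (\<lambda>l \<nu>. b l \<nu> - \<delta> k \<mu> l \<nu>) x = u x - Y k \<mu> x" for x
        using fun_cong[OF q\<delta>[OF k], of x] by (simp add: b(1) left_diff_distrib sum_subtractf)
      have z: "\<forall>x\<in>X. ?q (\<lambda>l \<nu>. b l \<nu> - \<delta> k \<mu> l \<nu>) x = 0" using neg unfolding diff by simp
      have mem: "?q (\<lambda>l \<nu>. b l \<nu> - \<delta> k \<mu> l \<nu>) \<in> harmonic_span Y N M"
        unfolding harmonic_span_def by (intro CollectI exI[of _ "\<lambda>l \<nu>. b l \<nu> - \<delta> k \<mu> l \<nu>"] conjI refl TrueI)
      have "?q (\<lambda>l \<nu>. b l \<nu> - \<delta> k \<mu> l \<nu>) x = 0" if "x \<in> sphere 0 1" for x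
        by (rule X(3)[unfolded unisolvent_def, THEN bspec, OF mem, THEN mp, OF z, THEN bspec, OF that])
      then have "b k \<mu> - \<delta> k \<mu> k \<mu> = 0"
        by (rule span_zero_coeff[OF _ k, where b="\<lambda>l \<nu>. b l \<nu> - \<delta> k \<mu> l \<nu>"])
      with b(2) show False by (simp add: \<delta>_def)
    qed
  qed
  then obtain w where w: "\<forall>u\<in>?U. (\<Sum>x\<in>X. w x * u x) = 0" "(\<Sum>x\<in>X. w x * Y k \<mu> x) \<noteq> 0"
    by (elim exE conjE)
  define W where "W = (\<Sum>x\<in>X. w x * Y k \<mu> x)"
  have "(\<Sum>x\<in>X. (w x / W) * Y j \<nu> x) = (if j = k \<and> \<nu> = \<mu> then 1 else 0)" if j: "j \<le> M" "\<nu> \<in> {1..N j}" for j \<nu>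
  proof -
    have "(\<Sum>x\<in>X. (w x / W) * Y j \<nu> x) = (\<Sum>x\<in>X. w x * Y j \<nu> x) / W" by (simp add: sum_divide_distrib)
    also have "\<dots> = (if j = k \<and> \<nu> = \<mu> then 1 else 0)"
    proof (cases "j = k \<and> \<nu> = \<mu>")
      case True
      then show ?thesis using w(2) by (auto simp: W_def)
    next
      case False
      then have "\<delta> j \<nu> k \<mu> = 0" by (auto simp: \<delta>_def)
      then have "Y j \<nu> \<in> ?U" using q\<delta>[OF j] by (intro CollectI exI[of _ "\<delta> j \<nu>"]) auto
      from bspec[OF w(1) this] show ?thesis using False by simp
    qed
    finally show ?thesis .
  qed
  then show ?thesis by (intro exI[of _ "\<lambda>x. w x / W"] allI impI ballI)
qed

text \<open>The signed measure \<open>Y l0 \<mu>0\<close> times surface measure is a weak limit of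
  finitely supported ones. Simple functions \<open>s i\<close> tend to the identity; the weight of a
  value \<open>z\<close> is the integral of the harmonic over the fibre where \<open>s i\<close>
  equals \<open>z\<close>. The total variation stays below \<open>H\<close>, the integral of its
  absolute value.\<close>

lemma exists_discrete_approximation:
  assumes \<mu>0: "\<mu>0 \<in> {1..N l0}"
  obtains R :: "nat \<Rightarrow> 'a set" and w :: "nat \<Rightarrow> 'a \<Rightarrow> real" and H :: real where
    "\<And>n. finite (R n)" "\<And>n. R n \<subseteq> sphere 0 1" "\<And>n. (\<Sum>z\<in>R n. \<bar>w n z\<bar>) \<le> H"
    "\<And>k \<mu>. \<mu> \<in> {1..N k} \<Longrightarrow> (\<lambda>n. \<Sum>z\<in>R n. w n z * Y k \<mu> z) \<longlonglongrightarrow> (if k = l0 \<and> \<mu> = \<mu>0 then 1 else 0)"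
proof -
  let ?M = "sphere_measure :: 'a measure" and ?S = "sphere (0::'a) 1"
  let ?h = "Y l0 \<mu>0"
  obtain e :: 'a where e: "e \<in> ?S" using sphere_nonempty by blast
  have "(\<lambda>x::'a. x) \<in> borel_measurable ?M" by (intro borel_measurable_sphere_continuous continuous_on_id)
  from borel_measurable_implies_sequence_metric[OF this, of 0]
  obtain F where F: "\<And>i. simple_function ?M (F i)" "\<And>x. x \<in> space ?M \<Longrightarrow> (\<lambda>i. F i x) \<longlonglongrightarrow> x" by blast
  \<comment> \<open>Values of the simple function \<open>F i\<close> may lie off the sphere, so they
    are projected by \<open>sgn\<close>; the arbitrary sphere point \<open>e\<close> replaces the
    value 0.\<close>
  define s where "s i x = (if F i x = 0 then e else sgn (F i x))" for i x
  have simple: "simple_function ?M (s i)" for i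
    unfolding s_def by (rule simple_function_compose1[OF F(1), of "\<lambda>z. if z = 0 then e else sgn z"])
  have sS: "s i x \<in> ?S" for i x using e by (simp add: s_def norm_sgn)
  have lim: "(\<lambda>i. s i x) \<longlonglongrightarrow> x" if x: "x \<in> ?S" for x
  proof -
    have x0: "x \<noteq> 0" and sx: "sgn x = x" using x by (auto simp: sgn_div_norm)
    have Fx: "(\<lambda>i. F i x) \<longlonglongrightarrow> x" using F(2) x by simp
    have "(\<lambda>i. sgn (F i x)) \<longlonglongrightarrow> x" using tendsto_sgn[OF Fx x0] by (simp add: sx)
    moreover have "\<forall>\<^sub>F i in sequentially. sgn (F i x) = s i x"
      using tendsto_imp_eventually_ne[OF Fx x0] by eventually_elim (simp add: s_def)
    ultimately show ?thesis by (rule Lim_transform_eventually)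
  qed
  define R where "R i = s i ` ?S" for i
  have finR: "finite (R i)" for i using simple[of i] by (simp add: R_def simple_function_def)
  have RS: "R i \<subseteq> ?S" for i using sS by (auto simp: R_def)
  have h_int: "integrable ?M ?h" by (intro integrable_sphere_continuous continuous_on_Y \<mu>0)
  have ind_int: "integrable ?M (\<lambda>x. indicator (s i -` {z} \<inter> ?S) x * f x)" if "integrable ?M f" for i z and f :: "'a \<Rightarrow> real"
    using integrable_mult_indicator[OF _ that, of "s i -` {z} \<inter> ?S"] simple_functionD(2)[OF simple, of i "{z}"]
    by simp
  define w where "w i z = (LINT x|?M. indicator (s i -` {z} \<inter> ?S) x * ?h x)" for i z
  have single: "(\<Sum>z\<in>R i. indicator (s i -` {z} \<inter> ?S) x * a z) = a (s i x)" if "x \<in> ?S" for i x and a :: "'a \<Rightarrow> real"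
  proof -
    have "(\<Sum>z\<in>R i. indicator (s i -` {z} \<inter> ?S) x * a z) = (\<Sum>z\<in>R i. if s i x = z then a z else 0)"
      using that by (intro sum.cong refl) (auto simp: indicator_def)
    then show ?thesis using that finR by (simp add: R_def)
  qed
  \<comment> \<open>A weighted sum over the nodes is the integral of \<open>g\<close> composed with
    the simple function, so convergence becomes a statement about integrals.\<close>
  have wsum: "(\<Sum>z\<in>R i. w i z * g z) = (LINT x|?M. g (s i x) * ?h x)" for i and g :: "'a \<Rightarrow> real"
  proof -
    have "(\<Sum>z\<in>R i. w i z * g z) = (\<Sum>z\<in>R i. LINT x|?M. (indicator (s i -` {z} \<inter> ?S) x * ?h x) * g z)"
      by (simp add: w_def)
    also have "\<dots> = (LINT x|?M. (\<Sum>z\<in>R i. (indicator (s i -` {z} \<inter> ?S) x * ?h x) * g z))"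
      by (intro Bochner_Integration.integral_sum[symmetric] integrable_mult_left ind_int h_int)
    also have "\<dots> = (LINT x|?M. g (s i x) * ?h x)"
    proof (rule Bochner_Integration.integral_cong)
      fix x assume "x \<in> space ?M"
      then have x: "x \<in> ?S" by simp
      have "(\<Sum>z\<in>R i. (indicator (s i -` {z} \<inter> ?S) x * ?h x) * g z)
          = (\<Sum>z\<in>R i. indicator (s i -` {z} \<inter> ?S) x * (?h x * g z))" by (simp add: mult.assoc)
      also have "\<dots> = ?h x * g (s i x)" by (rule single[OF x])
      finally show "(\<Sum>z\<in>R i. (indicator (s i -` {z} \<inter> ?S) x * ?h x) * g z) = g (s i x) * ?h x" by simp
    qed simp
    finally show ?thesis .
  qed
  define H where "H = (LINT x|?M. \<bar>?h x\<bar>)"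
  have wH: "(\<Sum>z\<in>R i. \<bar>w i z\<bar>) \<le> H" for i
  proof -
    have h_abs: "integrable ?M (\<lambda>x. \<bar>?h x\<bar>)" using h_int by simp
    have "(\<Sum>z\<in>R i. \<bar>w i z\<bar>) \<le> (\<Sum>z\<in>R i. LINT x|?M. indicator (s i -` {z} \<inter> ?S) x * \<bar>?h x\<bar>)"
    proof (rule sum_mono)
      fix z
      have "\<bar>w i z\<bar> \<le> (LINT x|?M. \<bar>indicator (s i -` {z} \<inter> ?S) x * ?h x\<bar>)"
        unfolding w_def by (rule integral_abs_bound)
      then show "\<bar>w i z\<bar> \<le> (LINT x|?M. indicator (s i -` {z} \<inter> ?S) x * \<bar>?h x\<bar>)"
        by (simp add: abs_mult)
    qed
    also have "\<dots> = (LINT x|?M. (\<Sum>z\<in>R i. indicator (s i -` {z} \<inter> ?S) x * \<bar>?h x\<bar>))"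
      by (intro Bochner_Integration.integral_sum[symmetric] ind_int h_abs)
    also have "\<dots> = H"
      unfolding H_def by (rule Bochner_Integration.integral_cong) (use single in auto)
    finally show ?thesis .
  qed
  have conv: "(\<lambda>i. \<Sum>z\<in>R i. w i z * Y k \<mu> z) \<longlonglongrightarrow> (if k = l0 \<and> \<mu> = \<mu>0 then 1 else 0)" if \<mu>: "\<mu> \<in> {1..N k}" for k \<mu>
  proof -
    have "(\<lambda>i. LINT x|?M. Y k \<mu> (s i x) * ?h x) \<longlonglongrightarrow> (LINT x|?M. Y k \<mu> x * ?h x)"
    proof (rule integral_dominated_convergence[where w="\<lambda>x. sqrt (kdiag k) * \<bar>?h x\<bar>"])
      show "(\<lambda>x. Y k \<mu> x * ?h x) \<in> borel_measurable ?M" using integrable_Y_mult[OF \<mu> \<mu>0] by auto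
      show "(\<lambda>x. Y k \<mu> (s i x) * ?h x) \<in> borel_measurable ?M" for i
        by (intro borel_measurable_times borel_measurable_integrable[OF h_int]
            borel_measurable_simple_function[OF simple_function_compose1[OF simple]])
      show "integrable ?M (\<lambda>x. sqrt (kdiag k) * \<bar>?h x\<bar>)" using h_int by simp
      show "AE x in ?M. (\<lambda>i. Y k \<mu> (s i x) * ?h x) \<longlonglongrightarrow> Y k \<mu> x * ?h x"
      proof (intro AE_I2 tendsto_intros)
        fix x assume "x \<in> space ?M"
        then have x: "x \<in> ?S" by simp
        show "(\<lambda>i. Y k \<mu> (s i x)) \<longlonglongrightarrow> Y k \<mu> x"
          using continuous_on_Y[OF \<mu>] lim[OF x] sS x by (auto simp: continuous_on_sequentially o_def)
      qed
      show "AE x in ?M. norm (Y k \<mu> (s i x) * ?h x) \<le> sqrt (kdiag k) * \<bar>?h x\<bar>" for i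
        by (intro AE_I2) (auto simp: abs_mult intro!: mult_right_mono abs_Y_le[OF \<mu> sS])
    qed
    then show ?thesis using sphere_inner_Y[OF \<mu> \<mu>0] by (simp add: wsum sphere_inner_def)
  qed
  show ?thesis by (rule that[of R w H, OF finR RS wH conv])
qed

text \<open>
  Discrete measures approximating \<open>Y l0 \<mu>0\<close> times the surface measure are corrected on \<open>X\<close> so that
  they annihilate the polynomial space; in the limit their energy tends to \<open>e l0\<close>.
\<close>

lemma conditionally_positive_definite_coeff_nonneg:
  assumes e: "summable (\<lambda>k. \<bar>e k\<bar> * kdiag k)"
    and \<Phi>: "\<And>x y. x \<in> sphere 0 1 \<Longrightarrow> y \<in> sphere 0 1 \<Longrightarrow> \<Phi> x y = kern e x y"
    and cpd: "conditionally_positive_definite (harmonic_span Y N M) \<Phi>"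
    and X: "finite X" "X \<subseteq> sphere 0 1" "unisolvent (harmonic_span Y N M) X"
    and l0: "M < l0" and \<mu>0: "\<mu>0 \<in> {1..N l0}"
  shows "0 \<le> e l0"
proof -
  obtain R w H where finR: "\<And>n. finite (R n)" and RS: "\<And>n. R n \<subseteq> sphere 0 1"
    and wH: "\<And>n. (\<Sum>z\<in>R n. \<bar>w n z\<bar>) \<le> H"
    and conv: "\<And>k \<mu>. \<mu> \<in> {1..N k} \<Longrightarrow>
      (\<lambda>n. \<Sum>z\<in>R n. w n z * Y k \<mu> z) \<longlonglongrightarrow> (if k = l0 \<and> \<mu> = \<mu>0 then 1 else 0)"
    by (rule exists_discrete_approximation[OF \<mu>0]) (rule that, assumption+)
  define A where "A n k \<mu> = (\<Sum>z\<in>R n. w n z * Y k \<mu> z)" for n k \<mu>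
  define g where "g k \<mu> = (SOME g. \<forall>j\<le>M. \<forall>\<nu>\<in>{1..N j}.
      (\<Sum>x\<in>X. g x * Y j \<nu> x) = (if j = k \<and> \<nu> = \<mu> then 1 else 0))" for k \<mu>
  have g: "(\<Sum>x\<in>X. g k \<mu> x * Y j \<nu> x) = (if j = k \<and> \<nu> = \<mu> then 1 else 0)"
    if "k \<le> M" "\<mu> \<in> {1..N k}" "j \<le> M" "\<nu> \<in> {1..N j}" for k \<mu> j \<nu>
    using someI_ex[OF harmonic_dual_functional[OF X that(1,2)]] that(3,4) unfolding g_def by simp
  define Z where "Z n = X \<union> R n" for n
  have Z: "finite (Z n)" "Z n \<subseteq> sphere 0 1" for n using X finR RS by (auto simp: Z_def)
  \<comment> \<open>The nodes \<open>R n\<close> and the set \<open>X\<close> may overlap, so both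
    weights are extended by 0 to the union \<open>Z n\<close> before they are subtracted.\<close>
  define a where "a n z = (if z \<in> R n then w n z else 0)" for n z
  \<comment> \<open>The correction on \<open>X\<close> reproduces the moments
    \<open>A n k \<mu>\<close> of degree at most \<open>M\<close>; these tend to 0 since
    \<open>M < l0\<close>, so it does not affect the limits.\<close>
  define b where "b n z = (if z \<in> X then \<Sum>k\<le>M. \<Sum>\<mu>=1..N k. A n k \<mu> * g k \<mu> z else 0)" for n z
  define \<beta> where "\<beta> n z = a n z - b n z" for n z
  have sum_a: "(\<Sum>z\<in>Z n. a n z * f z) = (\<Sum>z\<in>R n. w n z * f z)" for n f
    by (rule sum.mono_neutral_cong_right) (use Z in \<open>auto simp: Z_def a_def\<close>)
  have sum_b: "(\<Sum>z\<in>Z n. b n z * f z) = (\<Sum>k\<le>M. \<Sum>\<mu>=1..N k. A n k \<mu> * (\<Sum>x\<in>X. g k \<mu> x * f x))" for n f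
  proof -
    have "(\<Sum>z\<in>Z n. b n z * f z) = (\<Sum>z\<in>X. (\<Sum>k\<le>M. \<Sum>\<mu>=1..N k. A n k \<mu> * g k \<mu> z) * f z)"
      by (rule sum.mono_neutral_cong_right) (use Z in \<open>auto simp: Z_def b_def\<close>)
    also have "\<dots> = (\<Sum>z\<in>X. \<Sum>k\<le>M. \<Sum>\<mu>=1..N k. A n k \<mu> * (g k \<mu> z * f z))"
      by (simp add: sum_distrib_right mult.assoc)
    also have "\<dots> = (\<Sum>k\<le>M. \<Sum>z\<in>X. \<Sum>\<mu>=1..N k. A n k \<mu> * (g k \<mu> z * f z))"
      by (rule sum.swap)
    also have "\<dots> = (\<Sum>k\<le>M. \<Sum>\<mu>=1..N k. \<Sum>z\<in>X. A n k \<mu> * (g k \<mu> z * f z))"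
      by (intro sum.cong refl sum.swap)
    finally show ?thesis by (simp add: sum_distrib_left)
  qed
  define B where "B n j \<nu> = (\<Sum>z\<in>Z n. \<beta> n z * Y j \<nu> z)" for n j \<nu>
  have B: "B n j \<nu> = A n j \<nu> - (\<Sum>k\<le>M. \<Sum>\<mu>=1..N k. A n k \<mu> * (\<Sum>x\<in>X. g k \<mu> x * Y j \<nu> x))" for n j \<nu>
    unfolding B_def \<beta>_def left_diff_distrib sum_subtractf sum_a sum_b A_def ..
  have B0: "B n j \<nu> = 0" if j: "j \<le> M" "\<nu> \<in> {1..N j}" for n j \<nu>
  proof -
    have "(\<Sum>k\<le>M. \<Sum>\<mu>=1..N k. A n k \<mu> * (\<Sum>x\<in>X. g k \<mu> x * Y j \<nu> x))
        = (\<Sum>k\<le>M. \<Sum>\<mu>=1..N k. if k = j \<and> \<mu> = \<nu> then A n k \<mu> else 0)"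
    proof (intro sum.cong refl)
      fix k \<mu> assume "k \<in> {..M}" "\<mu> \<in> {1..N k}"
      then show "A n k \<mu> * (\<Sum>x\<in>X. g k \<mu> x * Y j \<nu> x) = (if k = j \<and> \<mu> = \<nu> then A n k \<mu> else 0)"
        using g[of k \<mu> j \<nu>] j by auto
    qed
    also have "\<dots> = (\<Sum>k\<le>M. if k = j then A n j \<nu> else 0)"
    proof (intro sum.cong refl)
      fix k
      show "(\<Sum>\<mu>=1..N k. if k = j \<and> \<mu> = \<nu> then A n k \<mu> else 0) = (if k = j then A n j \<nu> else 0)"
        using j by (cases "k = j") simp_all
    qed
    finally show ?thesis using j unfolding B by simp
  qed
  have Blim: "(\<lambda>n. B n j \<nu>) \<longlonglongrightarrow> (if j = l0 \<and> \<nu> = \<mu>0 then 1 else 0)" if \<nu>: "\<nu> \<in> {1..N j}" for j \<nu>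
  proof -
    have "(\<lambda>n. A n k \<mu>) \<longlonglongrightarrow> 0" if "k \<le> M" "\<mu> \<in> {1..N k}" for k \<mu>
      using conv[OF that(2)] that l0 by (simp add: A_def)
    then have "(\<lambda>n. A n j \<nu> - (\<Sum>k\<le>M. \<Sum>\<mu>=1..N k. A n k \<mu> * (\<Sum>x\<in>X. g k \<mu> x * Y j \<nu> x)))
        \<longlonglongrightarrow> (if j = l0 \<and> \<nu> = \<mu>0 then 1 else 0) - (\<Sum>k\<le>M. \<Sum>\<mu>=1..N k. 0 * (\<Sum>x\<in>X. g k \<mu> x * Y j \<nu> x))"
      by (intro tendsto_intros) (use conv[OF \<nu>] in \<open>auto simp: A_def\<close>)
    then show ?thesis unfolding B by simp
  qed
  have A_le: "\<bar>A n k \<mu>\<bar> \<le> H * sqrt (kdiag k)" if "\<mu> \<in> {1..N k}" for n k \<mu>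
  proof -
    have "\<bar>A n k \<mu>\<bar> \<le> (\<Sum>z\<in>R n. \<bar>w n z\<bar> * sqrt (kdiag k))"
      unfolding A_def by (rule order_trans[OF sum_abs])
        (use RS in \<open>auto simp: abs_mult intro!: sum_mono mult_left_mono abs_Y_le that\<close>)
    also have "\<dots> \<le> H * sqrt (kdiag k)"
      unfolding sum_distrib_right[symmetric] by (intro mult_right_mono wH) (simp add: kdiag_nonneg)
    finally show ?thesis .
  qed
  \<comment> \<open>A bound on the total weight independent of \<open>n\<close>; it yields the
    summable majorant for the exchange of limit and series.\<close>
  define W where "W = H + (\<Sum>z\<in>X. \<Sum>k\<le>M. \<Sum>\<mu>=1..N k. H * sqrt (kdiag k) * \<bar>g k \<mu> z\<bar>)"
  have \<beta>W: "(\<Sum>z\<in>Z n. \<bar>\<beta> n z\<bar>) \<le> W" for n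
  proof -
    have "(\<Sum>z\<in>Z n. \<bar>\<beta> n z\<bar>) \<le> (\<Sum>z\<in>Z n. \<bar>a n z\<bar>) + (\<Sum>z\<in>Z n. \<bar>b n z\<bar>)"
      unfolding \<beta>_def sum.distrib[symmetric] by (intro sum_mono abs_triangle_ineq4)
    also have "(\<Sum>z\<in>Z n. \<bar>a n z\<bar>) = (\<Sum>z\<in>R n. \<bar>w n z\<bar>)"
      by (rule sum.mono_neutral_cong_right) (use Z in \<open>auto simp: Z_def a_def\<close>)
    also have "(\<Sum>z\<in>Z n. \<bar>b n z\<bar>) = (\<Sum>z\<in>X. \<bar>\<Sum>k\<le>M. \<Sum>\<mu>=1..N k. A n k \<mu> * g k \<mu> z\<bar>)"
      by (rule sum.mono_neutral_cong_right) (use Z in \<open>auto simp: Z_def b_def\<close>)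
    also have "\<dots> \<le> (\<Sum>z\<in>X. \<Sum>k\<le>M. \<Sum>\<mu>=1..N k. H * sqrt (kdiag k) * \<bar>g k \<mu> z\<bar>)"
      by (intro sum_mono order_trans[OF sum_abs]) (auto simp: abs_mult intro!: mult_right_mono A_le)
    finally show ?thesis using wH[of n] by (simp add: W_def)
  qed
  let ?t = "\<lambda>k n. e k * (\<Sum>\<nu>=1..N k. (B n k \<nu>)\<^sup>2)"
  let ?L = "\<lambda>k. e k * (\<Sum>\<nu>=1..N k. (if k = l0 \<and> \<nu> = \<mu>0 then 1 else 0)\<^sup>2)"
  have energy: "(\<lambda>k. ?t k n) sums (\<Sum>x\<in>Z n. \<Sum>y\<in>Z n. \<beta> n x * \<beta> n y * kern e x y)" for n
    unfolding B_def by (rule kern_quadratic_sums[OF e Z])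
  have energy_nonneg: "0 \<le> (\<Sum>k. ?t k n)" for n
  proof -
    have "annihilates (harmonic_span Y N M) (Z n) (\<beta> n)"
      unfolding annihilates_def harmonic_span_def
    proof clarify
      fix c :: "nat \<Rightarrow> nat \<Rightarrow> real"
      have "(\<Sum>x\<in>Z n. \<beta> n x * (\<Sum>l\<le>M. \<Sum>\<mu>=1..N l. c l \<mu> * Y l \<mu> x))
          = (\<Sum>x\<in>Z n. \<Sum>l\<le>M. \<Sum>\<mu>=1..N l. c l \<mu> * (\<beta> n x * Y l \<mu> x))"
        by (simp add: sum_distrib_left mult_ac)
      also have "\<dots> = (\<Sum>l\<le>M. \<Sum>x\<in>Z n. \<Sum>\<mu>=1..N l. c l \<mu> * (\<beta> n x * Y l \<mu> x))"
        by (rule sum.swap)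
      also have "\<dots> = (\<Sum>l\<le>M. \<Sum>\<mu>=1..N l. \<Sum>x\<in>Z n. c l \<mu> * (\<beta> n x * Y l \<mu> x))"
        by (intro sum.cong refl sum.swap)
      also have "\<dots> = (\<Sum>l\<le>M. \<Sum>\<mu>=1..N l. c l \<mu> * B n l \<mu>)"
        by (simp add: B_def sum_distrib_left)
      also have "\<dots> = 0" using B0 by (intro sum.neutral ballI) simp
      finally show "(\<Sum>x\<in>Z n. \<beta> n x * (\<Sum>l\<le>M. \<Sum>\<mu>=1..N l. c l \<mu> * Y l \<mu> x)) = 0" .
    qed
    \<comment> \<open>Conditional positive definiteness covers nonzero weights; for zero weights the
      double sum is 0.\<close>
    then have "0 \<le> (\<Sum>x\<in>Z n. \<Sum>y\<in>Z n. \<beta> n x * \<beta> n y * \<Phi> x y)"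
      using cpd Z[of n] unfolding conditionally_positive_definite_def
      by (cases "\<exists>x\<in>Z n. \<beta> n x \<noteq> 0") (auto intro: less_imp_le)
    also have "\<dots> = (\<Sum>x\<in>Z n. \<Sum>y\<in>Z n. \<beta> n x * \<beta> n y * kern e x y)"
      using Z(2)[of n] by (intro sum.cong refl arg_cong2[of _ _ _ _ "(*)"] \<Phi>) auto
    also have "\<dots> = (\<Sum>k. ?t k n)" by (rule sums_unique[OF energy])
    finally show ?thesis .
  qed
  have bound: "norm (?t k n) \<le> \<bar>e k\<bar> * kdiag k * W\<^sup>2" for k n
  proof -
    have "(\<Sum>\<nu>=1..N k. (B n k \<nu>)\<^sup>2) = (\<Sum>x\<in>Z n. \<Sum>y\<in>Z n. \<beta> n x * \<beta> n y * K k x y)"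
      by (simp add: sum_sum_K B_def power2_eq_square)
    also have "\<dots> \<le> (\<Sum>x\<in>Z n. \<Sum>y\<in>Z n. \<bar>\<beta> n x\<bar> * \<bar>\<beta> n y\<bar> * kdiag k)"
    proof (intro sum_mono)
      fix x y assume "x \<in> Z n" "y \<in> Z n"
      then have "\<bar>K k x y\<bar> \<le> kdiag k" using Z(2)[of n] by (intro abs_K_le) auto
      then have "\<bar>\<beta> n x * \<beta> n y * K k x y\<bar> \<le> \<bar>\<beta> n x\<bar> * \<bar>\<beta> n y\<bar> * kdiag k"
        unfolding abs_mult by (intro mult_left_mono) auto
      then show "\<beta> n x * \<beta> n y * K k x y \<le> \<bar>\<beta> n x\<bar> * \<bar>\<beta> n y\<bar> * kdiag k" by linarith
    qed
    also have "\<dots> = (\<Sum>z\<in>Z n. \<bar>\<beta> n z\<bar>)\<^sup>2 * kdiag k"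
      unfolding power2_eq_square sum_product by (simp only: sum_distrib_right)
    also have "\<dots> \<le> W\<^sup>2 * kdiag k"
      by (intro mult_right_mono power_mono \<beta>W kdiag_nonneg sum_nonneg) auto
    finally have "(\<Sum>\<nu>=1..N k. (B n k \<nu>)\<^sup>2) \<le> kdiag k * W\<^sup>2" by (simp add: mult.commute)
    then have "\<bar>e k\<bar> * (\<Sum>\<nu>=1..N k. (B n k \<nu>)\<^sup>2) \<le> \<bar>e k\<bar> * (kdiag k * W\<^sup>2)"
      by (rule mult_left_mono) simp
    then show ?thesis by (simp add: abs_mult abs_of_nonneg[OF sum_nonneg] mult.assoc)
  qed
  \<comment> \<open>Tannery's theorem: each degree converges and all are dominated uniformly in
    \<open>n\<close>. In the limit only degree \<open>l0\<close> survives, with factor 1.\<close>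
  have "(\<lambda>n. \<Sum>k. ?t k n) \<longlonglongrightarrow> suminf ?L"
  proof (rule tannerys_theorem[THEN conjunct2, THEN conjunct2])
    show "(\<lambda>n. ?t k n) \<longlonglongrightarrow> ?L k" for k
      by (intro tendsto_mult tendsto_const tendsto_sum tendsto_power Blim)
    show "summable (\<lambda>k. \<bar>e k\<bar> * kdiag k * W\<^sup>2)" using e by (rule summable_mult2)
    show "\<forall>\<^sub>F (k, n) in sequentially \<times>\<^sub>F sequentially. norm (?t k n) \<le> \<bar>e k\<bar> * kdiag k * W\<^sup>2"
      using bound by (intro always_eventually) auto
  qed simp
  then have "0 \<le> suminf ?L" by (rule LIMSEQ_le_const) (use energy_nonneg in auto)
  also have "?L = (\<lambda>k. if k = l0 then e l0 else 0)"
  proof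
    fix k
    show "?L k = (if k = l0 then e l0 else 0)"
      using \<mu>0 by (cases "k = l0") (simp_all add: if_distrib[of "\<lambda>t. t\<^sup>2"] cong: if_cong)
  qed
  also have "suminf \<dots> = e l0" using sums_single[of l0 "\<lambda>_. e l0"] by (simp add: sums_iff)
  finally show ?thesis .
qed

end

section \<open>Spherical harmonics as eigenfunctions\<close>

context
  fixes S :: "'a::euclidean_space set" and f :: "'a \<Rightarrow> real"
    and g :: "'a \<Rightarrow> 'a \<Rightarrow> real" and G :: "'a \<Rightarrow> 'a \<Rightarrow> 'a \<Rightarrow> real"
  assumes f: "\<And>x. x \<in> S \<Longrightarrow> (f has_derivative (\<lambda>h. \<Sum>b\<in>Basis. (h \<bullet> b) * g b x)) (at x)"
    and g: "\<And>b x. b \<in> Basis \<Longrightarrow> x \<in> S \<Longrightarrow>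
        (g b has_derivative (\<lambda>h. \<Sum>c\<in>Basis. (h \<bullet> c) * G c b x)) (at x)"
begin

lemma C2_on_partial_derivatives:
  assumes G: "\<And>b c. b \<in> Basis \<Longrightarrow> c \<in> Basis \<Longrightarrow> continuous_on S (G c b)"
  shows "C2_on S f"
proof -
  \<comment> \<open>\<open>E c b\<close> is the elementary bilinear form (h, h') \<mapsto> (h
    \<bullet> c) (h' \<bullet> b); these assemble the second total derivative from the partial
    ones.\<close>
  define E :: "'a \<Rightarrow> 'a \<Rightarrow> 'a \<Rightarrow>\<^sub>L 'a \<Rightarrow>\<^sub>L real" where
    "E c b = Blinfun (\<lambda>h. (h \<bullet> c) *\<^sub>R blinfun_inner_left b)" for c b
  have E: "blinfun_apply (E c b) h = (h \<bullet> c) *\<^sub>R blinfun_inner_left b" for c b h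
    unfolding E_def
    by (subst bounded_linear_Blinfun_apply)
       (auto intro!: bounded_linear_scaleR_const bounded_linear_inner_left)
  let ?f' = "\<lambda>x. \<Sum>b\<in>Basis. g b x *\<^sub>R blinfun_inner_left b"
  let ?f'' = "\<lambda>x. \<Sum>b\<in>Basis. \<Sum>c\<in>Basis. G c b x *\<^sub>R E c b"
  have 1: "(f has_derivative blinfun_apply (?f' x)) (at x)" if x: "x \<in> S" for x
  proof -
    have "blinfun_apply (?f' x) = (\<lambda>h. \<Sum>b\<in>Basis. (h \<bullet> b) * g b x)"
      by (simp add: fun_eq_iff blinfun.sum_left blinfun.scaleR_left mult.commute)
    then show ?thesis using f[OF x] by simp
  qed
  have 2: "(?f' has_derivative blinfun_apply (?f'' x)) (at x)" if x: "x \<in> S" for x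
  proof -
  have "(?f' has_derivative (\<lambda>h. \<Sum>b\<in>Basis. (\<Sum>c\<in>Basis. (h \<bullet> c) * G c b x) *\<^sub>R blinfun_inner_left b)) (at x)"
    by (intro has_derivative_sum has_derivative_scaleR_left g x)
  moreover have "blinfun_apply (?f'' x) = (\<lambda>h. \<Sum>b\<in>Basis. (\<Sum>c\<in>Basis. (h \<bullet> c) * G c b x) *\<^sub>R blinfun_inner_left b)"
    by (simp add: fun_eq_iff blinfun.sum_left blinfun.scaleR_left E scaleR_sum_left mult.commute)
    ultimately show ?thesis by simp
  qed
  have 3: "continuous_on S ?f''" by (intro continuous_intros G)
  show ?thesis
    unfolding C2_on_def by (intro exI[of _ ?f'] exI[of _ ?f''] conjI ballI 1 2 3)
qed

lemma laplacian_partial_derivatives: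
  assumes S: "open S" and x: "x \<in> S"
  shows "laplacian f x = (\<Sum>b\<in>Basis. G b b x)"
  unfolding laplacian_def
proof (intro sum.cong refl)
  fix b :: 'a assume b: "b \<in> Basis"
  have line: "((\<lambda>t. \<phi> (x + t *\<^sub>R b)) has_real_derivative D b) (at s)"
    if "(\<phi> has_derivative (\<lambda>h. \<Sum>c\<in>Basis. (h \<bullet> c) * D c)) (at (x + s *\<^sub>R b))" for \<phi> :: "'a \<Rightarrow> real" and D s
  proof -
    have "((\<lambda>t. \<phi> (x + t *\<^sub>R b)) has_derivative (\<lambda>t. \<Sum>c\<in>Basis. ((t *\<^sub>R b) \<bullet> c) * D c)) (at s)"
      by (rule has_derivative_compose[where g=\<phi> and f="\<lambda>t. x + t *\<^sub>R b", OF _ that])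
         (auto intro!: derivative_eq_intros)
    moreover have "(\<Sum>c\<in>Basis. ((t *\<^sub>R b) \<bullet> c) * D c) = D b * t" for t
      using b by (simp add: inner_Basis if_distrib[of "\<lambda>r. _ * r * _"] sum.delta cong: if_cong)
    ultimately show ?thesis by (simp add: has_field_derivative_def)
  qed
  \<comment> \<open>The outer \<open>deriv\<close> sees the inner one on a whole neighbourhood of 0,
    so the first derivative must be known along a piece of the line.\<close>
  have "open ((\<lambda>t. x + t *\<^sub>R b) -` S)"
    by (intro open_vimage S continuous_intros)
  then have "\<forall>\<^sub>F s in nhds 0. x + s *\<^sub>R b \<in> S"
    using x by (intro eventually_nhds[THEN iffD2] exI[of _ "(\<lambda>t. x + t *\<^sub>R b) -` S"]) auto
  then have "\<forall>\<^sub>F s in nhds 0. deriv (\<lambda>t. f (x + t *\<^sub>R b)) s = g b (x + s *\<^sub>R b)"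
    by eventually_elim (rule DERIV_imp_deriv[OF line[OF f]])
  then have "deriv (deriv (\<lambda>t. f (x + t *\<^sub>R b))) 0 = deriv (\<lambda>s. g b (x + s *\<^sub>R b)) 0"
    by (rule deriv_cong_ev) simp
  also have "\<dots> = G b b x"
    using DERIV_imp_deriv[OF line[where s=0, OF g[OF b]]] x by simp
  finally show "deriv (deriv (\<lambda>t. f (x + t *\<^sub>R b))) 0 = G b b x" .
qed

end

text \<open>Sums of functions P z * |z|^(2 a) are closed under differentiation away from 0, with
  \<open>a\<close> dropping to a - 1 in one term. Used once for the radial extension of a harmonic
  and again for its first derivatives.\<close>

lemma has_derivative_mult_norm_powr:
  fixes P :: "'a::euclidean_space \<Rightarrow> real"
  assumes P: "real_polynomial_function P" and z: "z \<noteq> 0"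
  shows "((\<lambda>z. P z * (z \<bullet> z) powr a) has_derivative
    (\<lambda>h. \<Sum>b\<in>Basis. (h \<bullet> b) *
      (dir_deriv b P z * (z \<bullet> z) powr a + (2 * a * (z \<bullet> b) * P z) * (z \<bullet> z) powr (a - 1)))) (at z)"
proof -
  have zz: "z \<bullet> z > 0" using z by simp
  have "((\<lambda>z. (z \<bullet> z) powr a) has_derivative (\<lambda>h. a * (z \<bullet> z) powr (a - 1) * (2 * (z \<bullet> h)))) (at z)"
  proof (rule has_derivative_compose[where g="\<lambda>r. r powr a" and g'="\<lambda>h. a * (z \<bullet> z) powr (a - 1) * h"])
    show "((\<lambda>z. z \<bullet> z) has_derivative (\<lambda>h. 2 * (z \<bullet> h))) (at z)"
      by (auto intro!: derivative_eq_intros simp: inner_commute)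
    show "((\<lambda>r. r powr a) has_derivative (\<lambda>h. a * (z \<bullet> z) powr (a - 1) * h)) (at (z \<bullet> z))"
      using has_real_derivative_powr[OF zz, of a] by (simp add: has_field_derivative_def)
  qed
  from has_derivative_mult[OF has_derivative_dir_deriv[OF P] this]
  have "((\<lambda>z. P z * (z \<bullet> z) powr a) has_derivative
      (\<lambda>h. P z * (a * (z \<bullet> z) powr (a - 1) * (2 * (z \<bullet> h))) + dir_deriv h P z * (z \<bullet> z) powr a)) (at z)" .
  moreover have "P z * (a * (z \<bullet> z) powr (a - 1) * (2 * (z \<bullet> h))) + dir_deriv h P z * (z \<bullet> z) powr a =
      (\<Sum>b\<in>Basis. (h \<bullet> b) *
      (dir_deriv b P z * (z \<bullet> z) powr a + (2 * a * (z \<bullet> b) * P z) * (z \<bullet> z) powr (a - 1)))" for h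
  proof -
    have "(\<Sum>b\<in>Basis. (h \<bullet> b) *
      (dir_deriv b P z * (z \<bullet> z) powr a + (2 * a * (z \<bullet> b) * P z) * (z \<bullet> z) powr (a - 1)))
      = (\<Sum>b\<in>Basis. (h \<bullet> b) * dir_deriv b P z) * (z \<bullet> z) powr a
       + (2 * a * P z * (z \<bullet> z) powr (a - 1)) * (\<Sum>b\<in>Basis. (z \<bullet> b) * (h \<bullet> b))"
      unfolding sum_distrib_left sum_distrib_right sum.distrib[symmetric]
      by (intro sum.cong refl) (simp add: algebra_simps)
    also have "(\<Sum>b\<in>Basis. (z \<bullet> b) * (h \<bullet> b)) = z \<bullet> h" by (rule euclidean_inner[symmetric])
    also have "(\<Sum>b\<in>Basis. (h \<bullet> b) * dir_deriv b P z) = dir_deriv h P z" by (rule dir_deriv_Basis[OF P, symmetric])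
    finally show ?thesis by simp
  qed
  ultimately show ?thesis by simp
qed

text \<open>Links the formula for the eigenvalue with the analytic spectrum on which
  \<open>p\<close> is known to be positive: the harmonic itself is a C^2 eigenfunction.\<close>

lemma sphere_eigenvalue_in_spectrum:
  fixes f :: "'a::euclidean_space \<Rightarrow> real"
  assumes f: "harmonic_poly l f" and nz: "\<exists>x\<in>sphere 0 1. f x \<noteq> 0" and dim: "DIM('a) = d + 1"
  shows "sphere_eigenvalue d l \<in> laplace_beltrami_spectrum TYPE('a)"
proof -
  note rf = harmonic_polyD(1)[OF f] and hf = harmonic_polyD(2)[OF f]
  note rdf = real_polynomial_function_dir_deriv[OF rf]
  \<comment> \<open>Homogeneity of degree \<open>l\<close> gives f (z / |z|) = f z * |z|^(-l), and
    |z|^(-l) is the power -l/2 of \<open>z \<bullet> z\<close>.\<close>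
  define a where "a = - real l / 2"
  define T where "T = (\<lambda>z. f (sgn z))"
  define k where "k b z = 2 * a * (z \<bullet> b) * f z" for b z :: 'a
  define g where "g b z = dir_deriv b f z * (z \<bullet> z) powr a + k b z * (z \<bullet> z) powr (a - 1)" for b z :: 'a
  define G where "G c b z =
      dir_deriv c (dir_deriv b f) z * (z \<bullet> z) powr a + 2 * a * (z \<bullet> c) * dir_deriv b f z * (z \<bullet> z) powr (a - 1)
      + (dir_deriv c (k b) z * (z \<bullet> z) powr (a - 1) + 2 * (a - 1) * (z \<bullet> c) * k b z * (z \<bullet> z) powr (a - 1 - 1))"
    for c b z :: 'a
  have rk: "real_polynomial_function (k b)" for b
    unfolding k_def by (intro real_polynomial_function.intros(2,4) real_polynomial_function_inner rf)
  have T_eq: "T z = f z * (z \<bullet> z) powr a" if "z \<noteq> 0" for z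
  proof -
    have "f (sgn z) = inverse (norm z) ^ l * f z"
      using hf by (simp add: homogeneous_def sgn_div_norm)
    moreover have "(z \<bullet> z) powr a = inverse (norm z) ^ l"
    proof -
      have "(z \<bullet> z) powr a = (norm z powr 2) powr a"
        using that by (simp add: powr_numeral dot_square_norm)
      also have "\<dots> = norm z powr (- real l)" unfolding powr_powr a_def by simp
      also have "\<dots> = inverse (norm z) ^ l"
        using that by (simp add: powr_minus powr_realpow power_inverse)
      finally show ?thesis .
    qed
    ultimately show ?thesis by (simp add: T_def)
  qed
  have T': "(T has_derivative (\<lambda>h. \<Sum>b\<in>Basis. (h \<bullet> b) * g b z)) (at z)" if "z \<in> - {0}" for z
  proof (rule has_derivative_transform_within_open[where s="- {0}" and f="\<lambda>z. f z * (z \<bullet> z) powr a"])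
    show "((\<lambda>z. f z * (z \<bullet> z) powr a) has_derivative (\<lambda>h. \<Sum>b\<in>Basis. (h \<bullet> b) * g b z)) (at z)"
      unfolding g_def k_def by (rule has_derivative_mult_norm_powr[OF rf]) (use that in auto)
  qed (use that T_eq in auto)
  have g': "(g b has_derivative (\<lambda>h. \<Sum>c\<in>Basis. (h \<bullet> c) * G c b z)) (at z)" if "z \<in> - {0}" for b z
  proof -
    have z: "z \<noteq> 0" using that by simp
    have "(g b has_derivative (\<lambda>h. (\<Sum>c\<in>Basis. (h \<bullet> c) *
          (dir_deriv c (dir_deriv b f) z * (z \<bullet> z) powr a + (2 * a * (z \<bullet> c) * dir_deriv b f z) * (z \<bullet> z) powr (a - 1)))
        + (\<Sum>c\<in>Basis. (h \<bullet> c) *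
          (dir_deriv c (k b) z * (z \<bullet> z) powr (a - 1) + (2 * (a - 1) * (z \<bullet> c) * k b z) * (z \<bullet> z) powr (a - 1 - 1))))) (at z)"
      unfolding g_def[abs_def]
      by (intro has_derivative_add has_derivative_mult_norm_powr rdf rk z)
    then show ?thesis unfolding G_def sum.distrib[symmetric] distrib_left[symmetric] .
  qed
  note cont = continuous_on_real_polynomial_function[OF real_polynomial_function_dir_deriv[OF rdf]]
    continuous_on_real_polynomial_function[OF rdf]
    continuous_on_real_polynomial_function[OF rk]
    continuous_on_real_polynomial_function[OF real_polynomial_function_dir_deriv[OF rk]]
  have Gc: "continuous_on (- {0}) (G c b)" for c b
    unfolding G_def
    by (intro continuous_on_add continuous_on_mult continuous_on_powr continuous_on_const continuous_on_inner
        continuous_on_id cont ballI) auto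
  have "C2_on (- {0}) T" by (rule C2_on_partial_derivatives[OF T' g' Gc])
  moreover have "laplace_beltrami f x = sphere_eigenvalue d l * f x" if x: "x \<in> sphere 0 1" for x
  proof -
    have x0: "x \<in> - {0}" and xx: "x \<bullet> x = 1" using x by (auto simp: norm_eq_1)
    have dk: "dir_deriv b (k b) x = 2 * a * ((x \<bullet> b) * dir_deriv b f x + (b \<bullet> b) * f x)" for b
    proof -
      have "k b = (\<lambda>z. 2 * a * ((z \<bullet> b) * f z))" by (simp add: k_def fun_eq_iff)
      then have "dir_deriv b (k b) x = 2 * a * dir_deriv b (\<lambda>z. (z \<bullet> b) * f z) x"
        using dir_deriv_cmult[OF real_polynomial_function.intros(4)[OF real_polynomial_function_inner rf]] by simp
      also have "dir_deriv b (\<lambda>z. (z \<bullet> b) * f z) x = (x \<bullet> b) * dir_deriv b f x + (b \<bullet> b) * f x"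
        using dir_deriv_mult[OF real_polynomial_function_inner rf] by simp
      finally show ?thesis .
    qed
    have E: "(\<Sum>b\<in>Basis. (x \<bullet> b) * dir_deriv b f x) = real l * f x"
      using dir_deriv_Basis[OF rf, of x x] homogeneous_Euler[OF rf hf, of x] by simp
    have "laplace_beltrami f x = (\<Sum>b\<in>Basis. G b b x)"
      unfolding laplace_beltrami_def T_def[symmetric]
      by (rule laplacian_partial_derivatives[OF T' g' _ x0]) auto
    also have "\<dots> = (\<Sum>b\<in>Basis. dir_deriv b (dir_deriv b f) x + 4 * a * ((x \<bullet> b) * dir_deriv b f x)
        + 2 * a * f x + 4 * a * (a - 1) * f x * ((x \<bullet> b) * (x \<bullet> b)))"
      by (intro sum.cong refl) (simp add: G_def dk xx k_def algebra_simps)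
    \<comment> \<open>With n = DIM('a), harmonicity and Euler's identity the factor of f x becomes 4
      a l + 2 a n + 4 a (a - 1) = - l (l + n - 2).\<close>
    also have "\<dots> = (\<Sum>b\<in>Basis. dir_deriv b (dir_deriv b f) x) + 4 * a * (\<Sum>b\<in>Basis. (x \<bullet> b) * dir_deriv b f x)
        + real DIM('a) * (2 * a * f x) + 4 * a * (a - 1) * f x * (\<Sum>b\<in>Basis. (x \<bullet> b) * (x \<bullet> b))"
      by (simp add: sum.distrib sum_distrib_left)
    also have "(\<Sum>b\<in>Basis. (x \<bullet> b) * (x \<bullet> b)) = 1" using euclidean_inner[of x x] xx by simp
    also have "(\<Sum>b\<in>Basis. dir_deriv b (dir_deriv b f) x) = 0" by (rule harmonic_polyD(3)[OF f])
    finally show ?thesis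
      unfolding E by (simp add: dim sphere_eigenvalue_def a_def field_simps)
  qed
  ultimately show ?thesis
    using nz unfolding laplace_beltrami_spectrum_def T_def by blast
qed

section \<open>The differentiation matrix\<close>

text \<open>The cardinal functions \<open>u k\<close> pin the matrix down: applied to
  \<open>u k\<close>, any candidate shows its k-th column. Conversely the expansion \<open>L\<close>
  of every trial function in cardinal functions makes this matrix work, so the definite description
  is well defined.\<close>

lemma differentiation_matrix_eq:
  assumes xs: "distinct xs"
    and u: "\<And>k. k < length xs \<Longrightarrow> u k \<in> S"
      "\<And>k i. k < length xs \<Longrightarrow> i < length xs \<Longrightarrow> u k (xs ! i) = (if i = k then 1 else 0)"
    and L: "\<And>f x. f \<in> S \<Longrightarrow> x \<in> set xs \<Longrightarrow> L f x = (\<Sum>k<length xs. f (xs ! k) * L (u k) x)"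
  shows "differentiation_matrix S L xs = mat (length xs) (length xs) (\<lambda>(i, k). L (u k) (xs ! i))"
    (is "_ = ?M")
  unfolding differentiation_matrix_def
proof (rule the_equality)
  let ?n = "length xs"
  have mult: "(M *\<^sub>v vec_of_list (map f xs)) $ i = (\<Sum>k<?n. M $$ (i, k) * f (xs ! k))"
    if "M \<in> carrier_mat ?n ?n" "i < ?n" for M :: "real mat" and f i
  proof -
    have "(M *\<^sub>v vec_of_list (map f xs)) $ i = (\<Sum>k = 0..<?n. M $$ (i, k) * vec_of_list (map f xs) $ k)"
      using that by (auto simp: scalar_prod_def intro!: sum.cong)
    also have "\<dots> = (\<Sum>k<?n. M $$ (i, k) * f (xs ! k))"
      by (intro sum.cong) (auto simp: vec_of_list_index)
    finally show ?thesis .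
  qed
  show "?M \<in> carrier_mat ?n ?n \<and> (\<forall>f\<in>S. ?M *\<^sub>v vec_of_list (map f xs) = vec_of_list (map (L f) xs))"
  proof (intro conjI ballI eq_vecI)
    fix f i assume f: "f \<in> S" and "i < dim_vec (vec_of_list (map (L f) xs))"
    then have i: "i < ?n" by simp
    have "(?M *\<^sub>v vec_of_list (map f xs)) $ i = (\<Sum>k<?n. ?M $$ (i, k) * f (xs ! k))"
      by (rule mult) (use i in auto)
    also have "\<dots> = (\<Sum>k<?n. f (xs ! k) * L (u k) (xs ! i))"
      by (intro sum.cong) (use i in auto)
    also have "\<dots> = L f (xs ! i)" using L[OF f] i by simp
    finally show "(?M *\<^sub>v vec_of_list (map f xs)) $ i = vec_of_list (map (L f) xs) $ i" using i by (simp add: vec_of_list_index)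
  qed auto
  fix M assume M: "M \<in> carrier_mat ?n ?n \<and> (\<forall>f\<in>S. M *\<^sub>v vec_of_list (map f xs) = vec_of_list (map (L f) xs))"
  show "M = ?M"
  proof (rule eq_matI)
    fix i k assume "i < dim_row ?M" "k < dim_col ?M"
    then have ik: "i < ?n" "k < ?n" by auto
    have "L (u k) (xs ! i) = (M *\<^sub>v vec_of_list (map (u k) xs)) $ i"
      using M u(1)[OF ik(2)] ik by (simp add: vec_of_list_index)
    also have "\<dots> = (\<Sum>j<?n. M $$ (i, j) * u k (xs ! j))" by (rule mult) (use M ik in auto)
    also have "\<dots> = (\<Sum>j<?n. if j = k then M $$ (i, k) else 0)"
      by (intro sum.cong) (auto simp: u(2) ik)
    finally show "M $$ (i, k) = ?M $$ (i, k)" using ik by simp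
  qed (use M in auto)
qed

section \<open>The kernel and its expansion under the hypotheses of the theorem, with
  \<open>M\<close> = m - 1\<close>

locale cpd_kernel = harmonic_bases Y N
  for Y :: "nat \<Rightarrow> nat \<Rightarrow> 'a::euclidean_space \<Rightarrow> real" and N :: "nat \<Rightarrow> nat" +
  fixes c lam :: "nat \<Rightarrow> real" and \<Phi> :: "'a \<Rightarrow> 'a \<Rightarrow> real" and X :: "'a set" and M :: nat
  assumes zonal: "zonal_kernel Y N c \<Phi>"
    and cpd: "conditionally_positive_definite (harmonic_span Y N M) \<Phi>"
    and lam_summable: "summable (\<lambda>l. \<bar>c l * \<bar>lam l\<bar> * real l ^ (DIM('a) - 2)\<bar>)"
    and lam_pos: "\<And>l. 0 < N l \<Longrightarrow> 0 < lam l"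
    and X: "finite X" "X \<subseteq> sphere 0 1" "unisolvent (harmonic_span Y N M) X"
begin

text \<open>On the diagonal the products of harmonics are squares and add up to
  \<open>kdiag l\<close>, so absolute convergence at a single point (x, x) suffices.\<close>

lemma c_summable: "summable (\<lambda>l. \<bar>c l\<bar> * kdiag l)"
proof -
  obtain x :: 'a where x: "x \<in> sphere 0 1" using sphere_nonempty by blast
  have "summable (\<lambda>l. \<Sum>\<mu>=1..N l. \<bar>c l * Y l \<mu> x * Y l \<mu> x\<bar>)"
    using zonal x unfolding zonal_kernel_def by blast
  moreover have "(\<Sum>\<mu>=1..N l. \<bar>c l * Y l \<mu> x * Y l \<mu> x\<bar>) = \<bar>c l\<bar> * kdiag l" for l
    unfolding K_diag_eq[OF x, symmetric] K_def by (simp add: sum_distrib_left abs_mult mult.assoc)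
  ultimately show ?thesis by simp
qed

lemma clam_summable: "summable (\<lambda>l. \<bar>c l * lam l\<bar> * kdiag l)"
proof -
  obtain C where C: "\<And>l. l \<ge> 1 \<Longrightarrow> kdiag l \<le> C * real l ^ (DIM('a) - 2)" using kdiag_le by blast
  show ?thesis
  proof (rule summable_comparison_test[OF _ summable_mult[OF lam_summable, of C]], intro exI[of _ 1] allI impI)
    fix l :: nat assume l: "1 \<le> l"
    have "\<bar>c l * lam l\<bar> * kdiag l \<le> \<bar>c l * lam l\<bar> * (C * real l ^ (DIM('a) - 2))"
      by (intro mult_left_mono C l) simp
    then show "norm (\<bar>c l * lam l\<bar> * kdiag l) \<le> C * \<bar>c l * \<bar>lam l\<bar> * real l ^ (DIM('a) - 2)\<bar>"
      using kdiag_nonneg[of l] by (simp add: abs_mult mult_ac)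
  qed
qed

lemma \<Phi>_eq_kern:
  assumes "x \<in> sphere 0 1" "y \<in> sphere 0 1"
  shows "\<Phi> x y = kern c x y"
proof -
  note tendsto_uniform_limitI[OF zonal[unfolded zonal_kernel_def, THEN conjunct2], of "(x, y)"]
  then have "(\<lambda>l. c l * K l x y) sums \<Phi> x y"
    using assms by (simp add: sums_def K_def sum_distrib_left mult.assoc)
  then show ?thesis using kern_sums[OF c_summable assms] by (rule sums_unique2)
qed

section \<open>Trial functions in terms of their coefficients\<close>

abbreviation "V \<equiv> harmonic_span Y N M"
abbreviation "L \<equiv> harmonic_multiplier Y N lam"

definition harmonic_comb :: "(nat \<Rightarrow> nat \<Rightarrow> real) \<Rightarrow> 'a \<Rightarrow> real" where
  "harmonic_comb b x = (\<Sum>l\<le>M. \<Sum>\<mu>=1..N l. b l \<mu> * Y l \<mu> x)"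

definition trial :: "('a \<Rightarrow> real) \<Rightarrow> (nat \<Rightarrow> nat \<Rightarrow> real) \<Rightarrow> 'a \<Rightarrow> real" where
  "trial a b x = (\<Sum>y\<in>X. a y * \<Phi> x y) + harmonic_comb b x"

lemma harmonic_comb_in_V: "harmonic_comb b \<in> V"
  unfolding harmonic_span_def harmonic_comb_def[abs_def] by blast

lemma V_iff: "q \<in> V \<longleftrightarrow> (\<exists>b. q = harmonic_comb b)"
  unfolding harmonic_span_def harmonic_comb_def[abs_def] by blast

lemma trial_space_iff: "u \<in> trial_space V \<Phi> X \<longleftrightarrow> (\<exists>a b. annihilates V X a \<and> u = trial a b)"
  unfolding trial_space_def trial_def[abs_def] by (auto simp: V_iff)

lemma harmonic_comb_zero_on_X:
  assumes "\<And>x. x \<in> X \<Longrightarrow> harmonic_comb b x = 0" "l \<le> M" "\<mu> \<in> {1..N l}"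
  shows "b l \<mu> = 0"
proof (rule span_zero_coeff[OF _ assms(2,3)])
  have "\<forall>x\<in>sphere 0 1. harmonic_comb b x = 0"
    using X(3) harmonic_comb_in_V[of b] assms(1) unfolding unisolvent_def by blast
  then show "(\<Sum>l\<le>M. \<Sum>\<mu>=1..N l. b l \<mu> * Y l \<mu> x) = 0" if "x \<in> sphere 0 1" for x
    using that by (simp add: harmonic_comb_def)
qed

lemma sphere_inner_trial:
  assumes \<mu>: "\<mu> \<in> {1..N l}"
  shows "sphere_inner (trial a b) (Y l \<mu>) = c l * (\<Sum>y\<in>X. a y * Y l \<mu> y) + (if l \<le> M then b l \<mu> else 0)"
proof -
  have XS: "y \<in> sphere 0 1" if "y \<in> X" for y using X(2) that by blast
  have ki: "integrable sphere_measure (\<lambda>x. a y * (kern c x y * Y l \<mu> x))" if "y \<in> X" for y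
    by (intro integrable_mult_right sphere_inner_kern(2)[OF c_summable XS[OF that] \<mu>])
  have pi: "integrable sphere_measure (\<lambda>x. harmonic_comb b x * Y l \<mu> x)"
    unfolding harmonic_comb_def by (rule sphere_inner_span(2)[OF \<mu>])
  have "sphere_inner (trial a b) (Y l \<mu>)
      = (LINT x|sphere_measure. (\<Sum>y\<in>X. a y * (kern c x y * Y l \<mu> x)) + harmonic_comb b x * Y l \<mu> x)"
    unfolding sphere_inner_def
  proof (rule Bochner_Integration.integral_cong)
    fix x :: 'a assume "x \<in> space sphere_measure"
    then have "\<Phi> x y = kern c x y" if "y \<in> X" for y using \<Phi>_eq_kern XS[OF that] by simp
    then have "(\<Sum>y\<in>X. a y * \<Phi> x y) = (\<Sum>y\<in>X. a y * kern c x y)" by (intro sum.cong) auto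
    then show "trial a b x * Y l \<mu> x = (\<Sum>y\<in>X. a y * (kern c x y * Y l \<mu> x)) + harmonic_comb b x * Y l \<mu> x"
      by (simp add: trial_def distrib_right sum_distrib_right mult.assoc)
  qed simp
  also have "\<dots> = (LINT x|sphere_measure. (\<Sum>y\<in>X. a y * (kern c x y * Y l \<mu> x))) + (LINT x|sphere_measure. harmonic_comb b x * Y l \<mu> x)"
    by (intro Bochner_Integration.integral_add Bochner_Integration.integrable_sum ki pi)
  also have "(LINT x|sphere_measure. (\<Sum>y\<in>X. a y * (kern c x y * Y l \<mu> x)))
      = (\<Sum>y\<in>X. LINT x|sphere_measure. a y * (kern c x y * Y l \<mu> x))"
    by (intro Bochner_Integration.integral_sum ki)
  also have "\<dots> = (\<Sum>y\<in>X. a y * (c l * Y l \<mu> y))"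
    by (intro sum.cong refl) (use sphere_inner_kern(1)[OF c_summable XS \<mu>] in \<open>simp add: sphere_inner_def\<close>)
  also have "(LINT x|sphere_measure. harmonic_comb b x * Y l \<mu> x) = (if l \<le> M then b l \<mu> else 0)"
    using sphere_inner_span(1)[OF \<mu>, where M=M and b=b] by (simp add: sphere_inner_def harmonic_comb_def)
  finally show ?thesis by (simp add: sum_distrib_left mult_ac)
qed

text \<open>The operator acts on Fourier coefficients. Those of a kernel translate are
  \<open>c l * Y l \<mu> y\<close>, so \<open>c\<close> becomes \<open>c l * lam l\<close> in the
  kernel part, while the polynomial coefficients are multiplied by \<open>lam l\<close>.\<close>

lemma L_trial:
  assumes x: "x \<in> X"
  shows "L (trial a b) x = (\<Sum>y\<in>X. a y * kern (\<lambda>l. c l * lam l) x y) + harmonic_comb (\<lambda>l \<mu>. lam l * b l \<mu>) x"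
proof -
  have XS: "y \<in> sphere 0 1" if "y \<in> X" for y using X(2) that by blast
  have eq: "(\<Sum>\<mu>=1..N l. lam l * sphere_inner (trial a b) (Y l \<mu>) * Y l \<mu> x)
      = (\<Sum>y\<in>X. a y * (c l * lam l * K l x y)) + (if l \<in> {..M} then (\<Sum>\<mu>=1..N l. lam l * b l \<mu> * Y l \<mu> x) else 0)" for l
  proof -
    have "(\<Sum>\<mu>=1..N l. lam l * sphere_inner (trial a b) (Y l \<mu>) * Y l \<mu> x)
      = (\<Sum>\<mu>=1..N l. (\<Sum>y\<in>X. a y * (c l * lam l * (Y l \<mu> x * Y l \<mu> y))) + lam l * (if l \<le> M then b l \<mu> else 0) * Y l \<mu> x)"
      by (intro sum.cong refl) (simp add: sphere_inner_trial sum_distrib_left sum_distrib_right algebra_simps)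
    also have "\<dots> = (\<Sum>\<mu>=1..N l. \<Sum>y\<in>X. a y * (c l * lam l * (Y l \<mu> x * Y l \<mu> y)))
      + (\<Sum>\<mu>=1..N l. lam l * (if l \<le> M then b l \<mu> else 0) * Y l \<mu> x)"
      by (rule sum.distrib)
    also have "(\<Sum>\<mu>=1..N l. \<Sum>y\<in>X. a y * (c l * lam l * (Y l \<mu> x * Y l \<mu> y)))
      = (\<Sum>y\<in>X. a y * (c l * lam l * K l x y))"
      unfolding K_def by (subst sum.swap) (simp add: sum_distrib_left)
    finally show ?thesis by simp
  qed
  have "(\<lambda>l. \<Sum>\<mu>=1..N l. lam l * sphere_inner (trial a b) (Y l \<mu>) * Y l \<mu> x) sums
      ((\<Sum>y\<in>X. a y * kern (\<lambda>l. c l * lam l) x y) + (\<Sum>l\<in>{..M}. \<Sum>\<mu>=1..N l. lam l * b l \<mu> * Y l \<mu> x))"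
    unfolding eq
    by (intro sums_add sums_sum sums_mult kern_sums[OF clam_summable] XS x sums_If_finite_set) auto
  then show ?thesis unfolding harmonic_multiplier_def harmonic_comb_def by (rule sums_unique[symmetric])
qed

section \<open>Quadratic forms of the kernel and of its image under the operator\<close>

definition energy :: "(nat \<Rightarrow> real) \<Rightarrow> ('a \<Rightarrow> real) \<Rightarrow> ('a \<Rightarrow> real) \<Rightarrow> real" where
  "energy e a a' = (\<Sum>x\<in>X. \<Sum>y\<in>X. a x * a' y * kern e x y)"

lemma energy_commute: "energy e a a' = energy e a' a"
proof -
  have "kern e x y = kern e y x" for x y by (simp add: kern_def K_def mult.commute)
  then show ?thesis unfolding energy_def by (subst sum.swap) (simp add: mult.commute)
qed

lemma energy_pos:
  assumes "annihilates V X a" "\<exists>x\<in>X. a x \<noteq> 0"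
  shows "0 < energy c a a"
proof -
  have "0 < (\<Sum>x\<in>X. \<Sum>y\<in>X. a x * a y * \<Phi> x y)"
    using cpd X assms unfolding conditionally_positive_definite_def by blast
  also have "\<dots> = energy c a a"
    unfolding energy_def using X(2) by (intro sum.cong refl arg_cong2[of _ _ _ _ "(*)"] \<Phi>_eq_kern) auto
  finally show ?thesis .
qed

lemma energy_zero: "(\<And>x. x \<in> X \<Longrightarrow> a x = 0) \<Longrightarrow> energy e a a' = 0"
  unfolding energy_def by simp

text \<open>The annihilating vector removes the polynomial part, also after applying the operator,
  which maps polynomial parts to polynomial parts of the same degree bound.\<close>

lemma pair_trial:
  assumes a: "annihilates V X a"
  shows "(\<Sum>x\<in>X. a x * trial a' b x) = energy c a a'"
    and "(\<Sum>x\<in>X. a x * L (trial a' b) x) = energy (\<lambda>l. c l * lam l) a a'"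
proof -
  have kill: "(\<Sum>x\<in>X. a x * harmonic_comb b x) = 0" for b
    using a harmonic_comb_in_V unfolding annihilates_def by blast
  have exp: "(\<Sum>x\<in>X. a x * ((\<Sum>y\<in>X. a' y * kern e x y) + harmonic_comb b x)) = energy e a a'" for e b
    using kill[of b] by (simp add: energy_def distrib_left sum.distrib sum_distrib_left mult.assoc)
  have "(\<Sum>x\<in>X. a x * trial a' b x) = (\<Sum>x\<in>X. a x * ((\<Sum>y\<in>X. a' y * kern c x y) + harmonic_comb b x))"
    using X(2) by (intro sum.cong refl) (auto simp: trial_def \<Phi>_eq_kern subset_iff intro!: sum.cong)
  then show "(\<Sum>x\<in>X. a x * trial a' b x) = energy c a a'" unfolding exp .
  have "(\<Sum>x\<in>X. a x * L (trial a' b) x)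
      = (\<Sum>x\<in>X. a x * ((\<Sum>y\<in>X. a' y * kern (\<lambda>l. c l * lam l) x y) + harmonic_comb (\<lambda>l \<mu>. lam l * b l \<mu>) x))"
    by (intro sum.cong refl) (simp add: L_trial)
  then show "(\<Sum>x\<in>X. a x * L (trial a' b) x) = energy (\<lambda>l. c l * lam l) a a'" unfolding exp .
qed

lemma L_energy:
  assumes a: "annihilates V X a"
  shows "0 \<le> energy (\<lambda>l. c l * lam l) a a"
    and "\<exists>x\<in>X. a x \<noteq> 0 \<Longrightarrow> 0 < energy (\<lambda>l. c l * lam l) a a"
proof -
  define s where "s l = (\<Sum>\<mu>=1..N l. (\<Sum>x\<in>X. a x * Y l \<mu> x)\<^sup>2)" for l
  have c_sums: "(\<lambda>l. c l * s l) sums energy c a a"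
    unfolding s_def energy_def by (rule kern_quadratic_sums[OF c_summable X(1,2)])
  have l_sums: "(\<lambda>l. c l * lam l * s l) sums energy (\<lambda>l. c l * lam l) a a"
    unfolding s_def energy_def by (rule kern_quadratic_sums[OF clam_summable X(1,2)])
  have s0: "s l = 0" if "l \<le> M" for l
  proof -
    have "(\<Sum>x\<in>X. a x * Y l \<mu> x) = 0" if \<mu>: "\<mu> \<in> {1..N l}" for \<mu>
    proof -
      let ?b = "\<lambda>l' \<mu>'. if l' = l \<and> \<mu>' = \<mu> then 1 else 0 :: real"
      have "harmonic_comb ?b x = Y l \<mu> x" for x
      proof -
        have "harmonic_comb ?b x = (\<Sum>l'\<le>M. if l' = l then Y l \<mu> x else 0)"
          unfolding harmonic_comb_def
        proof (intro sum.cong refl)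
          fix l'
          have "(\<Sum>\<mu>'=1..N l'. ?b l' \<mu>' * Y l' \<mu>' x) = (\<Sum>\<mu>'=1..N l'. if l' = l \<and> \<mu>' = \<mu> then Y l' \<mu>' x else 0)"
            by (intro sum.cong refl) simp
          also have "\<dots> = (if l' = l then Y l \<mu> x else 0)" using \<mu> by (cases "l' = l") simp_all
          finally show "(\<Sum>\<mu>'=1..N l'. ?b l' \<mu>' * Y l' \<mu>' x) = (if l' = l then Y l \<mu> x else 0)" .
        qed
        then show ?thesis using \<open>l \<le> M\<close> by simp
      qed
      moreover have "(\<Sum>x\<in>X. a x * harmonic_comb ?b x) = 0" using a harmonic_comb_in_V unfolding annihilates_def by blast
      ultimately show ?thesis by simp
    qed
    then show ?thesis by (simp add: s_def)
  qed
  \<comment> \<open>\<open>lam l\<close> is known to be positive only when there are harmonics of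
    degree \<open>l\<close>; otherwise \<open>s l\<close> is an empty sum. For degrees above
    \<open>M\<close> the first harmonic serves to show \<open>c l \<ge> 0\<close>.\<close>
  have nonneg: "0 \<le> c l * s l \<and> (s l = 0 \<or> 0 < lam l)" for l
  proof (cases "l \<le> M \<or> N l = 0")
    case True
    then have "s l = 0" using s0 by (auto simp: s_def)
    then show ?thesis by simp
  next
    case False
    then have "0 \<le> c l"
      by (intro conditionally_positive_definite_coeff_nonneg[OF c_summable \<Phi>_eq_kern cpd X, of l 1]) auto
    moreover have "0 \<le> s l" by (simp add: s_def sum_nonneg)
    ultimately show ?thesis using lam_pos False by auto
  qed
  have l_nonneg: "0 \<le> c l * lam l * s l" for l
    using nonneg[of l] by (metis less_imp_le mult.assoc mult.commute mult_nonneg_nonneg mult_zero_left)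
  have l_sum: "summable (\<lambda>l. c l * lam l * s l)" and l_eq: "energy (\<lambda>l. c l * lam l) a a = (\<Sum>l. c l * lam l * s l)"
    using l_sums by (simp_all add: sums_iff)
  show "0 \<le> energy (\<lambda>l. c l * lam l) a a"
    unfolding l_eq by (rule suminf_nonneg[OF l_sum l_nonneg])
  assume "\<exists>x\<in>X. a x \<noteq> 0"
  then have pos: "0 < energy c a a" by (rule energy_pos[OF a])
  have "\<exists>l. c l * s l \<noteq> 0"
  proof (rule ccontr)
    assume "\<not> ?thesis"
    then have "(\<lambda>l. c l * s l) = (\<lambda>l. 0)" by auto
    with c_sums pos show False using sums_unique2[OF sums_zero, of "energy c a a"] by simp
  qed
  then obtain l where "c l * s l \<noteq> 0" by blast
  then have "0 < c l * s l" "0 < lam l" using nonneg[of l] by (simp only: less_le, auto)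
  then have "0 < c l * lam l * s l" by (metis mult.assoc mult.commute mult_pos_pos)
  then show "0 < energy (\<lambda>l. c l * lam l) a a"
    unfolding l_eq using suminf_pos2[OF l_sum l_nonneg] by blast
qed

section \<open>Interpolation on X and the spectrum\<close>

text \<open>If \<open>v\<close> were not attained, some \<open>w\<close> would annihilate all trial
  functions on \<open>X\<close> but not \<open>v\<close>. Then \<open>w\<close> annihilates the
  polynomials, so \<open>trial w 0\<close> is itself a trial function; its pairing with
  \<open>w\<close> is the energy of \<open>w\<close>, which is therefore 0, and \<open>w\<close>
  vanishes on \<open>X\<close>.\<close>

lemma trial_interpolation:
  obtains a b where "annihilates V X a" "\<And>x. x \<in> X \<Longrightarrow> trial a b x = v x"
proof -
  have "\<exists>u\<in>trial_space V \<Phi> X. \<forall>x\<in>X. u x = v x"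
  proof (rule ccontr)
    assume neg: "\<not> ?thesis"
    have "\<exists>w. (\<forall>u\<in>trial_space V \<Phi> X. (\<Sum>x\<in>X. w x * u x) = 0) \<and> (\<Sum>x\<in>X. w x * v x) \<noteq> 0"
    proof (rule exists_separating_functional[OF X(1)])
      show "(\<lambda>x. 0) \<in> trial_space V \<Phi> X"
        unfolding trial_space_iff
        by (intro exI[of _ "\<lambda>_. 0"] exI[of _ "\<lambda>_ _. 0"]) (simp add: annihilates_def trial_def harmonic_comb_def fun_eq_iff)
    next
      fix f g assume "f \<in> trial_space V \<Phi> X" "g \<in> trial_space V \<Phi> X"
      then obtain a b a' b' where "annihilates V X a" "f = trial a b" "annihilates V X a'" "g = trial a' b'"
        unfolding trial_space_iff by blast
      then show "(\<lambda>x. f x + g x) \<in> trial_space V \<Phi> X"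
        unfolding trial_space_iff
        by (intro exI[of _ "\<lambda>x. a x + a' x"] exI[of _ "\<lambda>l \<mu>. b l \<mu> + b' l \<mu>"])
           (simp add: annihilates_def trial_def harmonic_comb_def fun_eq_iff distrib_right sum.distrib)
    next
      fix t f assume "f \<in> trial_space V \<Phi> X"
      then obtain a b where "annihilates V X a" "f = trial a b" unfolding trial_space_iff by blast
      then show "(\<lambda>x. t * f x) \<in> trial_space V \<Phi> X"
        unfolding trial_space_iff
        by (intro exI[of _ "\<lambda>x. t * a x"] exI[of _ "\<lambda>l \<mu>. t * b l \<mu>"])
           (simp add: annihilates_def trial_def harmonic_comb_def fun_eq_iff distrib_left mult.assoc sum_distrib_left[symmetric])
    qed (use neg in blast)
    then obtain w where w: "\<And>u. u \<in> trial_space V \<Phi> X \<Longrightarrow> (\<Sum>x\<in>X. w x * u x) = 0" "(\<Sum>x\<in>X. w x * v x) \<noteq> 0"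
      by blast
    have ann: "annihilates V X w"
      unfolding annihilates_def
    proof
      fix q assume "q \<in> V"
      then obtain b where "q = harmonic_comb b" unfolding V_iff by blast
      then have "q \<in> trial_space V \<Phi> X"
        unfolding trial_space_iff
        by (intro exI[of _ "\<lambda>_. 0"] exI[of _ b]) (simp add: annihilates_def trial_def fun_eq_iff)
      then show "(\<Sum>x\<in>X. w x * q x) = 0" by (rule w(1))
    qed
    then have "trial w (\<lambda>_ _. 0) \<in> trial_space V \<Phi> X" unfolding trial_space_iff by blast
    from w(1)[OF this] have "energy c w w = 0" unfolding pair_trial(1)[OF ann] .
    with energy_pos[OF ann] have "\<forall>x\<in>X. w x = 0" by fastforce
    with w(2) show False by simp
  qed
  then obtain u where u: "u \<in> trial_space V \<Phi> X" "\<forall>x\<in>X. u x = v x" by blast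
  then obtain a b where "annihilates V X a" "u = trial a b" unfolding trial_space_iff by blast
  with u(2) show ?thesis by (intro that) auto
qed

text \<open>Pairing with \<open>a\<close> shows that its energy is 0, hence \<open>a = 0\<close> on
  \<open>X\<close>; unisolvence then removes the polynomial coefficients.\<close>

lemma trial_zero_on_X:
  assumes a: "annihilates V X a" and z: "\<And>x. x \<in> X \<Longrightarrow> trial a b x = 0"
  shows "x \<in> X \<Longrightarrow> a x = 0" "l \<le> M \<Longrightarrow> \<mu> \<in> {1..N l} \<Longrightarrow> b l \<mu> = 0"
proof -
  have "energy c a a = 0" using pair_trial(1)[OF a, of a b] z by simp
  with energy_pos[OF a] have a0: "a x = 0" if "x \<in> X" for x using that by fastforce
  then show "x \<in> X \<Longrightarrow> a x = 0" .
  have "harmonic_comb b x = 0" if "x \<in> X" for x using z[OF that] a0 by (simp add: trial_def)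
  then show "l \<le> M \<Longrightarrow> \<mu> \<in> {1..N l} \<Longrightarrow> b l \<mu> = 0" by (rule harmonic_comb_zero_on_X)
qed

text \<open>Values on \<open>X\<close> determine the coefficients that matter, and hence the values
  of the operator on \<open>X\<close>. The difference of the two sides is again a trial function,
  with coefficients \<open>?a\<close> and \<open>?b\<close>, to which \<open>trial_zero_on_X\<close>
  applies.\<close>

lemma L_trial_expansion:
  assumes J: "finite J" and a: "annihilates V X a" and aj: "\<And>j. j \<in> J \<Longrightarrow> annihilates V X (a' j)"
    and eq: "\<And>x. x \<in> X \<Longrightarrow> trial a b x = (\<Sum>j\<in>J. t j * trial (a' j) (b' j) x)"
    and x: "x \<in> X"
  shows "L (trial a b) x = (\<Sum>j\<in>J. t j * L (trial (a' j) (b' j)) x)"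
proof -
  let ?a = "\<lambda>y. a y - (\<Sum>j\<in>J. t j * a' j y)" and ?b = "\<lambda>l \<mu>. b l \<mu> - (\<Sum>j\<in>J. t j * b' j l \<mu>)"
  have swap_comb: "harmonic_comb (\<lambda>l \<mu>. g l \<mu> - (\<Sum>j\<in>J. t j * g' j l \<mu>)) x = harmonic_comb g x - (\<Sum>j\<in>J. t j * harmonic_comb (g' j) x)" for g g' x
  proof -
    have "(\<Sum>l\<le>M. \<Sum>\<mu>=1..N l. (\<Sum>j\<in>J. t j * g' j l \<mu>) * Y l \<mu> x) = (\<Sum>l\<le>M. \<Sum>\<mu>=1..N l. \<Sum>j\<in>J. t j * (g' j l \<mu> * Y l \<mu> x))"
      by (simp add: sum_distrib_right mult.assoc)
    also have "\<dots> = (\<Sum>l\<le>M. \<Sum>j\<in>J. \<Sum>\<mu>=1..N l. t j * (g' j l \<mu> * Y l \<mu> x))"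
      by (intro sum.cong refl sum.swap)
    also have "\<dots> = (\<Sum>j\<in>J. \<Sum>l\<le>M. \<Sum>\<mu>=1..N l. t j * (g' j l \<mu> * Y l \<mu> x))"
      by (rule sum.swap)
    finally show ?thesis unfolding harmonic_comb_def by (simp add: left_diff_distrib sum_subtractf sum_distrib_left)
  qed
  have swap_sum: "(\<Sum>y\<in>X. ?a y * k y) = (\<Sum>y\<in>X. a y * k y) - (\<Sum>j\<in>J. t j * (\<Sum>y\<in>X. a' j y * k y))" for k
  proof -
    have "(\<Sum>y\<in>X. (\<Sum>j\<in>J. t j * a' j y) * k y) = (\<Sum>y\<in>X. \<Sum>j\<in>J. t j * (a' j y * k y))"
      by (simp add: sum_distrib_right mult.assoc)
    also have "\<dots> = (\<Sum>j\<in>J. \<Sum>y\<in>X. t j * (a' j y * k y))" by (rule sum.swap)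
    finally show ?thesis by (simp add: left_diff_distrib sum_subtractf sum_distrib_left)
  qed
  have ann: "annihilates V X ?a"
    using a aj unfolding annihilates_def by (simp add: swap_sum)
  have "trial ?a ?b x = 0" if "x \<in> X" for x
    using eq[OF that] unfolding trial_def swap_sum swap_comb by (simp add: distrib_left sum.distrib)
  note zero = trial_zero_on_X[OF ann this]
  have "L (trial ?a ?b) x = 0"
    unfolding L_trial[OF x] harmonic_comb_def using zero by simp
  moreover have "harmonic_comb (\<lambda>l \<mu>. lam l * ?b l \<mu>) x
      = harmonic_comb (\<lambda>l \<mu>. lam l * b l \<mu>) x - (\<Sum>j\<in>J. t j * harmonic_comb (\<lambda>l \<mu>. lam l * b' j l \<mu>) x)"
    unfolding swap_comb[symmetric] by (simp add: right_diff_distrib sum_distrib_left mult_ac)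
  ultimately show ?thesis
    unfolding L_trial[OF x] swap_sum by (simp add: distrib_left sum.distrib)
qed

text \<open>
  Here \<open>trial a b\<close> and \<open>trial a' b'\<close> are the real and imaginary part of an eigenfunction for the
  eigenvalue \<open>\<sigma> + \<i> \<omega>\<close>. Pairing the eigenvalue equation with \<open>a - \<i> a'\<close> removes the polynomial part.
\<close>

lemma eigenvalue_positive:
  assumes a: "annihilates V X a" "annihilates V X a'"
    and eig: "\<And>x. x \<in> X \<Longrightarrow> L (trial a b) x = \<sigma> * trial a b x - \<omega> * trial a' b' x"
      "\<And>x. x \<in> X \<Longrightarrow> L (trial a' b') x = \<omega> * trial a b x + \<sigma> * trial a' b' x"
    and nz: "\<exists>x\<in>X. trial a b x \<noteq> 0 \<or> trial a' b' x \<noteq> 0"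
  shows "\<omega> = 0 \<and> 0 < \<sigma>"
proof -
  let ?B = "energy c" and ?BL = "energy (\<lambda>l. c l * lam l)"
  have p1: "?BL w a = \<sigma> * ?B w a - \<omega> * ?B w a'" if w: "annihilates V X w" for w
  proof -
    have "?BL w a = (\<Sum>x\<in>X. \<sigma> * (w x * trial a b x) - \<omega> * (w x * trial a' b' x))"
      unfolding pair_trial(2)[OF w, of a b, symmetric] by (intro sum.cong refl) (simp add: eig algebra_simps)
    then show ?thesis unfolding sum_subtractf sum_distrib_left[symmetric] pair_trial(1)[OF w] .
  qed
  have p2: "?BL w a' = \<omega> * ?B w a + \<sigma> * ?B w a'" if w: "annihilates V X w" for w
  proof -
    have "?BL w a' = (\<Sum>x\<in>X. \<omega> * (w x * trial a b x) + \<sigma> * (w x * trial a' b' x))"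
      unfolding pair_trial(2)[OF w, of a' b', symmetric] by (intro sum.cong refl) (simp add: eig algebra_simps)
    then show ?thesis unfolding sum.distrib sum_distrib_left[symmetric] pair_trial(1)[OF w] .
  qed
  \<comment> \<open>The first equation is tested with \<open>a\<close>, the second with
    \<open>a'\<close>; by symmetry the terms with \<omega> cancel. Testing crosswise instead cancels
    the terms with \<sigma> in \<open>imag_part\<close>.\<close>
  have real_part: "?BL a a + ?BL a' a' = \<sigma> * (?B a a + ?B a' a')"
    using p1[OF a(1)] p2[OF a(2)] energy_commute[of c a a'] by (simp add: algebra_simps)
  have imag_part: "0 = \<omega> * (?B a a + ?B a' a')"
    using p2[OF a(1)] p1[OF a(2)] energy_commute[of c a a'] energy_commute[of "\<lambda>l. c l * lam l" a a']
    by (simp add: algebra_simps)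
  show ?thesis
  proof (cases "(\<exists>x\<in>X. a x \<noteq> 0) \<or> (\<exists>x\<in>X. a' x \<noteq> 0)")
    case True
    have nonneg: "0 \<le> ?B w w" if "annihilates V X w" for w
      using energy_pos[OF that] energy_zero[of w c w] by (cases "\<exists>x\<in>X. w x \<noteq> 0") auto
    have "0 < ?B a a + ?B a' a'"
      using True energy_pos[OF a(1)] energy_pos[OF a(2)] nonneg[OF a(1)] nonneg[OF a(2)]
      by (elim disjE) (auto intro: add_pos_nonneg add_nonneg_pos)
    moreover have "0 < ?BL a a + ?BL a' a'"
      using True L_energy[OF a(1)] L_energy[OF a(2)] by (auto intro: add_pos_nonneg add_nonneg_pos)
    ultimately show ?thesis using real_part imag_part by (auto simp: zero_less_mult_iff)
  next
    case False
    then have tr: "trial a b x = harmonic_comb b x" "trial a' b' x = harmonic_comb b' x" for x by (simp_all add: trial_def)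
    have lt: "L (trial a b) x = harmonic_comb (\<lambda>l \<mu>. lam l * b l \<mu>) x" "L (trial a' b') x = harmonic_comb (\<lambda>l \<mu>. lam l * b' l \<mu>) x"
      if "x \<in> X" for x using False that by (simp_all add: L_trial)
    \<comment> \<open>In the purely polynomial case the defect of the eigenvalue equation is a
      polynomial vanishing on \<open>X\<close>, so unisolvence allows comparing
      coefficients.\<close>
    have "harmonic_comb (\<lambda>l \<mu>. lam l * b l \<mu> - (\<sigma> * b l \<mu> - \<omega> * b' l \<mu>)) x = 0" if "x \<in> X" for x
      using eig(1)[OF that] unfolding lt[OF that] tr
      by (simp add: harmonic_comb_def sum_distrib_left sum_subtractf left_diff_distrib mult.assoc)
    from harmonic_comb_zero_on_X[OF this] have 1: "lam l * b l \<mu> = \<sigma> * b l \<mu> - \<omega> * b' l \<mu>" if "l \<le> M" "\<mu> \<in> {1..N l}" for l \<mu>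
      using that by fastforce
    have "harmonic_comb (\<lambda>l \<mu>. lam l * b' l \<mu> - (\<omega> * b l \<mu> + \<sigma> * b' l \<mu>)) x = 0" if "x \<in> X" for x
      using eig(2)[OF that] unfolding lt[OF that] tr
      by (simp add: harmonic_comb_def sum_distrib_left sum_subtractf sum.distrib left_diff_distrib distrib_right mult.assoc)
    from harmonic_comb_zero_on_X[OF this] have 2: "lam l * b' l \<mu> = \<omega> * b l \<mu> + \<sigma> * b' l \<mu>" if "l \<le> M" "\<mu> \<in> {1..N l}" for l \<mu>
      using that by fastforce
    have "\<exists>l\<le>M. \<exists>\<mu>\<in>{1..N l}. b l \<mu> \<noteq> 0 \<or> b' l \<mu> \<noteq> 0"
    proof (rule ccontr)
      assume "\<not> ?thesis"
      then have "harmonic_comb b x = 0 \<and> harmonic_comb b' x = 0" for x by (simp add: harmonic_comb_def)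
      with nz tr show False by auto
    qed
    then obtain l \<mu> where l: "l \<le> M" "\<mu> \<in> {1..N l}" and bnz: "b l \<mu> \<noteq> 0 \<or> b' l \<mu> \<noteq> 0" by blast
    let ?p = "b l \<mu>" and ?q = "b' l \<mu>"
    have pos: "0 < ?p * ?p + ?q * ?q" using bnz by (simp add: sum_squares_gt_zero_iff)
    \<comment> \<open>The two coefficient equations state lam (p + i q) = (\<sigma> + i \<omega>) (p
      + i q); testing with (p, q) isolates \<sigma>.\<close>
    have "lam l * (?p * ?p + ?q * ?q) = (lam l * ?p) * ?p + (lam l * ?q) * ?q" by (simp add: algebra_simps)
    also have "\<dots> = \<sigma> * (?p * ?p + ?q * ?q)" unfolding 1[OF l] 2[OF l] by (simp add: algebra_simps)
    finally have "lam l = \<sigma>" using pos by auto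
    moreover have "0 < lam l" using l by (intro lam_pos) auto
    moreover have "\<omega> = 0"
    proof -
      have "\<omega> * ?q = 0" "\<omega> * ?p = 0" using 1[OF l] 2[OF l] \<open>lam l = \<sigma>\<close> by auto
      then show ?thesis using bnz by auto
    qed
    ultimately show ?thesis by simp
  qed
qed

text \<open>Interpolating the indicators of single points yields the cardinal functions and thereby
  the matrix. Interpolating the real and imaginary part of a complex eigenvector yields the pair of
  trial functions for \<open>eigenvalue_positive\<close>.\<close>

lemma spectrum_differentiation_matrix:
  assumes xs: "distinct xs" "set xs = X"
  shows "spectrum (map_mat complex_of_real (differentiation_matrix (trial_space V \<Phi> X) L xs))
    \<subseteq> complex_of_real ` {0<..}"
proof
  let ?n = "length xs"
  have "\<exists>a b. annihilates V X a \<and> (\<forall>x\<in>X. trial a b x = (if x = z then 1 else 0))" for z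
    by (rule trial_interpolation[of "\<lambda>x. if x = z then 1 else 0"]) blast
  then obtain a b where a: "\<And>z. annihilates V X (a z)"
    and ab: "\<And>z x. x \<in> X \<Longrightarrow> trial (a z) (b z) x = (if x = z then 1 else 0)" by metis
  define u where "u k = trial (a (xs ! k)) (b (xs ! k))" for k
  have mem: "xs ! i \<in> X" if "i < ?n" for i using that xs(2) by auto
  have u_nth: "u k (xs ! i) = (if i = k then 1 else 0)" if "k < ?n" "i < ?n" for k i
    using that xs(1) ab[OF mem[OF that(2)]] by (simp add: u_def nth_eq_iff_index_eq)
  have sum_nth: "(\<Sum>k<?n. g k * u k x) = g i" if "i < ?n" "x = xs ! i" for g i x
  proof -
    have "(\<Sum>k<?n. g k * u k x) = (\<Sum>k<?n. if i = k then g k else 0)"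
      by (intro sum.cong refl) (use that u_nth in auto)
    then show ?thesis using that by simp
  qed
  have expand: "L (trial a' b') x = (\<Sum>k<?n. trial a' b' (xs ! k) * L (u k) x)"
    if a': "annihilates V X a'" and x: "x \<in> X" for a' b' x
    unfolding u_def
  proof (rule L_trial_expansion[OF _ a' _ _ x])
    fix y assume "y \<in> X"
    then obtain i where "i < ?n" "y = xs ! i" using xs by (metis in_set_conv_nth)
    then show "trial a' b' y = (\<Sum>k<?n. trial a' b' (xs ! k) * trial (a (xs ! k)) (b (xs ! k)) y)"
      using sum_nth[of i y "\<lambda>k. trial a' b' (xs ! k)"] unfolding u_def by simp
  qed (auto intro: a)
  define A where "A = mat ?n ?n (\<lambda>(i, k). L (u k) (xs ! i))"
  have A: "differentiation_matrix (trial_space V \<Phi> X) L xs = A"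
    unfolding A_def
  proof (rule differentiation_matrix_eq[OF xs(1)])
    show "u k \<in> trial_space V \<Phi> X" for k unfolding trial_space_iff u_def using a by blast
    show "L f x = (\<Sum>k<?n. f (xs ! k) * L (u k) x)" if "f \<in> trial_space V \<Phi> X" "x \<in> set xs" for f x
      using that expand xs(2) unfolding trial_space_iff by auto
  qed (rule u_nth)
  fix \<tau> assume "\<tau> \<in> spectrum (map_mat complex_of_real (differentiation_matrix (trial_space V \<Phi> X) L xs))"
  then obtain v where v: "v \<in> carrier_vec ?n" "v \<noteq> 0\<^sub>v ?n" "map_mat complex_of_real A *\<^sub>v v = \<tau> \<cdot>\<^sub>v v"
    unfolding A spectrum_def eigenvalue_def eigenvector_def by (auto simp: A_def)
  have row: "(\<Sum>k<?n. complex_of_real (A $$ (i, k)) * v $ k) = \<tau> * v $ i" if i: "i < ?n" for i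
  proof -
    have "(map_mat complex_of_real A *\<^sub>v v) $ i = (\<Sum>k = 0..<?n. complex_of_real (A $$ (i, k)) * v $ k)"
      using i v(1) by (auto simp: A_def scalar_prod_def intro!: sum.cong)
    then show ?thesis unfolding v(3) using i v(1) by (simp add: atLeast0LessThan)
  qed
  \<comment> \<open>The inverse of the enumeration \<open>xs\<close>, turning vector entries into
    data on \<open>X\<close>.\<close>
  define idx where "idx x = (SOME i. i < ?n \<and> xs ! i = x)" for x
  have idx: "idx (xs ! i) = i" if "i < ?n" for i
  proof -
    have "idx (xs ! i) < ?n \<and> xs ! idx (xs ! i) = xs ! i" unfolding idx_def by (rule someI[of _ i]) (use that in simp)
    then show ?thesis using nth_eq_iff_index_eq[OF xs(1)] that by blast
  qed
  obtain ar br where ar: "annihilates V X ar" and r: "\<And>x. x \<in> X \<Longrightarrow> trial ar br x = Re (v $ idx x)"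
    by (rule trial_interpolation[of "\<lambda>x. Re (v $ idx x)"]) blast
  obtain ai bi where ai: "annihilates V X ai" and im: "\<And>x. x \<in> X \<Longrightarrow> trial ai bi x = Im (v $ idx x)"
    by (rule trial_interpolation[of "\<lambda>x. Im (v $ idx x)"]) blast
  have r': "trial ar br (xs ! i) = Re (v $ i)" and im': "trial ai bi (xs ! i) = Im (v $ i)" if "i < ?n" for i
    using r[OF mem[OF that]] im[OF mem[OF that]] idx[OF that] by simp_all
  have Lr: "L (trial ar br) x = Re \<tau> * trial ar br x - Im \<tau> * trial ai bi x"
    and Li: "L (trial ai bi) x = Im \<tau> * trial ar br x + Re \<tau> * trial ai bi x" if "x \<in> X" for x
  proof -
    have "x \<in> set xs" using that by (simp only: xs(2))
    then obtain i where "i < ?n" "xs ! i = x" unfolding in_set_conv_nth by (elim exE conjE)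
    then have i: "i < ?n" "x = xs ! i" by simp_all
    have "L (trial ar br) x = Re (\<Sum>k<?n. complex_of_real (A $$ (i, k)) * v $ k)"
      by (subst expand[OF ar that], subst Re_sum, intro sum.cong refl) (use i in \<open>simp add: r' A_def\<close>)
    then show "L (trial ar br) x = Re \<tau> * trial ar br x - Im \<tau> * trial ai bi x"
      unfolding row[OF i(1)] using i by (simp add: r' im')
    have "L (trial ai bi) x = Im (\<Sum>k<?n. complex_of_real (A $$ (i, k)) * v $ k)"
      by (subst expand[OF ai that], subst Im_sum, intro sum.cong refl) (use i in \<open>simp add: im' A_def\<close>)
    then show "L (trial ai bi) x = Im \<tau> * trial ar br x + Re \<tau> * trial ai bi x"
      unfolding row[OF i(1)] using i by (simp add: r' im')
  qed
  have "\<exists>i<?n. v $ i \<noteq> 0" using v(1,2) by (metis carrier_vecD eq_vecI index_zero_vec(1,2))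
  then obtain i where "i < ?n" "v $ i \<noteq> 0" by blast
  then have "\<exists>x\<in>X. trial ar br x \<noteq> 0 \<or> trial ai bi x \<noteq> 0"
    by (intro bexI[of _ "xs ! i"] mem) (simp_all add: r' im' complex_eq_iff)
  from eigenvalue_positive[OF ar ai Lr Li this] have "Im \<tau> = 0" "0 < Re \<tau>" by auto
  then show "\<tau> \<in> complex_of_real ` {0<..}"
    by (intro image_eqI[of _ _ "Re \<tau>"]) (auto simp: complex_eq_iff)
qed

end

theorem mainTheorem4:
  fixes d m :: nat
    and Y :: "nat \<Rightarrow> nat \<Rightarrow> 'a::euclidean_space \<Rightarrow> real"
    and N :: "nat \<Rightarrow> nat"
    and c lam :: "nat \<Rightarrow> real"
    and p :: "real \<Rightarrow> real"
    and \<Phi> :: "'a \<Rightarrow> 'a \<Rightarrow> real"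
    and X :: "'a set"
    and xs :: "'a list"
  assumes "DIM('a) = d + 1"
    and "d \<ge> 2"
    and "m \<ge> 1"
    and "spherical_harmonic_bases Y N"
    and "zonal_kernel Y N c \<Phi>"
    and "conditionally_positive_definite (harmonic_span Y N (m - 1)) \<Phi>"
    and "\<forall>\<nu>\<in>laplace_beltrami_spectrum TYPE('a). p \<nu> > 0"
    and "\<forall>l. lam l = p (sphere_eigenvalue d l)"
    and "\<exists>k::nat. lam \<in> O(\<lambda>l. real l ^ k)"
    and "summable (\<lambda>l. \<bar>c l * \<bar>lam l\<bar> * real l ^ (d - 1)\<bar>)"
    and "finite X"
    and "X \<subseteq> sphere 0 1"
    and "unisolvent (harmonic_span Y N (m - 1)) X"
    and "distinct xs"
    and "set xs = X"
  shows "spectrum (map_mat complex_of_real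
           (differentiation_matrix
              (trial_space (harmonic_span Y N (m - 1)) \<Phi> X)
              (harmonic_multiplier Y N lam) xs))
         \<subseteq> complex_of_real ` {0<..}"
proof -
  interpret hb: harmonic_bases Y N
    by unfold_locales (use assms(1,2,4) in auto)
  have dim: "DIM('a) - 2 = d - 1" using assms(1,2) by simp
  have lam_pos: "0 < lam l" if "0 < N l" for l
  proof -
    have one: "1 \<in> {1..N l}" using that by simp
    \<comment> \<open>The first basis harmonic has norm 1, so it does not vanish on the sphere and
      is a genuine eigenfunction; thus \<open>p\<close> is positive at its eigenvalue.\<close>
    have "\<exists>x\<in>sphere 0 1. hb.P l 1 x \<noteq> 0"
    proof (rule ccontr)
      assume neg: "\<not> ?thesis"
      have "Y l 1 x = 0" if "x \<in> sphere 0 1" for x using hb.P(2)[OF one that] neg that by auto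
      then have "sphere_inner (Y l 1) (Y l 1) = sphere_inner (\<lambda>x::'a. 0) (\<lambda>x. 0)"
        by (intro sphere_inner_cong) auto
      then show False using hb.sphere_inner_Y[OF one one] by (simp add: sphere_inner_def)
    qed
    from sphere_eigenvalue_in_spectrum[OF hb.P(1)[OF one] this assms(1)] assms(7,8)
    show ?thesis by simp
  qed
  interpret cpd_kernel Y N c lam \<Phi> X "m - 1"
    by unfold_locales (use assms(5,6,10-13) dim lam_pos in auto)
  show ?thesis by (rule spectrum_differentiation_matrix[OF assms(14,15)])
qed

end
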